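(* Consider the compound MAC model with arbitrarily correlated sources and side information, where there is no multiple access interference: receiver $k$'s channel output is $Y_k=(Y_{1,k},Y_{2,k})$ and the memoryless channel satisfies $$p(y_{1,1},y_{2,1},y_{1,2},y_{2,2}|x_1,x_2)=p(y_{1,1},y_{1,2}|x_1)\,p(y_{2,1},y_{2,2}|x_2).$$ Source-channel rate $b$ is achievable if there exists an input distribution $p(x_1)p(x_2)$ such that for $(k,l)\in\{(1,2),(2,1)\}$: $$H(S_k|S_l,W_k)<b\,I(X_k;Y_{k,k}),\quad H(S_l|S_k,W_k)<b\,I(X_l;Y_{l,k}),\quad H(S_k,S_l|W_k)<b\,[I(X_k;Y_{k,k})+I(X_l;Y_{l,k})].$$ Conversely, if $b$ is achievable then these inequalities hold with $<$ replaced by $\le$ for some input distribution of product form.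
   Context: Compound MAC model: $\{(S_{1,k},S_{2,k},W_{1,k},W_{2,k})\}_{k\ge1}$ i.i.d. $\sim p(s_1,s_2,w_1,w_2)$ on finite alphabets. Transmitter $i\in\{1,2\}$ observes $S_i^m$ and sends $X_i^n=f_i^{(m,n)}(S_i^m)$. The channel is discrete memoryless with finite alphabets. Receiver $k\in\{1,2\}$ observes $(Y_k^n,W_k^m)$ and outputs $(\hat S_{k,1}^m,\hat S_{k,2}^m)=g_k^{(m,n)}(Y_k^n,W_k^m)$, an estimate of both sources. Error probability $P_e^{(m,n)}=\Pr\{\bigcup_{k=1,2}\{(S_1^m,S_2^m)\neq(\hat S_{k,1}^m,\hat S_{k,2}^m)\}\}$. Rate $b$ is achievable if for every $\epsilon>0$ there exist positive integers $m,n$ with $n/m=b$ and encoders/decoders with $P_e^{(m,n)}<\epsilon$.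
   Formalization: The achievability direction is stated for rational b only: since achievability requires n/m = b with positive integers m, n, no irrational rate can be achievable, so the claim as written fails for irrational b even when the strict inequalities hold. *)

theory Defs
  imports "HOL-Probability.Probability"
begin

definition ent :: "'a::finite pmf \<Rightarrow> real" where
  "ent p = - (\<Sum>x\<in>UNIV. pmf p x * log 2 (pmf p x))"

definition cond_ent :: "('a::finite \<times> 'b::finite) pmf \<Rightarrow> real" where
  "cond_ent J = - (\<Sum>ab\<in>UNIV. pmf J ab * log 2 (pmf J ab / pmf (map_pmf snd J) (snd ab)))"

definition mut_inf :: "('a::finite \<times> 'b::finite) pmf \<Rightarrow> real" where
  "mut_inf J = (\<Sum>ab\<in>UNIV. pmf J ab *
      log 2 (pmf J ab / (pmf (map_pmf fst J) (fst ab) * pmf (map_pmf snd J) (snd ab))))"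

text \<open>Source letter: (s1, s2, w1, w2) with joint pmf P (i.i.d. over time).
  Channel: W x1 x2 is a pmf on (Y_1, Y_2), the outputs at receivers 1 and 2.
  Sequences are lists.\<close>

definition s1_of :: "'s1 \<times> 's2 \<times> 'w1 \<times> 'w2 \<Rightarrow> 's1" where "s1_of u = fst u"
definition s2_of :: "'s1 \<times> 's2 \<times> 'w1 \<times> 'w2 \<Rightarrow> 's2" where "s2_of u = fst (snd u)"
definition w1_of :: "'s1 \<times> 's2 \<times> 'w1 \<times> 'w2 \<Rightarrow> 'w1" where "w1_of u = fst (snd (snd u))"
definition w2_of :: "'s1 \<times> 's2 \<times> 'w1 \<times> 'w2 \<Rightarrow> 'w2" where "w2_of u = snd (snd (snd u))"

definition err_prob ::
  "('s1 \<times> 's2 \<times> 'w1 \<times> 'w2) pmf \<Rightarrow> ('x1 \<Rightarrow> 'x2 \<Rightarrow> ('y1 \<times> 'y2) pmf) \<Rightarrow> nat \<Rightarrow> nat \<Rightarrow>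
   ('s1 list \<Rightarrow> 'x1 list) \<Rightarrow> ('s2 list \<Rightarrow> 'x2 list) \<Rightarrow>
   ('y1 list \<Rightarrow> 'w1 list \<Rightarrow> 's1 list \<times> 's2 list) \<Rightarrow>
   ('y2 list \<Rightarrow> 'w2 list \<Rightarrow> 's1 list \<times> 's2 list) \<Rightarrow> real" where
  "err_prob P W m n f1 f2 g1 g2 =
    (\<Sum>u\<in>{u. length u = m}. (\<Prod>i<m. pmf P (u ! i)) *
      (\<Sum>y\<in>{y. length y = n}.
         (\<Prod>j<n. pmf (W (f1 (map s1_of u) ! j) (f2 (map s2_of u) ! j)) (y ! j)) *
         (if g1 (map fst y) (map w1_of u) = (map s1_of u, map s2_of u)
             \<and> g2 (map snd y) (map w2_of u) = (map s1_of u, map s2_of u)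
          then 0 else 1)))"

definition achievable ::
  "('s1 \<times> 's2 \<times> 'w1 \<times> 'w2) pmf \<Rightarrow> ('x1 \<Rightarrow> 'x2 \<Rightarrow> ('y1 \<times> 'y2) pmf) \<Rightarrow> real \<Rightarrow> bool" where
  "achievable P W b \<longleftrightarrow>
    (\<forall>\<epsilon>>0. \<exists>m n (f1 :: 's1 list \<Rightarrow> 'x1 list) (f2 :: 's2 list \<Rightarrow> 'x2 list)
                 (g1 :: 'y1 list \<Rightarrow> 'w1 list \<Rightarrow> 's1 list \<times> 's2 list)
                 (g2 :: 'y2 list \<Rightarrow> 'w2 list \<Rightarrow> 's1 list \<times> 's2 list).
       0 < m \<and> 0 < n \<and> real n / real m = b \<and>
       (\<forall>s. length s = m \<longrightarrow> length (f1 s) = n) \<and>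
       (\<forall>s. length s = m \<longrightarrow> length (f2 s) = n) \<and>
       err_prob P W m n f1 f2 g1 g2 < \<epsilon>)"

definition in_joint :: "'x1 pmf \<Rightarrow> 'x2 pmf \<Rightarrow> ('x1 \<Rightarrow> 'x2 \<Rightarrow> 'y pmf) \<Rightarrow> ('x1 \<times> 'x2 \<times> 'y) pmf" where
  "in_joint P1 P2 W =
     bind_pmf P1 (\<lambda>x1. bind_pmf P2 (\<lambda>x2. map_pmf (\<lambda>y. (x1, x2, y)) (W x1 x2)))"

text \<open>The six rate conditions of the theorem, for (k,l) = (1,2) and (2,1), with comparison R
  (strict < for the direct part, \<le> for the converse).
  Receiver outputs: Y_1 = (Y_{1,1}, Y_{2,1}), Y_2 = (Y_{1,2}, Y_{2,2}).\<close>
definition rate_conds ::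
  "(real \<Rightarrow> real \<Rightarrow> bool) \<Rightarrow> real \<Rightarrow>
   ('s1::finite \<times> 's2::finite \<times> 'w1::finite \<times> 'w2::finite) pmf \<Rightarrow>
   ('x1::finite \<Rightarrow> 'x2::finite \<Rightarrow> (('y11::finite \<times> 'y21::finite) \<times> ('y12::finite \<times> 'y22::finite)) pmf) \<Rightarrow>
   'x1 pmf \<Rightarrow> 'x2 pmf \<Rightarrow> bool" where
  "rate_conds R b P W P1 P2 \<longleftrightarrow>
    (let J = in_joint P1 P2 W;
         I11 = mut_inf (map_pmf (\<lambda>(x1, x2, y). (x1, fst (fst y))) J);
         I21 = mut_inf (map_pmf (\<lambda>(x1, x2, y). (x2, snd (fst y))) J);
         I12 = mut_inf (map_pmf (\<lambda>(x1, x2, y). (x1, fst (snd y))) J);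
         I22 = mut_inf (map_pmf (\<lambda>(x1, x2, y). (x2, snd (snd y))) J);
         H1_2W1 = cond_ent (map_pmf (\<lambda>(s1, s2, w1, w2). (s1, (s2, w1))) P);
         H2_1W1 = cond_ent (map_pmf (\<lambda>(s1, s2, w1, w2). (s2, (s1, w1))) P);
         H12_W1 = cond_ent (map_pmf (\<lambda>(s1, s2, w1, w2). ((s1, s2), w1)) P);
         H2_1W2 = cond_ent (map_pmf (\<lambda>(s1, s2, w1, w2). (s2, (s1, w2))) P);
         H1_2W2 = cond_ent (map_pmf (\<lambda>(s1, s2, w1, w2). (s1, (s2, w2))) P);
         H12_W2 = cond_ent (map_pmf (\<lambda>(s1, s2, w1, w2). ((s1, s2), w2)) P)
     in R H1_2W1 (b * I11) \<and> R H2_1W1 (b * I21) \<and> R H12_W1 (b * (I11 + I21)) \<and>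
        R H2_1W2 (b * I22) \<and> R H1_2W2 (b * I12) \<and> R H12_W2 (b * (I22 + I12)))"

end

theory Submission
  imports Defs
begin

text \<open>
  Direct part: draw all codewords independently from the input distributions and let a receiver
  accept a pair \<open>(s, t)\<close> if
  \<open>p(s | t, w) q(y\<^sub>1 | x\<^sub>1(s)) / r(y\<^sub>1)\<close>,
  \<open>p(t | s, w) q(y\<^sub>2 | x\<^sub>2(t)) / r(y\<^sub>2)\<close> and the corresponding joint product all exceed
  a threshold \<open>\<gamma>\<close>. Under an independent codeword the channel ratio has mean at most 1 and the
  conditional source probabilities sum to at most 1, so Markov's inequality bounds the probability
  that some wrong pair is accepted by \<open>3 / \<gamma>\<close>. By the weak law the true pair is accepted even for
  a \<open>\<gamma>\<close> that grows exponentially in the block length.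

  Converse: if \<open>E Z \<le> 1\<close> then \<open>E log Z \<le> 0\<close>. This is applied to the quotient of an auxiliary
  distribution by the true one; the auxiliary distribution is built from the decoder (as in Fano's
  inequality) and from the output distribution of the time-averaged input. With that input the
  per-letter terms add up to \<open>n I\<close> exactly, so neither chain rules nor concavity of mutual
  information are needed. Letting the error probability tend to 0, compactness of the simplices of
  input distributions yields the limiting inputs.
\<close>

section \<open>Expectations with finite support\<close>

text \<open>One pair of input distributions must satisfy six inequalities at two receivers, although
  correlated sources make the two codewords of a code dependent. Without interference each receiver
  faces a product of two point-to-point channels, so every information term involves one input
  marginal only, and neither the dependence between the inputs nor that between the receivers'
  outputs enters. The averaged inputs of the converse are determined by source and encoders alone,
  hence common to both receivers; in the direct part the errors of both receivers are averaged over
  the same random codebooks, so one pair of codebooks is good for both. A wrong pair has its first,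
  its second or both components wrong; only the codewords of wrong components are independent of the
  output, and this gives one threshold and one inequality for each case. A code has
  \<open>n / m = b\<close>, so an achievable \<open>b\<close> is rational: hence
  \<open>b \<in> \<rat>\<close> in the direct part, whose block lengths are equal multiples of
  numerator and denominator of one fraction for \<open>b\<close>.\<close>

abbreviation expct :: "'a pmf \<Rightarrow> ('a \<Rightarrow> real) \<Rightarrow> real" where
  "expct p f \<equiv> measure_pmf.expectation p f"

lemma expct_finite:
  "finite (set_pmf p) \<Longrightarrow> expct p f = (\<Sum>x\<in>set_pmf p. pmf p x * f x)"
  by (subst integral_measure_pmf[of "set_pmf p"]) auto

lemma expct_UNIV:
  fixes p :: "'a::finite pmf"
  shows "expct p f = (\<Sum>x\<in>UNIV. pmf p x * f x)"
  by (subst integral_measure_pmf[of UNIV]) auto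

lemma expct_bind:
  assumes "finite (set_pmf p)" "\<And>x. x \<in> set_pmf p \<Longrightarrow> finite (set_pmf (f x))"
  shows "expct (bind_pmf p f) h = expct p (\<lambda>x. expct (f x) h)"
  using pmf_expectation_bind[of "set_pmf p" f p h] assms by (simp add: expct_finite)

lemma expct_add:
  assumes "finite (set_pmf p)"
  shows "expct p (\<lambda>x. f x + g x) = expct p f + expct p g"
  using assms by (intro Bochner_Integration.integral_add integrable_measure_pmf_finite)

lemma expct_diff:
  assumes "finite (set_pmf p)"
  shows "expct p (\<lambda>x. f x - g x) = expct p f - expct p g"
  using assms by (intro Bochner_Integration.integral_diff integrable_measure_pmf_finite)

lemma expct_sum:
  assumes "finite (set_pmf p)"
  shows "expct p (\<lambda>x. \<Sum>i\<in>I. f i x) = (\<Sum>i\<in>I. expct p (f i))"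
  using assms by (intro Bochner_Integration.integral_sum integrable_measure_pmf_finite)

lemma expct_mono:
  assumes "finite (set_pmf p)" "\<And>x. x \<in> set_pmf p \<Longrightarrow> f x \<le> g x"
  shows "expct p f \<le> expct p g"
  using assms by (auto simp: expct_finite intro!: sum_mono mult_left_mono)

lemma expct_cong:
  assumes "\<And>x. x \<in> set_pmf p \<Longrightarrow> f x = g x"
  shows "expct p f = expct p g"
  using assms by (intro integral_cong_AE) (auto simp: AE_measure_pmf_iff)

text \<open>The route through the nonnegative integral avoids finiteness of the support: random
  coding conditions on output laws over arbitrary types.\<close>

lemma prob_bind:
  "measure_pmf.prob (bind_pmf p f) X = expct p (\<lambda>x. measure_pmf.prob (f x) X)"
proof -
  have "ennreal (measure_pmf.prob (bind_pmf p f) X) = emeasure (measure_pmf (bind_pmf p f)) X"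
    by (simp add: measure_pmf.emeasure_eq_measure)
  also have "\<dots> = (\<integral>\<^sup>+x. ennreal (measure_pmf.prob (f x) X) \<partial>measure_pmf p)"
    by (simp add: measure_pmf.emeasure_eq_measure[symmetric])
  also have "\<dots> = ennreal (expct p (\<lambda>x. measure_pmf.prob (f x) X))"
    by (intro nn_integral_eq_integral measure_pmf.integrable_const_bound[where B=1]) auto
  finally show ?thesis by (simp add: integral_nonneg_AE)
qed

lemma prob_bind_le:
  assumes "\<And>x. x \<in> set_pmf p \<Longrightarrow> measure_pmf.prob (f x) X \<le> c"
  shows "measure_pmf.prob (bind_pmf p f) X \<le> c"
proof -
  have "expct p (\<lambda>x. measure_pmf.prob (f x) X) \<le> expct p (\<lambda>_. c)"
    by (intro integral_mono_AE measure_pmf.integrable_const measure_pmf.integrable_const_bound[where B=1])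
       (auto simp: AE_measure_pmf_iff assms)
  then show ?thesis by (simp add: prob_bind)
qed

lemma markov_prob:
  assumes "finite (set_pmf p)" "\<And>x. x \<in> set_pmf p \<Longrightarrow> 0 \<le> f x" "\<gamma> > 0"
  shows "measure_pmf.prob p {x. f x \<ge> \<gamma>} \<le> expct p f / \<gamma>"
proof -
  have "measure_pmf.prob p {x. f x \<ge> \<gamma>} = expct p (indicator {x. f x \<ge> \<gamma>})" by simp
  also have "\<dots> \<le> expct p (\<lambda>x. f x / \<gamma>)"
    using assms by (intro expct_mono) (auto simp: indicator_def)
  finally show ?thesis by simp
qed

section \<open>Product distributions on lists\<close>

text \<open>Independent entries with individual laws: given a codeword \<open>x\<close>, the output
  block of a memoryless channel \<open>a\<close> has law \<open>seq_pmf (map a x)\<close>.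
  \<open>replicate_pmf\<close> covers only identically distributed entries.\<close>

primrec seq_pmf :: "'a pmf list \<Rightarrow> 'a list pmf" where
  "seq_pmf [] = return_pmf []"
| "seq_pmf (p # ps) = bind_pmf p (\<lambda>x. map_pmf ((#) x) (seq_pmf ps))"

lemma replicate_pmf_eq_seq_pmf: "replicate_pmf n p = seq_pmf (replicate n p)"
  by (induction n) (simp_all add: map_pmf_def)

lemma set_seq_pmf: "xs \<in> set_pmf (seq_pmf ps) \<longleftrightarrow> list_all2 (\<lambda>x p. x \<in> set_pmf p) xs ps"
  by (induction ps arbitrary: xs) (auto simp: list_all2_Cons2)

lemma length_seq_pmf: "xs \<in> set_pmf (seq_pmf ps) \<Longrightarrow> length xs = length ps"
  by (auto simp: set_seq_pmf list_all2_lengthD)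

lemma nth_seq_pmf: "xs \<in> set_pmf (seq_pmf ps) \<Longrightarrow> i < length ps \<Longrightarrow> xs ! i \<in> set_pmf (ps ! i)"
  by (auto simp: set_seq_pmf list_all2_conv_all_nth)

lemma finite_set_seq_pmf [simp]:
  fixes ps :: "'a::finite pmf list"
  shows "finite (set_pmf (seq_pmf ps))"
  by (rule finite_subset[OF _ finite_lists_length_eq[of UNIV "length ps"]])
     (auto dest: length_seq_pmf)

lemma finite_set_replicate_pmf [simp]:
  fixes p :: "'a::finite pmf"
  shows "finite (set_pmf (replicate_pmf n p))"
  by (simp add: replicate_pmf_eq_seq_pmf)

lemma length_replicate_pmf: "xs \<in> set_pmf (replicate_pmf n p) \<Longrightarrow> length xs = n"
  by (simp add: set_replicate_pmf)

lemma prod_Suc_shift: "(\<Prod>j<Suc n. f j) = f 0 * (\<Prod>j<n. f (Suc j))"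
  for f :: "nat \<Rightarrow> 'a::comm_monoid_mult"
  by (subst lessThan_Suc_eq_insert_0) (simp add: prod.reindex)

lemma pmf_seq_pmf:
  "pmf (seq_pmf ps) xs =
     (if length xs = length ps then \<Prod>j<length ps. pmf (ps ! j) (xs ! j) else 0)"
proof (induction ps arbitrary: xs)
  case Nil
  then show ?case by (auto simp: indicator_def)
next
  case (Cons p ps)
  show ?case
  proof (cases xs)
    case Nil
    then have "xs \<notin> set_pmf (seq_pmf (p # ps))" by auto
    then show ?thesis using Nil by (simp add: set_pmf_iff del: seq_pmf.simps)
  next
    case (Cons x xs')
    have "seq_pmf (p # ps) = map_pmf (\<lambda>(x, xs). x # xs) (pair_pmf p (seq_pmf ps))"
      by (simp add: pair_pmf_def map_bind_pmf map_pmf_def[symmetric] map_pmf_comp)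
    then have "pmf (seq_pmf (p # ps)) xs
        = pmf (map_pmf (\<lambda>(x, xs). x # xs) (pair_pmf p (seq_pmf ps))) ((\<lambda>(x, xs). x # xs) (x, xs'))"
      by (simp add: Cons)
    also have "\<dots> = pmf (pair_pmf p (seq_pmf ps)) (x, xs')"
      by (rule pmf_map_inj') (auto simp: inj_def)
    finally show ?thesis
      by (simp add: Cons pmf_pair Cons.IH prod_Suc_shift del: prod.lessThan_Suc)
  qed
qed

lemma pmf_replicate_pmf:
  "length xs = n \<Longrightarrow> pmf (replicate_pmf n p) xs = (\<Prod>j<n. pmf p (xs ! j))"
  by (simp add: replicate_pmf_eq_seq_pmf pmf_seq_pmf)

lemma map_seq_pmf: "map_pmf (map f) (seq_pmf ps) = seq_pmf (map (map_pmf f) ps)"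
  by (induction ps)
     (simp_all add: map_bind_pmf bind_map_pmf map_pmf_comp, simp flip: map_pmf_comp)

lemma map_replicate_pmf: "map_pmf (map f) (replicate_pmf n p) = replicate_pmf n (map_pmf f p)"
  by (simp add: replicate_pmf_eq_seq_pmf map_seq_pmf)

lemma nth_seq_pmf_marginal: "i < length ps \<Longrightarrow> map_pmf (\<lambda>xs. xs ! i) (seq_pmf ps) = ps ! i"
proof (induction ps arbitrary: i)
  case (Cons p ps)
  then show ?case
    by (cases i) (simp_all add: map_bind_pmf map_pmf_comp bind_return_pmf')
qed simp

lemma expct_nth_seq_pmf: "i < length ps \<Longrightarrow> expct (seq_pmf ps) (\<lambda>xs. f (xs ! i)) = expct (ps ! i) f"
  using integral_map_pmf[of "\<lambda>xs. xs ! i" "seq_pmf ps" f] by (simp add: nth_seq_pmf_marginal)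

lemma expct_sum_replicate_pmf:
  fixes p :: "'a::finite pmf"
  shows "expct (replicate_pmf n p) (\<lambda>xs. \<Sum>i<n. f (xs ! i)) = real n * expct p f"
  by (simp add: expct_sum replicate_pmf_eq_seq_pmf expct_nth_seq_pmf)

text \<open>Distributive law with lists as choice functions. It turns a bound on each letter into
  one on the block, both for expectations of products and for sums of conditional source
  probabilities over all blocks.\<close>

lemma sum_lists_prod:
  fixes h :: "nat \<Rightarrow> 'a::finite \<Rightarrow> real"
  shows "(\<Sum>xs\<in>{xs. length xs = n}. \<Prod>i<n. h i (xs ! i)) = (\<Prod>i<n. \<Sum>a\<in>UNIV. h i a)"
proof (induction n arbitrary: h)
  case (Suc n)
  have eq: "{xs. length xs = Suc n} = (\<lambda>(x, xs). x # xs) ` (UNIV \<times> {xs::'a list. length xs = n})"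
    by (auto simp: length_Suc_conv image_iff)
  have "(\<Sum>xs\<in>{xs. length xs = Suc n}. \<Prod>i<Suc n. h i (xs ! i))
      = (\<Sum>(x, xs)\<in>UNIV \<times> {xs. length xs = n}. h 0 x * (\<Prod>i<n. h (Suc i) (xs ! i)))"
    unfolding eq by (subst sum.reindex)
      (auto simp: inj_on_def prod_Suc_shift case_prod_unfold simp del: prod.lessThan_Suc)
  also have "\<dots> = (\<Sum>a\<in>UNIV. h 0 a) * (\<Prod>i<n. \<Sum>a\<in>UNIV. h (Suc i) a)"
    by (simp add: Suc.IH[symmetric] sum_product sum.cartesian_product)
  also have "\<dots> = (\<Prod>i<Suc n. \<Sum>a\<in>UNIV. h i a)"
    by (simp only: prod_Suc_shift)
  finally show ?case .
qed simp

lemma finite_length_eq: "finite {xs::'a::finite list. length xs = n}"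
  using finite_lists_length_eq[of "UNIV::'a set" n] by simp

lemma expct_prod_seq_pmf:
  fixes ps :: "'a::finite pmf list"
  assumes "length ps = n"
  shows "expct (seq_pmf ps) (\<lambda>xs. \<Prod>i<n. h i (xs ! i)) = (\<Prod>i<n. expct (ps ! i) (h i))"
proof -
  have "expct (seq_pmf ps) (\<lambda>xs. \<Prod>i<n. h i (xs ! i))
      = (\<Sum>xs\<in>{xs. length xs = n}. pmf (seq_pmf ps) xs * (\<Prod>i<n. h i (xs ! i)))"
    using assms by (subst integral_measure_pmf[OF finite_length_eq[of n]]) (auto dest: length_seq_pmf)
  also have "\<dots> = (\<Sum>xs\<in>{xs. length xs = n}. \<Prod>i<n. pmf (ps ! i) (xs ! i) * h i (xs ! i))"
    using assms by (intro sum.cong) (auto simp: pmf_seq_pmf prod.distrib)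
  also have "\<dots> = (\<Prod>i<n. expct (ps ! i) (h i))"
    by (subst sum_lists_prod) (simp add: expct_UNIV)
  finally show ?thesis .
qed

section \<open>A one-shot converse\<close>

lemma log_prod_sum:
  fixes f :: "'i \<Rightarrow> real"
  assumes "finite I" "\<And>i. i \<in> I \<Longrightarrow> f i > 0"
  shows "log 2 (\<Prod>i\<in>I. f i) = (\<Sum>i\<in>I. log 2 (f i))"
  using assms
proof (induction I rule: finite_induct)
  case (insert i I)
  have "(\<Prod>i\<in>I. f i) > 0" using insert.prems by (intro prod_pos) auto
  moreover have "f i > 0" using insert.prems by simp
  ultimately have "log 2 (f i * (\<Prod>i\<in>I. f i)) = log 2 (f i) + log 2 (\<Prod>i\<in>I. f i)"
    by (intro log_mult_pos)
  then show ?case using insert by simp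
qed simp

text \<open>\<open>ln z \<le> z - 1\<close> takes the place of Jensen's inequality. Positivity of
  \<open>Z\<close> is asked on the support only, so quotients of point masses qualify. The Fano
  bound and the nonnegativity of mutual information are both instances.\<close>

lemma expct_log_nonpos:
  assumes "finite (set_pmf J)" "\<And>x. x \<in> set_pmf J \<Longrightarrow> Z x > 0" "expct J Z \<le> 1"
  shows "expct J (\<lambda>x. log 2 (Z x)) \<le> 0"
proof -
  have "expct J (\<lambda>x. log 2 (Z x)) \<le> expct J (\<lambda>x. (Z x - 1) / ln 2)"
    using assms(1,2) by (intro expct_mono) (auto simp: log_def intro!: divide_right_mono ln_le_minus_one)
  also have "\<dots> = (expct J Z - 1) / ln 2"
    using assms(1) by (simp add: expct_diff)
  also have "\<dots> \<le> 0" using assms(3) by (simp add: divide_nonpos_pos)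
  finally show ?thesis .
qed

text \<open>Bound on the expected log-loss of a guess that gives the decoded value
  \<open>1 - \<epsilon>\<close> and every other value \<open>\<epsilon> / K\<close>, at error
  probability \<open>\<epsilon>\<close>. It exceeds the usual binary entropy of
  \<open>\<epsilon>\<close> plus \<open>\<epsilon> * log 2 K\<close> only because
  \<open>log 2 (1 - \<epsilon>)\<close> is not weighted by \<open>1 - \<epsilon>\<close>, and it
  still vanishes with \<open>\<epsilon>\<close>.\<close>

definition fano :: "real \<Rightarrow> real \<Rightarrow> real" where
  "fano \<epsilon> K = - log 2 (1 - \<epsilon>) - \<epsilon> * log 2 (\<epsilon> / K)"

lemma pmf_bind_Pair:
  "pmf (bind_pmf p (\<lambda>x. map_pmf (Pair x) (a x))) (x, y) = pmf p x * pmf (a x) y"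
proof -
  have "pmf (bind_pmf p (\<lambda>x. map_pmf (Pair x) (a x))) (x, y)
      = expct p (\<lambda>x'. indicator {x} x' * pmf (a x) y)"
    unfolding pmf_bind
  proof (intro expct_cong)
    fix x'
    show "pmf (map_pmf (Pair x') (a x')) (x, y) = indicator {x} x' * pmf (a x) y"
      by (cases "x' = x")
         (auto simp: pmf_map_inj' inj_def intro!: pmf_map_outside)
  qed
  then show ?thesis by (simp add: pmf.rep_eq)
qed

text \<open>\<open>s\<close> is decoded from the output \<open>y\<close> and the side information \<open>t\<close>; the reference channel \<open>\<rho>\<close> may
  depend on \<open>t\<close>, so that it can keep those parts of the output that are independent of \<open>s\<close> given \<open>t\<close>.\<close>

lemma one_shot_converse:
  fixes p :: "('s \<times> 't) pmf" and b :: "'s \<Rightarrow> 't \<Rightarrow> 'y pmf" and \<rho> :: "'t \<Rightarrow> 'y pmf"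
  assumes fin: "finite (set_pmf p)" "\<And>s t. finite (set_pmf (b s t))"
    and A: "finite A" "fst ` set_pmf p \<subseteq> A" "real (card A) \<le> K" "1 \<le> K"
    and \<epsilon>: "0 < \<epsilon>" "\<epsilon> < 1"
    and ac: "\<And>s t. (s, t) \<in> set_pmf p \<Longrightarrow> set_pmf (b s t) \<subseteq> set_pmf (\<rho> t)"
    and err: "measure_pmf.prob (bind_pmf p (\<lambda>st. map_pmf (Pair st) (b (fst st) (snd st))))
                {(st, y). g y (snd st) \<noteq> fst st} \<le> \<epsilon>"
  shows "- expct p (\<lambda>st. log 2 (pmf p st / pmf (map_pmf snd p) (snd st)))
         \<le> expct p (\<lambda>st. expct (b (fst st) (snd st))
              (\<lambda>y. log 2 (pmf (b (fst st) (snd st)) y / pmf (\<rho> (snd st)) y))) + fano \<epsilon> K"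
proof -
  define J where "J = bind_pmf p (\<lambda>st. map_pmf (Pair st) (b (fst st) (snd st)))"
  \<comment> \<open>Fano's guess of \<open>s\<close>: most of the mass on the decoded value, the rest spread evenly\<close>
  define T where "T = (\<lambda>s t y. if g y t = s then 1 - \<epsilon> else \<epsilon> / K)"
  define h where "h = (\<lambda>st. pmf p st / pmf (map_pmf snd p) (snd st))"
  define d where "d = (\<lambda>st y. pmf (b (fst st) (snd st)) y / pmf (\<rho> (snd st)) y)"
  \<comment> \<open>The auxiliary law \<open>p(t) \<rho>(y | t) T(s | t, y)\<close> divided by the
    true law \<open>p(s, t) b(y | s, t)\<close>; the factors regroup into \<open>h\<close> and
    \<open>d\<close>.\<close>
  define Z where "Z = (\<lambda>(st, y). T (fst st) (snd st) y / (h st * d st y))"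
  have finJ: "finite (set_pmf J)" using fin by (auto simp: J_def)
  have T_pos: "T s t y > 0" for s t y using \<epsilon> A by (auto simp: T_def)
  have suppJ: "st \<in> set_pmf p \<and> y \<in> set_pmf (b (fst st) (snd st))" if "(st, y) \<in> set_pmf J" for st y
    using that by (auto simp: J_def)
  have h_pos: "h st > 0" if "st \<in> set_pmf p" for st
  proof -
    have "snd st \<in> set_pmf (map_pmf snd p)" using that by auto
    then show ?thesis using that unfolding h_def by (intro divide_pos_pos pmf_positive)
  qed
  have d_pos: "d st y > 0" if "st \<in> set_pmf p" "y \<in> set_pmf (b (fst st) (snd st))" for st y
    using that ac[of "fst st" "snd st"] unfolding d_def by (intro divide_pos_pos pmf_positive) auto
  have Z_pos: "Z x > 0" if "x \<in> set_pmf J" for x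
    using that suppJ[of "fst x" "snd x"] unfolding Z_def case_prod_unfold
    by (intro divide_pos_pos mult_pos_pos T_pos h_pos d_pos) auto
  \<comment> \<open>\<open>T\<close> need only be a subprobability in \<open>s\<close>: the decoder
    may answer outside \<open>A\<close>, and \<open>K\<close> may exceed the number of
    values.\<close>
  have sum_T: "(\<Sum>s\<in>A. T s t y) \<le> 1" for t y
  proof -
    have "(\<Sum>s\<in>A. T s t y) \<le> (\<Sum>s\<in>A. (if s = g y t then 1 - \<epsilon> else 0) + \<epsilon> / K)"
      using \<epsilon> A by (intro sum_mono) (auto simp: T_def)
    also have "\<dots> \<le> (1 - \<epsilon>) + real (card A) * (\<epsilon> / K)"
      using \<epsilon> A(1) by (auto simp: sum.distrib sum.delta)
    also have "\<dots> \<le> (1 - \<epsilon>) + K * (\<epsilon> / K)"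
      using A \<epsilon> by (intro add_left_mono mult_right_mono) auto
    also have "\<dots> = 1" using A by simp
    finally show ?thesis .
  qed
  define Tt where "Tt = snd ` set_pmf p"
  define Y where "Y = (\<Union>st\<in>set_pmf p. set_pmf (b (fst st) (snd st)))"
  have fin': "finite Tt" "finite Y" using fin by (auto simp: Tt_def Y_def)
  have "expct J Z = (\<Sum>x\<in>set_pmf J. pmf J x * Z x)"
    using finJ by (rule expct_finite)
  also have "\<dots> = (\<Sum>x\<in>set_pmf J. T (fst (fst x)) (snd (fst x)) (snd x)
        * (pmf (map_pmf snd p) (snd (fst x)) * pmf (\<rho> (snd (fst x))) (snd x)))"
  proof (intro sum.cong refl)
    fix x assume x: "x \<in> set_pmf J"
    obtain st y where [simp]: "x = (st, y)" by (cases x)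
    have "pmf p st > 0" "pmf (b (fst st) (snd st)) y > 0"
      using suppJ[of st y] x by (auto intro: pmf_positive)
    then show "pmf J x * Z x = T (fst (fst x)) (snd (fst x)) (snd x)
        * (pmf (map_pmf snd p) (snd (fst x)) * pmf (\<rho> (snd (fst x))) (snd x))"
      unfolding J_def Z_def h_def d_def by (simp add: pmf_bind_Pair field_simps)
  qed
  \<comment> \<open>The support of \<open>J\<close> need not be a rectangle. The point masses of
    \<open>J\<close> have cancelled, so the remaining nonnegative terms can be summed over a
    rectangle, with \<open>s\<close> innermost, where \<open>sum_T\<close> applies.\<close>
  also have "\<dots> \<le> (\<Sum>x\<in>(A \<times> Tt) \<times> Y. T (fst (fst x)) (snd (fst x)) (snd x)
        * (pmf (map_pmf snd p) (snd (fst x)) * pmf (\<rho> (snd (fst x))) (snd x)))"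
    using fin' A fin
    by (intro sum_mono2) (auto simp: J_def Tt_def Y_def less_imp_le[OF T_pos] image_iff, force+)
  also have "\<dots> = (\<Sum>t\<in>Tt. \<Sum>y\<in>Y. \<Sum>s\<in>A. T s t y * (pmf (map_pmf snd p) t * pmf (\<rho> t) y))"
    unfolding sum.cartesian_product' fst_conv snd_conv
    by (subst sum.swap) (intro sum.cong refl sum.swap)
  also have "\<dots> \<le> (\<Sum>t\<in>Tt. \<Sum>y\<in>Y. pmf (map_pmf snd p) t * pmf (\<rho> t) y)"
    unfolding sum_distrib_right[symmetric]
    by (intro sum_mono mult_left_le_one_le) (auto intro!: sum_T sum_nonneg less_imp_le[OF T_pos])
  also have "\<dots> = (\<Sum>t\<in>Tt. pmf (map_pmf snd p) t * measure_pmf.prob (\<rho> t) Y)"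
    using fin' by (simp add: sum_distrib_left measure_measure_pmf_finite)
  also have "\<dots> \<le> (\<Sum>t\<in>Tt. pmf (map_pmf snd p) t * 1)"
    by (intro sum_mono mult_left_mono) auto
  also have "\<dots> = measure_pmf.prob (map_pmf snd p) Tt"
    using fin' by (simp add: measure_measure_pmf_finite del: measure_map_pmf)
  also have "\<dots> \<le> 1" by simp
  finally have "expct J (\<lambda>x. log 2 (Z x)) \<le> 0"
    by (intro expct_log_nonpos finJ Z_pos)
  also have "expct J (\<lambda>x. log 2 (Z x)) = expct J (\<lambda>x. log 2 (T (fst (fst x)) (snd (fst x)) (snd x))
      - log 2 (h (fst x)) - log 2 (d (fst x) (snd x)))"
  proof (intro expct_cong)
    fix x assume x: "x \<in> set_pmf J"
    obtain st y where [simp]: "x = (st, y)" by (cases x)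
    have "h st > 0" "d st y > 0" using x suppJ[of st y] by (auto intro: h_pos d_pos)
    then show "log 2 (Z x) = log 2 (T (fst (fst x)) (snd (fst x)) (snd x))
      - log 2 (h (fst x)) - log 2 (d (fst x) (snd x))"
      using T_pos[of "fst st" "snd st" y] by (simp add: Z_def log_divide log_mult)
  qed
  also have "\<dots> = expct J (\<lambda>x. log 2 (T (fst (fst x)) (snd (fst x)) (snd x)))
      - expct J (\<lambda>x. log 2 (h (fst x))) - expct J (\<lambda>x. log 2 (d (fst x) (snd x)))"
    using finJ by (simp add: expct_diff)
  also have "expct J (\<lambda>x. log 2 (h (fst x))) = expct p (\<lambda>st. log 2 (h st))"
    using fin unfolding J_def by (subst expct_bind) auto
  also have "expct J (\<lambda>x. log 2 (d (fst x) (snd x)))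
      = expct p (\<lambda>st. expct (b (fst st) (snd st)) (\<lambda>y. log 2 (d st y)))"
    using fin unfolding J_def by (subst expct_bind) auto
  finally have main: "expct J (\<lambda>x. log 2 (T (fst (fst x)) (snd (fst x)) (snd x)))
     - expct p (\<lambda>st. log 2 (h st))
     \<le> expct p (\<lambda>st. expct (b (fst st) (snd st)) (\<lambda>y. log 2 (d st y)))" by simp
  define E where "E = {(st, y). g y (snd st) \<noteq> fst st}"
  have l2: "log 2 (\<epsilon> / K) \<le> 0" using \<epsilon> A by (simp add: divide_le_eq_1)
  have "- fano \<epsilon> K = log 2 (1 - \<epsilon>) + \<epsilon> * log 2 (\<epsilon> / K)" by (simp add: fano_def)
  \<comment> \<open>Only an upper bound on the error probability is known; the factor
    \<open>log 2 (\<epsilon> / K)\<close> is nonpositive, so the bound goes in the right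
    direction.\<close>
  also have "\<dots> \<le> log 2 (1 - \<epsilon>) + measure_pmf.prob J E * log 2 (\<epsilon> / K)"
    using err l2 unfolding J_def E_def by (intro add_left_mono mult_right_mono_neg) auto
  also have "\<dots> = expct J (\<lambda>x. log 2 (1 - \<epsilon>) + indicator E x * log 2 (\<epsilon> / K))"
    using finJ by (subst expct_add) auto
  \<comment> \<open>On \<open>E\<close> the left side carries \<open>log 2 (1 - \<epsilon>)\<close>
    as an extra nonpositive term; off \<open>E\<close> both sides agree.\<close>
  also have "\<dots> \<le> expct J (\<lambda>x. log 2 (T (fst (fst x)) (snd (fst x)) (snd x)))"
    using finJ \<epsilon> l2 by (intro expct_mono) (auto simp: E_def T_def indicator_def)
  finally show ?thesis using main unfolding h_def d_def by simp
qed

section \<open>Single-letter expressions\<close>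

abbreviation chan_joint :: "'x pmf \<Rightarrow> ('x \<Rightarrow> 'y pmf) \<Rightarrow> ('x \<times> 'y) pmf" where
  "chan_joint Q a \<equiv> bind_pmf Q (\<lambda>x. map_pmf (Pair x) (a x))"

lemma cond_ent_expct:
  "cond_ent q = - expct q (\<lambda>st. log 2 (pmf q st / pmf (map_pmf snd q) (snd st)))"
  by (simp add: cond_ent_def expct_UNIV)

lemma map_fst_chan_joint: "map_pmf fst (chan_joint Q a) = Q"
  by (simp add: map_bind_pmf map_pmf_comp bind_return_pmf')

lemma map_snd_chan_joint: "map_pmf snd (chan_joint Q a) = bind_pmf Q a"
  by (simp add: map_bind_pmf map_pmf_comp)

text \<open>Cancelling \<open>pmf Q x\<close> in the ratio is legitimate because letters of
  probability 0 have weight 0 on both sides. The resulting mean divergence from the output law is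
  the form in which the per-letter terms of the converse arise.\<close>

lemma mut_inf_chan_joint:
  "mut_inf (chan_joint Q a)
     = expct Q (\<lambda>x. expct (a x) (\<lambda>y. log 2 (pmf (a x) y / pmf (bind_pmf Q a) y)))"
proof -
  have "mut_inf (chan_joint Q a) = (\<Sum>x\<in>UNIV. \<Sum>y\<in>UNIV. pmf Q x * pmf (a x) y *
      log 2 (pmf Q x * pmf (a x) y / (pmf Q x * pmf (bind_pmf Q a) y)))"
    unfolding mut_inf_def map_fst_chan_joint map_snd_chan_joint UNIV_Times_UNIV[symmetric]
      sum.cartesian_product'
    by (simp add: pmf_bind_Pair)
  also have "\<dots> = (\<Sum>x\<in>UNIV. pmf Q x * (\<Sum>y\<in>UNIV. pmf (a x) y *
      log 2 (pmf (a x) y / pmf (bind_pmf Q a) y)))"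
    by (intro sum.cong refl) (auto simp: sum_distrib_left intro!: sum.cong)
  finally show ?thesis by (simp add: expct_UNIV)
qed

lemma log_seq_ratio:
  assumes "y \<in> set_pmf (seq_pmf ps)" "y \<in> set_pmf (seq_pmf qs)" "length ps = n"
  shows "log 2 (pmf (seq_pmf ps) y / pmf (seq_pmf qs) y)
       = (\<Sum>j<n. log 2 (pmf (ps ! j) (y ! j) / pmf (qs ! j) (y ! j)))"
proof -
  have len: "length y = n" "length qs = n"
    using assms length_seq_pmf by metis+
  have "pmf (ps ! j) (y ! j) / pmf (qs ! j) (y ! j) > 0" if "j < n" for j
    using that assms len by (intro divide_pos_pos pmf_positive nth_seq_pmf) auto
  then show ?thesis
    using len assms(3)
    by (simp add: pmf_seq_pmf flip: prod_dividef) (intro log_prod_sum; simp)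
qed

definition unzip :: "('s \<times> 't) list \<Rightarrow> 's list \<times> 't list" where
  "unzip u = (map fst u, map snd u)"

lemma inj_unzip: "inj unzip"
  by (auto simp: inj_def unzip_def intro: pair_list_eqI)

text \<open>Since \<open>unzip\<close> is injective, the point mass of a pair of blocks is that of
  the block of pairs and factorizes, so the log-ratio becomes a sum over positions.\<close>

lemma iid_cond_ent:
  fixes q :: "('s::finite \<times> 't::finite) pmf" and m :: nat
  defines "p \<equiv> map_pmf unzip (replicate_pmf m q)"
  shows "- expct p (\<lambda>st. log 2 (pmf p st / pmf (map_pmf snd p) (snd st))) = real m * cond_ent q"
proof -
  have snd_p: "map_pmf snd p = replicate_pmf m (map_pmf snd q)"
    by (simp add: p_def map_pmf_comp unzip_def map_replicate_pmf)
  have "expct p (\<lambda>st. log 2 (pmf p st / pmf (map_pmf snd p) (snd st)))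
      = expct (replicate_pmf m q) (\<lambda>u. log 2 (pmf p (unzip u) / pmf (map_pmf snd p) (snd (unzip u))))"
    by (simp add: p_def)
  also have "\<dots> = expct (replicate_pmf m q) (\<lambda>u. \<Sum>i<m. log 2 (pmf q (u ! i) / pmf (map_pmf snd q) (snd (u ! i))))"
  proof (intro expct_cong)
    fix u assume u: "u \<in> set_pmf (replicate_pmf m q)"
    have len: "length u = m" using u by (rule length_replicate_pmf)
    have "pmf q (u ! i) / pmf (map_pmf snd q) (snd (u ! i)) > 0" if "i < m" for i
    proof -
      have "u ! i \<in> set_pmf q" using u that len by (auto simp: set_replicate_pmf)
      then show ?thesis by (intro divide_pos_pos pmf_positive) auto
    qed
    then show "log 2 (pmf p (unzip u) / pmf (map_pmf snd p) (snd (unzip u)))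
       = (\<Sum>i<m. log 2 (pmf q (u ! i) / pmf (map_pmf snd q) (snd (u ! i))))"
      unfolding p_def pmf_map_inj'[OF inj_unzip] snd_p[unfolded p_def]
      using len
      by (simp add: unzip_def pmf_replicate_pmf flip: prod_dividef) (intro log_prod_sum; simp)
  qed
  also have "\<dots> = real m * expct q (\<lambda>st. log 2 (pmf q st / pmf (map_pmf snd q) (snd st)))"
    by (rule expct_sum_replicate_pmf)
  finally show ?thesis by (simp add: cond_ent_expct)
qed

definition avg_input :: "nat \<Rightarrow> 'x list pmf \<Rightarrow> 'x pmf" where
  "avg_input n X = bind_pmf (pmf_of_set {..<n}) (\<lambda>j. map_pmf (\<lambda>x. x ! j) X)"

text \<open>The reference output law is the same at every time, so the inner expectation at time
  \<open>j\<close> is one fixed function \<open>G\<close> of the letter \<open>x ! j\<close>.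
  Averaging \<open>G\<close> over codewords and times is the expectation under \<open>Q\<close>,
  however the letters of a codeword depend on each other.\<close>

lemma avg_input_info:
  fixes X :: "'x::finite list pmf" and a :: "'x \<Rightarrow> 'y::finite pmf"
  assumes "n > 0" "finite (set_pmf X)" "\<And>x. x \<in> set_pmf X \<Longrightarrow> length x = n"
  defines "Q \<equiv> avg_input n X"
  shows "expct X (\<lambda>x. expct (seq_pmf (map a x)) (\<lambda>y. \<Sum>j<n.
           log 2 (pmf (a (x ! j)) (y ! j) / pmf (bind_pmf Q a) (y ! j))))
         = real n * mut_inf (chan_joint Q a)"
proof -
  define G where "G = (\<lambda>x. expct (a x) (\<lambda>y. log 2 (pmf (a x) y / pmf (bind_pmf Q a) y)))"
  have "expct X (\<lambda>x. expct (seq_pmf (map a x)) (\<lambda>y. \<Sum>j<n.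
           log 2 (pmf (a (x ! j)) (y ! j) / pmf (bind_pmf Q a) (y ! j)))) = expct X (\<lambda>x. \<Sum>j<n. G (x ! j))"
  proof (intro expct_cong)
    fix x assume "x \<in> set_pmf X"
    then have len: "length x = n" by (rule assms)
    have "expct (seq_pmf (map a x)) (\<lambda>y. log 2 (pmf (a (x ! j)) (y ! j) / pmf (bind_pmf Q a) (y ! j)))
        = G (x ! j)" if "j < n" for j
      using that len
      by (subst expct_nth_seq_pmf[where f="\<lambda>y. log 2 (pmf (a (x ! j)) y / pmf (bind_pmf Q a) y)"])
         (auto simp: G_def)
    then show "expct (seq_pmf (map a x)) (\<lambda>y. \<Sum>j<n.
           log 2 (pmf (a (x ! j)) (y ! j) / pmf (bind_pmf Q a) (y ! j))) = (\<Sum>j<n. G (x ! j))"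
      by (simp add: expct_sum)
  qed
  also have "\<dots> = real n * expct Q G"
    using assms(1,2) unfolding Q_def avg_input_def
    by (subst expct_bind) (auto simp: expct_sum integral_pmf_of_set lessThan_empty_iff)
  finally show ?thesis by (simp add: mut_inf_chan_joint G_def)
qed

lemma set_avg_input:
  assumes "x \<in> set_pmf X" "j < n"
  shows "x ! j \<in> set_pmf (avg_input n X)"
proof -
  have "set_pmf (pmf_of_set {..<n}) = {..<n}" using assms by (intro set_pmf_of_set) auto
  then show ?thesis using assms by (auto simp: avg_input_def)
qed

text \<open>Absolute continuity for the one-shot bound: every letter that a codeword uses has
  positive average probability, so every output it can cause is possible under the averaged
  law.\<close>

lemma avg_input_support:
  assumes "x \<in> set_pmf X" "length x = n"
  shows "set_pmf (seq_pmf (map a x)) \<subseteq> set_pmf (replicate_pmf n (bind_pmf (avg_input n X) a))"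
  using assms set_avg_input[OF assms(1)]
  by (fastforce simp: replicate_pmf_eq_seq_pmf set_seq_pmf list_all2_conv_all_nth)

lemma avg_input_block_info:
  fixes X :: "'x::finite list pmf" and a :: "'x \<Rightarrow> 'y::finite pmf"
  assumes "n > 0" "finite (set_pmf X)" "\<And>x. x \<in> set_pmf X \<Longrightarrow> length x = n"
  defines "Q \<equiv> avg_input n X"
  shows "expct X (\<lambda>x. expct (seq_pmf (map a x)) (\<lambda>y.
           log 2 (pmf (seq_pmf (map a x)) y / pmf (replicate_pmf n (bind_pmf Q a)) y)))
         = real n * mut_inf (chan_joint Q a)"
proof -
  have "expct X (\<lambda>x. expct (seq_pmf (map a x)) (\<lambda>y.
           log 2 (pmf (seq_pmf (map a x)) y / pmf (replicate_pmf n (bind_pmf Q a)) y)))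
      = expct X (\<lambda>x. expct (seq_pmf (map a x)) (\<lambda>y. \<Sum>j<n.
           log 2 (pmf (a (x ! j)) (y ! j) / pmf (bind_pmf Q a) (y ! j))))"
    unfolding Q_def
  proof (intro expct_cong)
    fix x y assume x: "x \<in> set_pmf X" and y: "y \<in> set_pmf (seq_pmf (map a x))"
    have len: "length x = n" using x by (rule assms)
    have "y \<in> set_pmf (seq_pmf (replicate n (bind_pmf (avg_input n X) a)))"
      using avg_input_support[OF x len] y by (auto simp: replicate_pmf_eq_seq_pmf)
    then show "log 2 (pmf (seq_pmf (map a x)) y / pmf (replicate_pmf n (bind_pmf (avg_input n X) a)) y)
        = (\<Sum>j<n. log 2 (pmf (a (x ! j)) (y ! j) / pmf (bind_pmf (avg_input n X) a) (y ! j)))"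
      using y len unfolding replicate_pmf_eq_seq_pmf
      by (subst log_seq_ratio[where n=n]) (auto intro!: sum.cong)
  qed
  then show ?thesis using avg_input_info[OF assms(1-3), of a] by (simp add: Q_def)
qed

text \<open>\<open>hs\<close> and \<open>ht\<close> select from a source letter the part to be
  decoded and the part granted as side information. The three inequalities of a receiver differ only
  in this choice, and \<open>B\<close> may use the side information because a known source block
  determines its codeword.\<close>

lemma code_converse:
  fixes p :: "'u::finite pmf" and hs :: "'u \<Rightarrow> 's::finite" and ht :: "'u \<Rightarrow> 't::finite"
    and B :: "'s list \<Rightarrow> 't list \<Rightarrow> 'y pmf" and \<rho> :: "'t list \<Rightarrow> 'y pmf"
  assumes fin: "\<And>s t. finite (set_pmf (B s t))"
    and K: "real CARD('s) ^ m \<le> K"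
    and \<epsilon>: "0 < \<epsilon>" "\<epsilon> < 1"
    and ac: "\<And>u. u \<in> set_pmf (replicate_pmf m p) \<Longrightarrow>
               set_pmf (B (map hs u) (map ht u)) \<subseteq> set_pmf (\<rho> (map ht u))"
    and err: "measure_pmf.prob (bind_pmf (replicate_pmf m p)
                (\<lambda>u. map_pmf (Pair u) (B (map hs u) (map ht u))))
                {(u, y). g y (map ht u) \<noteq> map hs u} \<le> \<epsilon>"
  shows "real m * cond_ent (map_pmf (\<lambda>u. (hs u, ht u)) p)
         \<le> expct (replicate_pmf m p) (\<lambda>u. expct (B (map hs u) (map ht u))
              (\<lambda>y. log 2 (pmf (B (map hs u) (map ht u)) y / pmf (\<rho> (map ht u)) y))) + fano \<epsilon> K"
proof -
  define q where "q = map_pmf (\<lambda>u. (hs u, ht u)) p"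
  define p' where "p' = map_pmf unzip (replicate_pmf m q)"
  have p': "p' = map_pmf (\<lambda>u. (map hs u, map ht u)) (replicate_pmf m p)"
    by (simp add: p'_def q_def unzip_def map_pmf_comp comp_def flip: map_replicate_pmf)
  have "real m * cond_ent q = - expct p' (\<lambda>st. log 2 (pmf p' st / pmf (map_pmf snd p') (snd st)))"
    unfolding p'_def by (rule iid_cond_ent[symmetric])
  also have "\<dots> \<le> expct p' (\<lambda>st. expct (B (fst st) (snd st))
              (\<lambda>y. log 2 (pmf (B (fst st) (snd st)) y / pmf (\<rho> (snd st)) y))) + fano \<epsilon> K"
  proof (rule one_shot_converse[where A="{xs. length xs = m}" and g=g])
    show "finite (set_pmf p')" by (simp add: p')
    show "finite {xs::'s list. length xs = m}" by (rule finite_length_eq)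
    show "fst ` set_pmf p' \<subseteq> {xs. length xs = m}" by (auto simp: p' dest: length_replicate_pmf)
    show "real (card {xs::'s list. length xs = m}) \<le> K"
      using K card_lists_length_eq[of "UNIV::'s set" m] by simp
    have "1 \<le> real CARD('s)" by (simp add: Suc_le_eq)
    then have "1 \<le> real CARD('s) ^ m" by (rule one_le_power)
    then show "1 \<le> K" using K by linarith
    show "set_pmf (B s t) \<subseteq> set_pmf (\<rho> t)" if "(s, t) \<in> set_pmf p'" for s t
      using that ac by (auto simp: p')
    have "bind_pmf p' (\<lambda>st. map_pmf (Pair st) (B (fst st) (snd st)))
      = map_pmf (\<lambda>(u, y). ((map hs u, map ht u), y)) (bind_pmf (replicate_pmf m p)
                (\<lambda>u. map_pmf (Pair u) (B (map hs u) (map ht u))))"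
      by (simp add: p' bind_map_pmf map_bind_pmf map_pmf_comp)
    then have "measure_pmf.prob (bind_pmf p' (\<lambda>st. map_pmf (Pair st) (B (fst st) (snd st))))
            {(st, y). g y (snd st) \<noteq> fst st}
       = measure_pmf.prob (bind_pmf (replicate_pmf m p)
                (\<lambda>u. map_pmf (Pair u) (B (map hs u) (map ht u))))
                {(u, y). g y (map ht u) \<noteq> map hs u}"
      by (auto intro!: arg_cong[where f="measure_pmf.prob _"])
    then show "measure_pmf.prob (bind_pmf p' (\<lambda>st. map_pmf (Pair st) (B (fst st) (snd st))))
            {(st, y). g y (snd st) \<noteq> fst st} \<le> \<epsilon>" using err by simp
  qed (use fin \<epsilon> in auto)
  finally show ?thesis by (simp add: q_def p')
qed

text \<open>The law seen by a single receiver, already in product form: without interference its two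
  output blocks are independent given the codewords.\<close>

definition recv_pmf :: "nat \<Rightarrow> ('s1 \<times> 's2 \<times> 'w) pmf \<Rightarrow> ('x1 \<Rightarrow> 'y1 pmf) \<Rightarrow> ('x2 \<Rightarrow> 'y2 pmf) \<Rightarrow>
    ('s1 list \<Rightarrow> 'x1 list) \<Rightarrow> ('s2 list \<Rightarrow> 'x2 list) \<Rightarrow>
    (('s1 \<times> 's2 \<times> 'w) list \<times> 'y1 list \<times> 'y2 list) pmf" where
  "recv_pmf m p a c f1 f2 = bind_pmf (replicate_pmf m p) (\<lambda>u. map_pmf (Pair u)
     (pair_pmf (seq_pmf (map a (f1 (map fst u)))) (seq_pmf (map c (f2 (map (fst \<circ> snd) u))))))"

text \<open>Granting the receiver one source block reveals the corresponding codeword, so the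
  reference channel can keep that output block and its factor cancels from the ratio; only the
  blocks of decoded sources are replaced by \<open>R1\<close> and \<open>R2\<close>. Once the
  logarithm of the joint ratio is split, each term involves the law of one codeword, so dependent
  codewords do no harm.\<close>

lemma receiver_converse:
  fixes p :: "('s1::finite \<times> 's2::finite \<times> 'w::finite) pmf"
    and a :: "'x1::finite \<Rightarrow> 'y1::finite pmf" and c :: "'x2::finite \<Rightarrow> 'y2::finite pmf"
  assumes n: "n > 0"
    and len: "\<And>s. length s = m \<Longrightarrow> length (f1 s) = n" "\<And>s. length s = m \<Longrightarrow> length (f2 s) = n"
    and \<epsilon>: "0 < \<epsilon>" "\<epsilon> < 1"
    and err: "measure_pmf.prob (recv_pmf m p a c f1 f2)
        {(u, y1, y2). g y1 y2 (map (snd \<circ> snd) u) \<noteq> (map fst u, map (fst \<circ> snd) u)} \<le> \<epsilon>"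
  defines "Q1 \<equiv> avg_input n (map_pmf (\<lambda>u. f1 (map fst u)) (replicate_pmf m p))"
    and "Q2 \<equiv> avg_input n (map_pmf (\<lambda>u. f2 (map (fst \<circ> snd) u)) (replicate_pmf m p))"
    and "K \<equiv> (real CARD('s1) * real CARD('s2)) ^ m"
  shows "real m * cond_ent (map_pmf (\<lambda>(s1, s2, w). (s1, (s2, w))) p)
           \<le> real n * mut_inf (chan_joint Q1 a) + fano \<epsilon> K"
    and "real m * cond_ent (map_pmf (\<lambda>(s1, s2, w). (s2, (s1, w))) p)
           \<le> real n * mut_inf (chan_joint Q2 c) + fano \<epsilon> K"
    and "real m * cond_ent (map_pmf (\<lambda>(s1, s2, w). ((s1, s2), w)) p)
           \<le> real n * (mut_inf (chan_joint Q1 a) + mut_inf (chan_joint Q2 c)) + fano \<epsilon> K"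
proof -
  define U where "U = replicate_pmf m p"
  define X1 where "X1 = map_pmf (\<lambda>u. f1 (map fst u)) U"
  define X2 where "X2 = map_pmf (\<lambda>u. f2 (map (fst \<circ> snd) u)) U"
  define R1 where "R1 = replicate_pmf n (bind_pmf Q1 a)"
  define R2 where "R2 = replicate_pmf n (bind_pmf Q2 c)"
  define C1 where "C1 = (\<lambda>s. seq_pmf (map a (f1 s)))"
  define C2 where "C2 = (\<lambda>s. seq_pmf (map c (f2 s)))"
  define L1 where "L1 = (\<lambda>s y. log 2 (pmf (C1 s) y / pmf R1 y))"
  define L2 where "L2 = (\<lambda>s y. log 2 (pmf (C2 s) y / pmf R2 y))"
  have finU: "finite (set_pmf U)" by (simp add: U_def)
  have lenU: "length u = m" if "u \<in> set_pmf U" for u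
    using that unfolding U_def by (rule length_replicate_pmf)
  have ac1: "set_pmf (C1 (map fst u)) \<subseteq> set_pmf R1" if "u \<in> set_pmf U" for u
    unfolding C1_def R1_def Q1_def U_def[symmetric] X1_def[symmetric]
    using that lenU[OF that] len by (intro avg_input_support) (auto simp: X1_def)
  have ac2: "set_pmf (C2 (map (fst \<circ> snd) u)) \<subseteq> set_pmf R2" if "u \<in> set_pmf U" for u
    unfolding C2_def R2_def Q2_def U_def[symmetric] X2_def[symmetric]
    using that lenU[OF that] len by (intro avg_input_support) (auto simp: X2_def)
  have I1: "expct U (\<lambda>u. expct (C1 (map fst u)) (L1 (map fst u))) = real n * mut_inf (chan_joint Q1 a)"
  proof -
    have "finite (set_pmf X1)" "\<And>x. x \<in> set_pmf X1 \<Longrightarrow> length x = n"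
      using finU lenU len by (auto simp: X1_def)
    from avg_input_block_info[OF n this, of a] show ?thesis
      unfolding L1_def C1_def R1_def Q1_def U_def[symmetric] X1_def[symmetric]
      by (simp add: X1_def)
  qed
  have I2: "expct U (\<lambda>u. expct (C2 (map (fst \<circ> snd) u)) (L2 (map (fst \<circ> snd) u)))
      = real n * mut_inf (chan_joint Q2 c)"
  proof -
    have "finite (set_pmf X2)" "\<And>x. x \<in> set_pmf X2 \<Longrightarrow> length x = n"
      using finU lenU len by (auto simp: X2_def)
    from avg_input_block_info[OF n this, of c] show ?thesis
      unfolding L2_def C2_def R2_def Q2_def U_def[symmetric] X2_def[symmetric]
      by (simp add: X2_def)
  qed
  have fin: "finite (set_pmf (C1 s))" "finite (set_pmf (C2 s'))" for s s'
    by (simp_all add: C1_def C2_def)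
  have one: "1 \<le> real CARD('s1)" "1 \<le> real CARD('s2)" by (simp_all add: Suc_le_eq)
  \<comment> \<open>\<open>K\<close> bounds the number of candidates in all three decoding problems,
    so one Fano term serves them all.\<close>
  have K1: "real CARD('s1) ^ m \<le> K" "real CARD('s2) ^ m \<le> K" "real CARD('s1 \<times> 's2) ^ m \<le> K"
    using one by (auto simp: K_def power_mult_distrib intro!: mult_le_cancel_left1[THEN iffD2]
      mult_le_cancel_right1[THEN iffD2] one_le_power)
  have err1: "measure_pmf.prob (bind_pmf (replicate_pmf m p) (\<lambda>u. map_pmf (Pair u) (B u))) X \<le> \<epsilon>"
    if "\<And>u. B u = pair_pmf (C1 (map fst u)) (C2 (map (fst \<circ> snd) u))"
      and "X \<subseteq> {(u, y1, y2). g y1 y2 (map (snd \<circ> snd) u) \<noteq> (map fst u, map (fst \<circ> snd) u)}" for B X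
  proof -
    have "bind_pmf (replicate_pmf m p) (\<lambda>u. map_pmf (Pair u) (B u)) = recv_pmf m p a c f1 f2"
      by (simp add: recv_pmf_def C1_def C2_def that(1))
    then show ?thesis
      using err measure_pmf.finite_measure_mono[OF that(2), of "recv_pmf m p a c f1 f2"] by simp
  qed

  have "real m * cond_ent (map_pmf (\<lambda>u. (fst u, snd u)) p)
    \<le> expct U (\<lambda>u. expct (pair_pmf (C1 (map fst u)) (C2 (map fst (map snd u))))
        (\<lambda>y. log 2 (pmf (pair_pmf (C1 (map fst u)) (C2 (map fst (map snd u)))) y /
                    pmf (pair_pmf R1 (C2 (map fst (map snd u)))) y))) + fano \<epsilon> K"
    unfolding U_def
  proof (rule code_converse[where hs=fst and ht=snd and B="\<lambda>s t. pair_pmf (C1 s) (C2 (map fst t))"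
        and \<rho>="\<lambda>t. pair_pmf R1 (C2 (map fst t))" and g="\<lambda>(y1, y2) t. fst (g y1 y2 (map snd t))"])
    show "measure_pmf.prob (bind_pmf (replicate_pmf m p)
        (\<lambda>u. map_pmf (Pair u) (pair_pmf (C1 (map fst u)) (C2 (map fst (map snd u))))))
        {(u, y). (case y of (y1, y2) \<Rightarrow> \<lambda>t. fst (g y1 y2 (map snd t))) (map snd u) \<noteq> map fst u} \<le> \<epsilon>"
      by (rule err1) (auto simp: comp_def)
  qed (use fin K1 \<epsilon> ac1 in \<open>auto simp: U_def\<close>)
  also have "expct U (\<lambda>u. expct (pair_pmf (C1 (map fst u)) (C2 (map fst (map snd u))))
        (\<lambda>y. log 2 (pmf (pair_pmf (C1 (map fst u)) (C2 (map fst (map snd u)))) y /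
                    pmf (pair_pmf R1 (C2 (map fst (map snd u)))) y)))
     = expct U (\<lambda>u. expct (pair_pmf (C1 (map fst u)) (C2 (map fst (map snd u))))
        (\<lambda>y. L1 (map fst u) (fst y)))"
    by (intro expct_cong) (auto simp: pmf_pair L1_def set_pmf_iff)
  finally show "real m * cond_ent (map_pmf (\<lambda>(s1, s2, w). (s1, (s2, w))) p)
           \<le> real n * mut_inf (chan_joint Q1 a) + fano \<epsilon> K"
    by (simp add: I1 case_prod_unfold)

  have "real m * cond_ent (map_pmf (\<lambda>u. ((fst \<circ> snd) u, (fst u, snd (snd u)))) p)
    \<le> expct U (\<lambda>u. expct (pair_pmf (C1 (map fst (map (\<lambda>u. (fst u, snd (snd u))) u))) (C2 (map (fst \<circ> snd) u)))
        (\<lambda>y. log 2 (pmf (pair_pmf (C1 (map fst (map (\<lambda>u. (fst u, snd (snd u))) u))) (C2 (map (fst \<circ> snd) u))) y /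
                    pmf (pair_pmf (C1 (map fst (map (\<lambda>u. (fst u, snd (snd u))) u))) R2) y))) + fano \<epsilon> K"
    unfolding U_def
  proof (rule code_converse[where hs="fst \<circ> snd" and ht="\<lambda>u. (fst u, snd (snd u))"
        and B="\<lambda>s t. pair_pmf (C1 (map fst t)) (C2 s)"
        and \<rho>="\<lambda>t. pair_pmf (C1 (map fst t)) R2" and g="\<lambda>(y1, y2) t. snd (g y1 y2 (map snd t))"])
    show "measure_pmf.prob (bind_pmf (replicate_pmf m p)
        (\<lambda>u. map_pmf (Pair u) (pair_pmf (C1 (map fst (map (\<lambda>u. (fst u, snd (snd u))) u))) (C2 (map (fst \<circ> snd) u)))))
        {(u, y). (case y of (y1, y2) \<Rightarrow> \<lambda>t. snd (g y1 y2 (map snd t))) (map (\<lambda>u. (fst u, snd (snd u))) u) \<noteq> map (fst \<circ> snd) u} \<le> \<epsilon>"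
      by (rule err1) (auto simp: comp_def)
  qed (use fin K1 \<epsilon> ac2 in \<open>auto simp: U_def\<close>)
  also have "expct U (\<lambda>u. expct (pair_pmf (C1 (map fst (map (\<lambda>u. (fst u, snd (snd u))) u))) (C2 (map (fst \<circ> snd) u)))
        (\<lambda>y. log 2 (pmf (pair_pmf (C1 (map fst (map (\<lambda>u. (fst u, snd (snd u))) u))) (C2 (map (fst \<circ> snd) u))) y /
                    pmf (pair_pmf (C1 (map fst (map (\<lambda>u. (fst u, snd (snd u))) u))) R2) y)))
     = expct U (\<lambda>u. expct (pair_pmf (C1 (map fst u)) (C2 (map (fst \<circ> snd) u)))
        (\<lambda>y. L2 (map (fst \<circ> snd) u) (snd y)))"
    by (intro expct_cong) (auto simp: pmf_pair L2_def set_pmf_iff comp_def intro!: expct_cong)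
  finally show "real m * cond_ent (map_pmf (\<lambda>(s1, s2, w). (s2, (s1, w))) p)
           \<le> real n * mut_inf (chan_joint Q2 c) + fano \<epsilon> K"
    by (simp add: I2 case_prod_unfold)

  have "real m * cond_ent (map_pmf (\<lambda>u. ((fst u, fst (snd u)), (snd \<circ> snd) u)) p)
    \<le> expct U (\<lambda>u. expct (pair_pmf (C1 (map fst (map (\<lambda>u. (fst u, fst (snd u))) u))) (C2 (map snd (map (\<lambda>u. (fst u, fst (snd u))) u))))
        (\<lambda>y. log 2 (pmf (pair_pmf (C1 (map fst (map (\<lambda>u. (fst u, fst (snd u))) u))) (C2 (map snd (map (\<lambda>u. (fst u, fst (snd u))) u)))) y /
                    pmf (pair_pmf R1 R2) y))) + fano \<epsilon> K"
    unfolding U_def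
  proof (rule code_converse[where hs="\<lambda>u. (fst u, fst (snd u))" and ht="snd \<circ> snd"
        and B="\<lambda>s t. pair_pmf (C1 (map fst s)) (C2 (map snd s))"
        and \<rho>="\<lambda>t. pair_pmf R1 R2" and g="\<lambda>(y1, y2) t. zip (fst (g y1 y2 t)) (snd (g y1 y2 t))"])
    \<comment> \<open>Estimates of unequal length, where \<open>zip\<close> truncates, are decoding
      errors already; the argument rests on two correct estimates zipping to the true pairs.\<close>
    have zip: "zip (map fst u) (map (fst \<circ> snd) u) = map (\<lambda>u. (fst u, fst (snd u))) u" for u :: "('s1 \<times> 's2 \<times> 'w) list"
      by (induction u) auto
    show "measure_pmf.prob (bind_pmf (replicate_pmf m p)
        (\<lambda>u. map_pmf (Pair u) (pair_pmf (C1 (map fst (map (\<lambda>u. (fst u, fst (snd u))) u))) (C2 (map snd (map (\<lambda>u. (fst u, fst (snd u))) u))))))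
        {(u, y). (case y of (y1, y2) \<Rightarrow> \<lambda>t. zip (fst (g y1 y2 t)) (snd (g y1 y2 t))) (map (snd \<circ> snd) u) \<noteq> map (\<lambda>u. (fst u, fst (snd u))) u} \<le> \<epsilon>"
      by (rule err1) (auto simp: comp_def zip[unfolded comp_def])
  qed (use fin K1 \<epsilon> in \<open>auto simp: comp_def
      intro: ac1[unfolded U_def, THEN subsetD] ac2[unfolded U_def comp_def, THEN subsetD]\<close>)
  also have "expct U (\<lambda>u. expct (pair_pmf (C1 (map fst (map (\<lambda>u. (fst u, fst (snd u))) u))) (C2 (map snd (map (\<lambda>u. (fst u, fst (snd u))) u))))
        (\<lambda>y. log 2 (pmf (pair_pmf (C1 (map fst (map (\<lambda>u. (fst u, fst (snd u))) u))) (C2 (map snd (map (\<lambda>u. (fst u, fst (snd u))) u)))) y /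
                    pmf (pair_pmf R1 R2) y)))
     = expct U (\<lambda>u. expct (pair_pmf (C1 (map fst u)) (C2 (map (fst \<circ> snd) u)))
        (\<lambda>y. L1 (map fst u) (fst y) + L2 (map (fst \<circ> snd) u) (snd y)))"
  proof (intro expct_cong, simp add: comp_def, intro expct_cong)
    fix u y assume u: "u \<in> set_pmf U"
      and y: "y \<in> set_pmf (pair_pmf (C1 (map fst u)) (C2 (map (\<lambda>u. fst (snd u)) u)))"
    have "pmf (C1 (map fst u)) (fst y) / pmf R1 (fst y) > 0"
      using ac1[OF u] y by (intro divide_pos_pos pmf_positive) auto
    moreover have "pmf (C2 (map (\<lambda>u. fst (snd u)) u)) (snd y) / pmf R2 (snd y) > 0"
      using ac2[OF u] y by (intro divide_pos_pos pmf_positive) (auto simp: comp_def)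
    ultimately have "log 2 ((pmf (C1 (map fst u)) (fst y) / pmf R1 (fst y)) *
          (pmf (C2 (map (\<lambda>u. fst (snd u)) u)) (snd y) / pmf R2 (snd y)))
      = L1 (map fst u) (fst y) + L2 (map (\<lambda>u. fst (snd u)) u) (snd y)"
      unfolding L1_def L2_def by (intro log_mult_pos)
    then show "log 2 (pmf (pair_pmf (C1 (map fst u)) (C2 (map (\<lambda>u. fst (snd u)) u))) y / pmf (pair_pmf R1 R2) y)
      = L1 (map fst u) (fst y) + L2 (map (\<lambda>u. fst (snd u)) u) (snd y)"
      by (cases y) (simp add: pmf_pair)
  qed
  also have "\<dots> = real n * mut_inf (chan_joint Q1 a) + real n * mut_inf (chan_joint Q2 c)"
    using finU fin by (simp add: expct_add I1 I2)
  finally show "real m * cond_ent (map_pmf (\<lambda>(s1, s2, w). ((s1, s2), w)) p)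
           \<le> real n * (mut_inf (chan_joint Q1 a) + mut_inf (chan_joint Q2 c)) + fano \<epsilon> K"
    by (simp add: case_prod_unfold algebra_simps)
qed

section \<open>Block codes and their receivers\<close>

definition code_pmf where
  "code_pmf P W m f1 f2 = bind_pmf (replicate_pmf m P) (\<lambda>u. map_pmf (Pair u)
     (seq_pmf (map2 W (f1 (map s1_of u)) (f2 (map s2_of u)))))"

lemma err_prob_eq_prob:
  fixes P :: "('s1::finite \<times> 's2::finite \<times> 'w1::finite \<times> 'w2::finite) pmf"
    and W :: "'x1 \<Rightarrow> 'x2 \<Rightarrow> ('y1::finite \<times> 'y2::finite) pmf"
  assumes len: "\<And>s. length s = m \<Longrightarrow> length (f1 s) = n" "\<And>s. length s = m \<Longrightarrow> length (f2 s) = n"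
  shows "err_prob P W m n f1 f2 g1 g2 = measure_pmf.prob (code_pmf P W m f1 f2)
    {(u, y). \<not> (g1 (map fst y) (map w1_of u) = (map s1_of u, map s2_of u)
             \<and> g2 (map snd y) (map w2_of u) = (map s1_of u, map s2_of u))}"
proof -
  define ok where "ok = (\<lambda>u y. g1 (map fst y) (map w1_of u) = (map s1_of u, map s2_of u)
             \<and> g2 (map snd y) (map w2_of u) = (map s1_of u, map s2_of u))"
  define ch where "ch = (\<lambda>u::('s1 \<times> 's2 \<times> 'w1 \<times> 'w2) list. seq_pmf (map2 W (f1 (map s1_of u)) (f2 (map s2_of u))))"
  have inner: "measure_pmf.prob (ch u) {y. \<not> ok u y} = (\<Sum>y\<in>{y. length y = n}.
         (\<Prod>j<n. pmf (W (f1 (map s1_of u) ! j) (f2 (map s2_of u) ! j)) (y ! j)) *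
         (if ok u y then 0 else 1))" if "length u = m" for u
  proof -
    have "measure_pmf.prob (ch u) {y. \<not> ok u y} = expct (ch u) (indicator {y. \<not> ok u y})" by simp
    also have "\<dots> = (\<Sum>y\<in>{y. length y = n}. pmf (ch u) y * indicator {y. \<not> ok u y} y)"
      using that len
      by (subst integral_measure_pmf[OF finite_length_eq[of n]]) (auto simp: ch_def dest!: length_seq_pmf)
    also have "\<dots> = (\<Sum>y\<in>{y. length y = n}.
         (\<Prod>j<n. pmf (W (f1 (map s1_of u) ! j) (f2 (map s2_of u) ! j)) (y ! j)) *
         (if ok u y then 0 else 1))"
      using that len by (intro sum.cong refl) (auto simp: ch_def pmf_seq_pmf)
    finally show ?thesis .
  qed
  have "measure_pmf.prob (code_pmf P W m f1 f2) {(u, y). \<not> ok u y}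
      = expct (replicate_pmf m P) (\<lambda>u. measure_pmf.prob (ch u) {y. \<not> ok u y})"
    by (simp add: code_pmf_def prob_bind ch_def vimage_def)
  also have "\<dots> = (\<Sum>u\<in>{u. length u = m}. pmf (replicate_pmf m P) u * measure_pmf.prob (ch u) {y. \<not> ok u y})"
    by (subst integral_measure_pmf[OF finite_length_eq[of m]]) (auto dest!: length_replicate_pmf)
  also have "\<dots> = err_prob P W m n f1 f2 g1 g2"
  proof (unfold err_prob_def, intro sum.cong refl)
    fix u :: "('s1 \<times> 's2 \<times> 'w1 \<times> 'w2) list"
    assume "u \<in> {u. length u = m}"
    then have "length u = m" by simp
    from pmf_replicate_pmf[OF this, of P] inner[OF this]
    show "pmf (replicate_pmf m P) u * measure_pmf.prob (ch u) {y. \<not> ok u y} = (\<Prod>i<m. pmf P (u ! i)) *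
      (\<Sum>y\<in>{y. length y = n}.
         (\<Prod>j<n. pmf (W (f1 (map s1_of u) ! j) (f2 (map s2_of u) ! j)) (y ! j)) *
         (if g1 (map fst y) (map w1_of u) = (map s1_of u, map s2_of u)
             \<and> g2 (map snd y) (map w2_of u) = (map s1_of u, map s2_of u)
          then 0 else 1))"
      unfolding ok_def by simp
  qed
  finally show ?thesis by (simp add: ok_def)
qed

lemma unzip_seq_pair_pmf:
  fixes a :: "'x1 \<Rightarrow> 'y1 pmf" and c :: "'x2 \<Rightarrow> 'y2 pmf"
  assumes "length x1 = length x2"
  shows "map_pmf unzip (seq_pmf (map2 (\<lambda>x1 x2. pair_pmf (a x1) (c x2)) x1 x2))
       = pair_pmf (seq_pmf (map a x1)) (seq_pmf (map c x2))" (is "map_pmf unzip ?S = _")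
proof (rule pmf_eqI)
  fix z :: "'y1 list \<times> 'y2 list"
  obtain y1 y2 where z: "z = (y1, y2)" by (cases z)
  show "pmf (map_pmf unzip ?S) z = pmf (pair_pmf (seq_pmf (map a x1)) (seq_pmf (map c x2))) z"
  proof (cases "length y1 = length x1 \<and> length y2 = length x2")
    case True
    then have "z = unzip (zip y1 y2)" using assms by (simp add: z unzip_def)
    then have "pmf (map_pmf unzip ?S) z = pmf ?S (zip y1 y2)"
      by (simp only: pmf_map_inj'[OF inj_unzip])
    then show ?thesis using True assms
      by (simp add: z pmf_pair pmf_seq_pmf flip: prod.distrib)
  next
    case False
    have "z \<notin> unzip ` set_pmf ?S"
      using False assms by (auto simp: z unzip_def dest!: length_seq_pmf)
    then have "pmf (map_pmf unzip ?S) z = 0" by (rule pmf_map_outside)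
    moreover have "pmf (pair_pmf (seq_pmf (map a x1)) (seq_pmf (map c x2))) z = 0"
      using False by (auto simp: z pmf_pair pmf_seq_pmf)
    ultimately show ?thesis by simp
  qed
qed

lemma receiver_channel_block:
  assumes "\<And>x1 x2. map_pmf \<pi> (W x1 x2) = pair_pmf (a x1) (c x2)"
    and "length x1 = length x2"
  shows "map_pmf (\<lambda>y. unzip (map \<pi> y)) (seq_pmf (map2 W x1 x2))
       = pair_pmf (seq_pmf (map a x1)) (seq_pmf (map c x2))"
proof -
  have "map_pmf (\<lambda>y. unzip (map \<pi> y)) (seq_pmf (map2 W x1 x2))
      = map_pmf unzip (map_pmf (map \<pi>) (seq_pmf (map2 W x1 x2)))"
    by (simp add: map_pmf_comp)
  also have "map_pmf (map \<pi>) (seq_pmf (map2 W x1 x2))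
      = seq_pmf (map2 (\<lambda>x1 x2. pair_pmf (a x1) (c x2)) x1 x2)"
    by (simp add: map_seq_pmf comp_def assms(1) case_prod_unfold)
  also have "map_pmf unzip \<dots> = pair_pmf (seq_pmf (map a x1)) (seq_pmf (map c x2))"
    using assms(2) by (rule unzip_seq_pair_pmf)
  finally show ?thesis .
qed

text \<open>\<open>\<pi>\<close> selects one receiver's output, whose channel is a product. The
  dependence between the outputs of the two receivers is lost in this projection, so each receiver
  can be treated alone.\<close>

lemma receiver_marginal:
  fixes P :: "('s1 \<times> 's2 \<times> 'w1 \<times> 'w2) pmf"
  assumes \<pi>: "\<And>x1 x2. map_pmf \<pi> (W x1 x2) = pair_pmf (a x1) (c x2)"
    and len: "\<And>s. length s = m \<Longrightarrow> length (f1 s) = n" "\<And>s. length s = m \<Longrightarrow> length (f2 s) = n"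
  shows "map_pmf (\<lambda>(u, y). (map (\<lambda>u. (s1_of u, s2_of u, w u)) u, unzip (map \<pi> y))) (code_pmf P W m f1 f2)
       = recv_pmf m (map_pmf (\<lambda>u. (s1_of u, s2_of u, w u)) P) a c f1 f2"
proof -
  have "map_pmf (\<lambda>y. (map (\<lambda>u. (s1_of u, s2_of u, w u)) u, unzip (map \<pi> y)))
      (seq_pmf (map2 W (f1 (map s1_of u)) (f2 (map s2_of u))))
    = map_pmf (Pair (map (\<lambda>u. (s1_of u, s2_of u, w u)) u))
        (pair_pmf (seq_pmf (map a (f1 (map s1_of u)))) (seq_pmf (map c (f2 (map s2_of u)))))"
    if "u \<in> set_pmf (replicate_pmf m P)" for u
    using length_replicate_pmf[OF that] len
    by (subst receiver_channel_block[where \<pi>=\<pi> and W=W, OF \<pi>, symmetric]) (auto simp: map_pmf_comp)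
  then show ?thesis
    unfolding code_pmf_def recv_pmf_def map_replicate_pmf[symmetric] bind_map_pmf map_bind_pmf
    by (intro bind_pmf_cong refl) (auto simp: map_pmf_comp comp_def)
qed

section \<open>Single-letter marginals of the channel without interference\<close>

lemma in_joint_left:
  assumes "\<And>x1 x2. map_pmf h (W x1 x2) = a x1"
  shows "map_pmf (\<lambda>(x1, x2, y). (x1, h y)) (in_joint P1 P2 W) = chan_joint P1 a"
proof -
  have "map_pmf (\<lambda>y. (x1, h y)) (W x1 x2) = map_pmf (Pair x1) (a x1)" for x1 x2
    unfolding assms[of x1 x2, symmetric] by (simp add: map_pmf_comp)
  then show ?thesis by (simp add: in_joint_def map_bind_pmf map_pmf_comp)
qed

lemma in_joint_right:
  assumes "\<And>x1 x2. map_pmf h (W x1 x2) = c x2"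
  shows "map_pmf (\<lambda>(x1, x2, y). (x2, h y)) (in_joint P1 P2 W) = chan_joint P2 c"
proof -
  have "map_pmf (\<lambda>y. (x2, h y)) (W x1 x2) = map_pmf (Pair x2) (c x2)" for x1 x2
    unfolding assms[of x1 x2, symmetric] by (simp add: map_pmf_comp)
  then show ?thesis by (simp add: in_joint_def map_bind_pmf map_pmf_comp)
qed

text \<open>\<open>q1\<close> and \<open>q2\<close> group the four outputs by transmitter,
  \<open>W\<close> groups them by receiver; \<open>?sh\<close> exchanges the inner two.\<close>

lemma no_interference_decompose:
  fixes W :: "'x1 \<Rightarrow> 'x2 \<Rightarrow> (('y11 \<times> 'y21) \<times> ('y12 \<times> 'y22)) pmf"
  assumes "\<And>y11 y21 y12 y22.
       pmf (W x1 x2) ((y11, y21), (y12, y22)) = pmf (q1 x1) (y11, y12) * pmf (q2 x2) (y21, y22)"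
  shows "W x1 x2 = map_pmf (\<lambda>((y11, y12), (y21, y22)). ((y11, y21), (y12, y22))) (pair_pmf (q1 x1) (q2 x2))"
    (is "_ = map_pmf ?sh _")
proof (rule pmf_eqI)
  fix z :: "('y11 \<times> 'y21) \<times> ('y12 \<times> 'y22)"
  obtain y11 y21 y12 y22 where z: "z = ((y11, y21), (y12, y22))" by (metis surj_pair)
  have "inj ?sh" by (auto simp: inj_def)
  then have "pmf (map_pmf ?sh (pair_pmf (q1 x1) (q2 x2))) (?sh ((y11, y12), (y21, y22)))
      = pmf (pair_pmf (q1 x1) (q2 x2)) ((y11, y12), (y21, y22))"
    by (rule pmf_map_inj')
  then show "pmf (W x1 x2) z = pmf (map_pmf ?sh (pair_pmf (q1 x1) (q2 x2))) z"
    by (simp add: z assms pmf_pair)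
qed

lemma receiver_channels:
  assumes "\<And>x1 x2 y11 y21 y12 y22.
       pmf (W x1 x2) ((y11, y21), (y12, y22)) = pmf (q1 x1) (y11, y12) * pmf (q2 x2) (y21, y22)"
  shows "map_pmf fst (W x1 x2) = pair_pmf (map_pmf fst (q1 x1)) (map_pmf fst (q2 x2))"
    and "map_pmf snd (W x1 x2) = pair_pmf (map_pmf snd (q1 x1)) (map_pmf snd (q2 x2))"
  unfolding no_interference_decompose[where W=W and ?q1.0=q1 and ?q2.0=q2, OF assms]
    map_pair[symmetric] map_pmf_comp
  by (simp_all add: case_prod_unfold)

text \<open>The conditions of a single receiver. \<open>R\<close> is also instantiated with
  \<open>h \<le> i + \<delta>\<close>, the form in which the converse holds at positive error
  probability.\<close>

definition recv_conds ::
  "(real \<Rightarrow> real \<Rightarrow> bool) \<Rightarrow> real \<Rightarrow> ('s1::finite \<times> 's2::finite \<times> 'w::finite) pmf \<Rightarrow>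
   ('x1::finite \<Rightarrow> 'y1::finite pmf) \<Rightarrow> ('x2::finite \<Rightarrow> 'y2::finite pmf) \<Rightarrow> 'x1 pmf \<Rightarrow> 'x2 pmf \<Rightarrow> bool" where
  "recv_conds R b p a c P1 P2 \<longleftrightarrow>
     R (cond_ent (map_pmf (\<lambda>(s1, s2, w). (s1, (s2, w))) p)) (b * mut_inf (chan_joint P1 a)) \<and>
     R (cond_ent (map_pmf (\<lambda>(s1, s2, w). (s2, (s1, w))) p)) (b * mut_inf (chan_joint P2 c)) \<and>
     R (cond_ent (map_pmf (\<lambda>(s1, s2, w). ((s1, s2), w)) p))
       (b * (mut_inf (chan_joint P1 a) + mut_inf (chan_joint P2 c)))"

lemma rate_conds_iff_recv_conds:
  assumes no_int: "\<And>x1 x2 y11 y21 y12 y22.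
       pmf (W x1 x2) ((y11, y21), (y12, y22)) = pmf (q1 x1) (y11, y12) * pmf (q2 x2) (y21, y22)"
  shows "rate_conds R b P W P1 P2 \<longleftrightarrow>
    recv_conds R b (map_pmf (\<lambda>u. (s1_of u, s2_of u, w1_of u)) P)
      (\<lambda>x. map_pmf fst (q1 x)) (\<lambda>x. map_pmf fst (q2 x)) P1 P2 \<and>
    recv_conds R b (map_pmf (\<lambda>u. (s1_of u, s2_of u, w2_of u)) P)
      (\<lambda>x. map_pmf snd (q1 x)) (\<lambda>x. map_pmf snd (q2 x)) P1 P2"
proof -
  note rc = receiver_channels[where W=W, OF no_int]
  have 1: "map_pmf (\<lambda>y. fst (fst y)) (W x1 x2) = map_pmf fst (q1 x1)"
    "map_pmf (\<lambda>y. snd (fst y)) (W x1 x2) = map_pmf fst (q2 x2)"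
    "map_pmf (\<lambda>y. fst (snd y)) (W x1 x2) = map_pmf snd (q1 x1)"
    "map_pmf (\<lambda>y. snd (snd y)) (W x1 x2) = map_pmf snd (q2 x2)" for x1 x2
    using arg_cong[OF rc(1)[of x1 x2], of "map_pmf fst"] arg_cong[OF rc(1)[of x1 x2], of "map_pmf snd"]
      arg_cong[OF rc(2)[of x1 x2], of "map_pmf fst"] arg_cong[OF rc(2)[of x1 x2], of "map_pmf snd"]
    by (simp_all add: map_pmf_comp map_fst_pair_pmf map_snd_pair_pmf)
  note ij = in_joint_left[where h="\<lambda>y. fst (fst y)" and W=W, OF 1(1)]
     in_joint_right[where h="\<lambda>y. snd (fst y)" and W=W, OF 1(2)]
     in_joint_left[where h="\<lambda>y. fst (snd y)" and W=W, OF 1(3)]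
     in_joint_right[where h="\<lambda>y. snd (snd y)" and W=W, OF 1(4)]
  show ?thesis
    unfolding rate_conds_def recv_conds_def Let_def ij
    by (simp add: map_pmf_comp case_prod_unfold s1_of_def s2_of_def w1_of_def w2_of_def add.commute
        conj_ac)
qed

text \<open>Only the term with \<open>log 2 K\<close> grows with the block length; the remainder is
  nonnegative, so multiplying it by \<open>m \<ge> 1\<close> is harmless. The loss per source letter
  then does not involve \<open>m\<close>, about which nothing is known as \<open>\<epsilon>\<close>
  shrinks.\<close>

lemma fano_block_bound:
  assumes "0 < \<epsilon>" "\<epsilon> < 1" "m > 0" "K > 0"
  shows "fano \<epsilon> (K ^ m) \<le> real m * fano \<epsilon> K"
proof -
  have "fano \<epsilon> (K ^ m) = (- log 2 (1 - \<epsilon>) - \<epsilon> * log 2 \<epsilon>) + real m * (\<epsilon> * log 2 K)"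
    using assms by (simp add: fano_def log_divide log_nat_power algebra_simps)
  also have "\<dots> \<le> real m * (- log 2 (1 - \<epsilon>) - \<epsilon> * log 2 \<epsilon>) + real m * (\<epsilon> * log 2 K)"
  proof -
    have "log 2 (1 - \<epsilon>) \<le> 0" "\<epsilon> * log 2 \<epsilon> \<le> 0" using assms by (auto intro: mult_nonneg_nonpos)
    then have "0 \<le> - log 2 (1 - \<epsilon>) - \<epsilon> * log 2 \<epsilon>" by simp
    then show ?thesis using assms by (simp add: mult_le_cancel_right1)
  qed
  also have "\<dots> = real m * fano \<epsilon> K"
    using assms by (simp add: fano_def log_divide algebra_simps)
  finally show ?thesis .
qed

section \<open>Continuity of mutual information\<close>

text \<open>\<open>ln z \<le> z - 1\<close> at \<open>z = 1 / sqrt t\<close>; at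
  \<open>z = 1 / t\<close> it would yield a constant bound, which does not vanish at 0.\<close>

lemma abs_t_ln_t_le:
  fixes t :: real
  assumes "0 \<le> t" "t \<le> 1"
  shows "\<bar>t * ln t\<bar> \<le> 2 * sqrt t"
proof (cases "t = 0")
  case False
  with assms have t: "t > 0" by simp
  have "ln (1 / sqrt t) \<le> 1 / sqrt t" using t by (intro order.trans[OF ln_le_minus_one]) auto
  then have "- ln t \<le> 2 / sqrt t" using t by (simp add: ln_div ln_sqrt)
  then have "t * (- ln t) \<le> t * (2 / sqrt t)" using t by (intro mult_left_mono) auto
  also have "\<dots> = 2 * (t / sqrt t)" by simp
  also have "\<dots> = 2 * sqrt t" using t by (simp only: real_div_sqrt)
  finally show ?thesis using t assms by (simp add: abs_mult)
qed simp

text \<open>Only the limit 0 needs the square-root bound, the logarithm being discontinuous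
  there.\<close>

lemma tendsto_t_log_t:
  fixes r :: "nat \<Rightarrow> real"
  assumes r: "r \<longlonglongrightarrow> l" and r01: "\<And>k. 0 \<le> r k" "\<And>k. r k \<le> 1"
  shows "(\<lambda>k. r k * log 2 (r k)) \<longlonglongrightarrow> l * log 2 l"
proof (cases "l = 0")
  case True
  have "(\<lambda>k. r k * ln (r k)) \<longlonglongrightarrow> 0"
  proof (rule tendsto_rabs_zero_cancel,
      rule tendsto_sandwich[where f="\<lambda>_. 0" and h="\<lambda>k. 2 * sqrt (r k)"])
    show "\<forall>\<^sub>F k in sequentially. \<bar>r k * ln (r k)\<bar> \<le> 2 * sqrt (r k)"
      using abs_t_ln_t_le r01 by simp
    show "(\<lambda>k. 2 * sqrt (r k)) \<longlonglongrightarrow> 0"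
      using tendsto_mult[OF tendsto_const[of 2] tendsto_real_sqrt[OF r]] True by simp
  qed auto
  then have "(\<lambda>k. r k * ln (r k) / ln 2) \<longlonglongrightarrow> 0 / ln 2" by (intro tendsto_divide) auto
  then show ?thesis using True by (simp add: log_def)
next
  case False
  moreover have "l \<ge> 0" using r r01(1) by (intro LIMSEQ_le_const) auto
  ultimately show ?thesis using r by (intro tendsto_intros) auto
qed

text \<open>\<open>k + 2\<close> keeps the error level strictly between 0 and 1 for every
  \<open>k\<close>, as the Fano bound requires.\<close>

lemma fano_tendsto_0:
  assumes "K > 0"
  shows "(\<lambda>k. fano (1 / real (k + 2)) K) \<longlonglongrightarrow> 0"
proof -
  define e where "e = (\<lambda>k::nat. 1 / real (k + 2))"
  have e: "e \<longlonglongrightarrow> 0" unfolding e_def by real_asymp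
  have "(\<lambda>k. - log 2 (1 - e k) - e k * log 2 (e k) + e k * log 2 K) \<longlonglongrightarrow> - log 2 (1 - 0) - 0 * log 2 0 + 0 * log 2 K"
    by (intro tendsto_intros e tendsto_t_log_t) (auto simp: e_def)
  moreover have "fano (e k) K = - log 2 (1 - e k) - e k * log 2 (e k) + e k * log 2 K" for k
  proof -
    have "e k > 0" by (simp add: e_def)
    then show ?thesis using assms by (simp add: fano_def log_divide algebra_simps)
  qed
  ultimately show ?thesis by (simp add: e_def)
qed

text \<open>The vectors of point masses lie in the compact unit cube; nonnegativity and total mass 1
  survive the limit because the sum is finite, so \<open>embed_pmf\<close> turns the limit back into
  a distribution.\<close>

lemma pmf_subseq_convergent:
  fixes p :: "nat \<Rightarrow> 'x::finite pmf"
  shows "\<exists>q r. strict_mono r \<and> (\<forall>x. (\<lambda>k. pmf (p (r k)) x) \<longlonglongrightarrow> pmf q x)"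
proof -
  define v where "v = (\<lambda>k. \<chi> x. pmf (p k) x)"
  have "\<forall>k. v k \<in> cbox 0 (\<chi> x. 1)" by (simp add: v_def mem_box_cart pmf_le_1)
  then obtain l r where lr: "l \<in> cbox 0 (\<chi> x. 1)" "strict_mono r" "(v \<circ> r) \<longlonglongrightarrow> l"
    using compact_cbox[of 0 "\<chi> x::'x. (1::real)"] unfolding compact_def by metis
  have lim: "(\<lambda>k. pmf (p (r k)) x) \<longlonglongrightarrow> l $ x" for x
    using tendsto_vec_nth[OF lr(3), of x] by (simp add: v_def comp_def)
  have nonneg: "l $ x \<ge> 0" for x using lr(1) by (simp add: mem_box_cart)
  have "(\<lambda>k. \<Sum>x\<in>UNIV. pmf (p (r k)) x) \<longlonglongrightarrow> (\<Sum>x\<in>UNIV. l $ x)"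
    by (intro tendsto_sum lim)
  then have "(\<Sum>x\<in>UNIV. l $ x) = 1"
    by (simp add: sum_pmf_eq_1 LIMSEQ_const_iff)
  then have "pmf (embed_pmf (\<lambda>x. l $ x)) x = l $ x" for x
    using nonneg by (intro pmf_embed_pmf) (auto simp: nn_integral_count_space_finite sum_ennreal)
  then show ?thesis using lr(2) lim by metis
qed

lemma pmf_bind_UNIV:
  fixes Q :: "'x::finite pmf"
  shows "pmf (bind_pmf Q a) y = (\<Sum>x\<in>UNIV. pmf Q x * pmf (a x) y)"
  by (simp add: pmf_bind expct_UNIV)

text \<open>As output entropy minus conditional entropy, the dependence on \<open>Q\<close> is a
  linear term plus terms \<open>r * log 2 r\<close>, whose continuity is known. In the ratio form
  denominators may tend to 0.\<close>

lemma mut_inf_chan_joint_entropies: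
  fixes a :: "'x::finite \<Rightarrow> 'y::finite pmf"
  shows "mut_inf (chan_joint Q a) =
    (\<Sum>x\<in>UNIV. pmf Q x * (\<Sum>y\<in>UNIV. pmf (a x) y * log 2 (pmf (a x) y)))
    - (\<Sum>y\<in>UNIV. pmf (bind_pmf Q a) y * log 2 (pmf (bind_pmf Q a) y))"
proof -
  define r where "r = pmf (bind_pmf Q a)"
  have "mut_inf (chan_joint Q a) = (\<Sum>x\<in>UNIV. \<Sum>y\<in>UNIV. pmf Q x * pmf (a x) y * log 2 (pmf (a x) y / r y))"
    by (simp add: mut_inf_chan_joint expct_UNIV r_def sum_distrib_left mult.assoc)
  also have "\<dots> = (\<Sum>x\<in>UNIV. \<Sum>y\<in>UNIV. pmf Q x * pmf (a x) y * log 2 (pmf (a x) y)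
      - pmf Q x * pmf (a x) y * log 2 (r y))"
  proof (intro sum.cong refl)
    fix x y
    show "pmf Q x * pmf (a x) y * log 2 (pmf (a x) y / r y)
        = pmf Q x * pmf (a x) y * log 2 (pmf (a x) y) - pmf Q x * pmf (a x) y * log 2 (r y)"
    proof (cases "pmf Q x * pmf (a x) y = 0")
      case False
      then have "x \<in> set_pmf Q" "y \<in> set_pmf (a x)" by (auto simp: set_pmf_iff)
      then have "r y > 0" "pmf (a x) y > 0" by (auto simp: r_def intro!: pmf_positive)
      then show ?thesis by (simp add: log_divide right_diff_distrib)
    qed auto
  qed
  also have "\<dots> = (\<Sum>x\<in>UNIV. \<Sum>y\<in>UNIV. pmf Q x * pmf (a x) y * log 2 (pmf (a x) y))
     - (\<Sum>y\<in>UNIV. \<Sum>x\<in>UNIV. pmf Q x * pmf (a x) y * log 2 (r y))"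
    unfolding sum_subtractf by (subst (2) sum.swap) simp
  also have "(\<Sum>y\<in>UNIV. \<Sum>x\<in>UNIV. pmf Q x * pmf (a x) y * log 2 (r y)) = (\<Sum>y\<in>UNIV. r y * log 2 (r y))"
    by (simp add: r_def pmf_bind_UNIV sum_distrib_right)
  finally show ?thesis by (simp add: r_def sum_distrib_left mult.assoc)
qed

lemma tendsto_mut_inf:
  fixes a :: "'x::finite \<Rightarrow> 'y::finite pmf"
  assumes "\<And>x. (\<lambda>k. pmf (p k) x) \<longlonglongrightarrow> pmf q x"
  shows "(\<lambda>k. mut_inf (chan_joint (p k) a)) \<longlonglongrightarrow> mut_inf (chan_joint q a)"
proof -
  have "(\<lambda>k. pmf (bind_pmf (p k) a) y) \<longlonglongrightarrow> pmf (bind_pmf q a) y" for y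
    unfolding pmf_bind_UNIV by (intro tendsto_intros assms)
  then show ?thesis
    unfolding mut_inf_chan_joint_entropies
    by (intro tendsto_intros assms tendsto_t_log_t) (auto simp: pmf_le_1)
qed

lemma recv_conds_limit:
  assumes p1: "\<And>x. (\<lambda>k. pmf (p1 k) x) \<longlonglongrightarrow> pmf P1 x"
    and p2: "\<And>x. (\<lambda>k. pmf (p2 k) x) \<longlonglongrightarrow> pmf P2 x"
    and \<delta>: "\<delta> \<longlonglongrightarrow> 0"
    and conds: "\<And>k. recv_conds (\<lambda>h i. h \<le> i + \<delta> k) b p a c (p1 k) (p2 k)"
  shows "recv_conds (\<le>) b p a c P1 P2"
proof -
  note 1 = tendsto_mut_inf[OF p1, of a] and 2 = tendsto_mut_inf[OF p2, of c]
  have "(\<lambda>k. b * mut_inf (chan_joint (p1 k) a) + \<delta> k) \<longlonglongrightarrow> b * mut_inf (chan_joint P1 a) + 0"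
    "(\<lambda>k. b * mut_inf (chan_joint (p2 k) c) + \<delta> k) \<longlonglongrightarrow> b * mut_inf (chan_joint P2 c) + 0"
    "(\<lambda>k. b * (mut_inf (chan_joint (p1 k) a) + mut_inf (chan_joint (p2 k) c)) + \<delta> k)
      \<longlonglongrightarrow> b * (mut_inf (chan_joint P1 a) + mut_inf (chan_joint P2 c)) + 0"
    by (intro tendsto_intros 1 2 \<delta>)+
  from this[THEN LIMSEQ_le_const] show ?thesis
    using conds unfolding recv_conds_def by simp
qed

section \<open>Converse\<close>

text \<open>The encoders read only the two sources, which every receiver's marginal source retains.
  The averaged inputs therefore do not depend on \<open>\<pi>\<close>, \<open>wk\<close> or
  \<open>g\<close>, and both receivers obtain the same pair.\<close>

lemma code_recv_conds:
  fixes P :: "('s1::finite \<times> 's2::finite \<times> 'w1::finite \<times> 'w2::finite) pmf"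
    and W :: "'x1::finite \<Rightarrow> 'x2::finite \<Rightarrow> ('y::finite \<times> 'y'::finite) pmf"
    and wk :: "'s1 \<times> 's2 \<times> 'w1 \<times> 'w2 \<Rightarrow> 'w::finite"
    and a :: "'x1 \<Rightarrow> 'z1::finite pmf" and c :: "'x2 \<Rightarrow> 'z2::finite pmf"
  assumes \<pi>: "\<And>x1 x2. map_pmf \<pi> (W x1 x2) = pair_pmf (a x1) (c x2)"
    and mn: "m > 0" "n > 0"
    and len: "\<And>s. length s = m \<Longrightarrow> length (f1 s) = n" "\<And>s. length s = m \<Longrightarrow> length (f2 s) = n"
    and \<epsilon>: "0 < \<epsilon>" "\<epsilon> < 1"
    and err: "measure_pmf.prob (code_pmf P W m f1 f2)
        {(u, y). g (map \<pi> y) (map wk u) \<noteq> (map s1_of u, map s2_of u)} \<le> \<epsilon>"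
  shows "recv_conds (\<lambda>h i. h \<le> i + fano \<epsilon> (real CARD('s1) * real CARD('s2))) (real n / real m)
      (map_pmf (\<lambda>u. (s1_of u, s2_of u, wk u)) P) a c
      (avg_input n (map_pmf (\<lambda>u. f1 (map s1_of u)) (replicate_pmf m P)))
      (avg_input n (map_pmf (\<lambda>u. f2 (map s2_of u)) (replicate_pmf m P)))"
proof -
  define \<phi> where "\<phi> = (\<lambda>u. (s1_of u, s2_of u, wk u))"
  define p where "p = map_pmf \<phi> P"
  define K where "K = real CARD('s1) * real CARD('s2)"
  have "K > 0" by (simp add: K_def)
  then have fano: "fano \<epsilon> (K ^ m) \<le> real m * fano \<epsilon> K"
    using \<epsilon> mn by (intro fano_block_bound)
  have X: "map_pmf (\<lambda>u. f1 (map fst u)) (replicate_pmf m p) = map_pmf (\<lambda>u. f1 (map s1_of u)) (replicate_pmf m P)"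
    "map_pmf (\<lambda>u. f2 (map (fst \<circ> snd) u)) (replicate_pmf m p) = map_pmf (\<lambda>u. f2 (map s2_of u)) (replicate_pmf m P)"
    by (simp_all add: p_def map_pmf_comp comp_def \<phi>_def flip: map_replicate_pmf)
  have recv: "recv_pmf m p a c f1 f2 = map_pmf (\<lambda>(u, y). (map \<phi> u, unzip (map \<pi> y))) (code_pmf P W m f1 f2)"
    unfolding p_def \<phi>_def by (rule receiver_marginal[OF \<pi> len, symmetric])
  have "measure_pmf.prob (recv_pmf m p a c f1 f2)
        {(u, y1, y2). g (zip y1 y2) (map (snd \<circ> snd) u) \<noteq> (map fst u, map (fst \<circ> snd) u)}
      = measure_pmf.prob (code_pmf P W m f1 f2)
        {(u, y). g (map \<pi> y) (map wk u) \<noteq> (map s1_of u, map s2_of u)}"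
  proof -
    have "zip (map (\<lambda>x. fst (\<pi> x)) y) (map (\<lambda>x. snd (\<pi> x)) y) = map \<pi> y" for y
      by (induction y) auto
    then show ?thesis
      unfolding recv measure_map_pmf
      by (intro arg_cong[where f="measure_pmf.prob _"]) (auto simp: unzip_def comp_def \<phi>_def)
  qed
  then have err': "measure_pmf.prob (recv_pmf m p a c f1 f2)
        {(u, y1, y2). g (zip y1 y2) (map (snd \<circ> snd) u) \<noteq> (map fst u, map (fst \<circ> snd) u)} \<le> \<epsilon>"
    using err by simp
  note rc = receiver_converse[where p=p and a=a and c=c and g="\<lambda>y1 y2. g (zip y1 y2)",
      OF mn(2) len \<epsilon> err', unfolded X, folded K_def]
  have scale: "h \<le> real n / real m * i + fano \<epsilon> K" if "real m * h \<le> real n * i + fano \<epsilon> (K ^ m)" for h i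
  proof -
    have "real m * h \<le> real m * (real n / real m * i + fano \<epsilon> K)"
      using that fano mn by (simp add: distrib_left)
    then show ?thesis using mn by simp
  qed
  show ?thesis
    unfolding recv_conds_def \<phi>_def[symmetric] p_def[symmetric] K_def[symmetric]
    by (intro conjI scale rc)
qed

lemma converse_part:
  fixes P :: "('s1::finite \<times> 's2::finite \<times> 'w1::finite \<times> 'w2::finite) pmf"
    and W :: "'x1::finite \<Rightarrow> 'x2::finite \<Rightarrow>
              (('y11::finite \<times> 'y21::finite) \<times> ('y12::finite \<times> 'y22::finite)) pmf"
  assumes no_int: "\<And>x1 x2 y11 y21 y12 y22.
       pmf (W x1 x2) ((y11, y21), (y12, y22)) = pmf (q1 x1) (y11, y12) * pmf (q2 x2) (y21, y22)"
    and ach: "achievable P W b"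
  shows "\<exists>P1 P2. rate_conds (\<le>) b P W P1 P2"
proof -
  define K where "K = real CARD('s1) * real CARD('s2)"
  define pA where "pA = map_pmf (\<lambda>u. (s1_of u, s2_of u, w1_of u)) P"
  define pB where "pB = map_pmf (\<lambda>u. (s1_of u, s2_of u, w2_of u)) P"
  note rc = receiver_channels[where W=W and ?q1.0=q1 and ?q2.0=q2, OF no_int]
  \<comment> \<open>The block lengths of the code vary with \<open>\<epsilon>\<close> without
    control; what is kept is a statement about inputs in fixed simplices, to which compactness
    applies.\<close>
  have "\<exists>P1 P2. recv_conds (\<lambda>h i. h \<le> i + fano \<epsilon> K) b pA (\<lambda>x. map_pmf fst (q1 x)) (\<lambda>x. map_pmf fst (q2 x)) P1 P2
      \<and> recv_conds (\<lambda>h i. h \<le> i + fano \<epsilon> K) b pB (\<lambda>x. map_pmf snd (q1 x)) (\<lambda>x. map_pmf snd (q2 x)) P1 P2"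
    if \<epsilon>: "0 < \<epsilon>" "\<epsilon> < 1" for \<epsilon>
  proof -
    from ach[unfolded achievable_def, rule_format, OF \<epsilon>(1)] obtain m n f1 f2 g1 g2 where mn: "0 < m" "0 < n" and b: "real n / real m = b"
      and len: "\<forall>s. length s = m \<longrightarrow> length (f1 s) = n" "\<forall>s. length s = m \<longrightarrow> length (f2 s) = n"
      and "err_prob P W m n f1 f2 g1 g2 < \<epsilon>"
      by (elim exE conjE) (rule that)
    then have err: "measure_pmf.prob (code_pmf P W m f1 f2)
      {(u, y). \<not> (g1 (map fst y) (map w1_of u) = (map s1_of u, map s2_of u)
             \<and> g2 (map snd y) (map w2_of u) = (map s1_of u, map s2_of u))} < \<epsilon>"
      by (subst (asm) err_prob_eq_prob) auto
    have errA: "measure_pmf.prob (code_pmf P W m f1 f2)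
        {(u, y). g1 (map fst y) (map w1_of u) \<noteq> (map s1_of u, map s2_of u)} \<le> \<epsilon>"
      by (rule order.trans[OF measure_pmf.finite_measure_mono less_imp_le[OF err]]) auto
    have errB: "measure_pmf.prob (code_pmf P W m f1 f2)
        {(u, y). g2 (map snd y) (map w2_of u) \<noteq> (map s1_of u, map s2_of u)} \<le> \<epsilon>"
      by (rule order.trans[OF measure_pmf.finite_measure_mono less_imp_le[OF err]]) auto
    have len': "\<And>s. length s = m \<Longrightarrow> length (f1 s) = n" "\<And>s. length s = m \<Longrightarrow> length (f2 s) = n"
      using len by auto
    show ?thesis
      using code_recv_conds[where W=W and \<pi>=fst and g=g1 and wk=w1_of, OF rc(1) mn len' \<epsilon> errA]
        code_recv_conds[where W=W and \<pi>=snd and g=g2 and wk=w2_of, OF rc(2) mn len' \<epsilon> errB]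
      unfolding pA_def[symmetric] pB_def[symmetric] K_def[symmetric] b by blast
  qed
  then have "\<forall>k::nat. \<exists>P1 P2.
      recv_conds (\<lambda>h i. h \<le> i + fano (1 / real (k + 2)) K) b pA (\<lambda>x. map_pmf fst (q1 x)) (\<lambda>x. map_pmf fst (q2 x)) P1 P2
      \<and> recv_conds (\<lambda>h i. h \<le> i + fano (1 / real (k + 2)) K) b pB (\<lambda>x. map_pmf snd (q1 x)) (\<lambda>x. map_pmf snd (q2 x)) P1 P2"
    by auto
  then obtain p1 p2 where conds: "\<And>k::nat.
      recv_conds (\<lambda>h i. h \<le> i + fano (1 / real (k + 2)) K) b pA (\<lambda>x. map_pmf fst (q1 x)) (\<lambda>x. map_pmf fst (q2 x)) (p1 k) (p2 k)"
     "\<And>k. recv_conds (\<lambda>h i. h \<le> i + fano (1 / real (k + 2)) K) b pB (\<lambda>x. map_pmf snd (q1 x)) (\<lambda>x. map_pmf snd (q2 x)) (p1 k) (p2 k)"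
    by metis
  obtain P1 r where r: "strict_mono r" "\<And>x. (\<lambda>k. pmf (p1 (r k)) x) \<longlonglongrightarrow> pmf P1 x"
    using pmf_subseq_convergent[of p1] by auto
  \<comment> \<open>The second extraction is made inside the first subsequence, so that both inputs
    converge along the composition of \<open>r\<close> and \<open>r'\<close>.\<close>
  obtain P2 r' where r': "strict_mono r'" "\<And>x. (\<lambda>k. pmf (p2 (r (r' k))) x) \<longlonglongrightarrow> pmf P2 x"
    using pmf_subseq_convergent[of "\<lambda>k. p2 (r k)"] by auto
  have lim1: "(\<lambda>k. pmf (p1 (r (r' k))) x) \<longlonglongrightarrow> pmf P1 x" for x
    using LIMSEQ_subseq_LIMSEQ[OF r(2) r'(1)] by (simp add: comp_def)
  have "K > 0" by (simp add: K_def)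
  from LIMSEQ_subseq_LIMSEQ[OF fano_tendsto_0[OF this] strict_mono_o[OF r(1) r'(1)]]
  have lim0: "(\<lambda>k. fano (1 / real (r (r' k) + 2)) K) \<longlonglongrightarrow> 0" by (simp add: comp_def)
  have "rate_conds (\<le>) b P W P1 P2"
    unfolding rate_conds_iff_recv_conds[where W=W and ?q1.0=q1 and ?q2.0=q2, OF no_int]
      pA_def[symmetric] pB_def[symmetric]
    using recv_conds_limit[OF lim1 r'(2) lim0 conds(1)] recv_conds_limit[OF lim1 r'(2) lim0 conds(2)]
    by blast
  then show ?thesis by blast
qed

section \<open>Weak law of large numbers\<close>

lemma expct_square_sum:
  fixes p :: "'a::finite pmf"
  assumes "expct p g = 0"
  shows "expct (replicate_pmf n p) (\<lambda>xs. (\<Sum>i<n. g (xs ! i))\<^sup>2) = real n * expct p (\<lambda>x. (g x)\<^sup>2)"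
proof (induction n)
  case (Suc n)
  let ?S = "\<lambda>xs. \<Sum>i<n. g (xs ! i)"
  have S: "expct (replicate_pmf n p) ?S = 0"
    using assms by (simp add: expct_sum_replicate_pmf)
  have "expct (replicate_pmf (Suc n) p) (\<lambda>xs. (\<Sum>i<Suc n. g (xs ! i))\<^sup>2)
     = expct p (\<lambda>x. expct (replicate_pmf n p) (\<lambda>xs. (g x + ?S xs)\<^sup>2))"
    by (simp add: expct_bind sum.lessThan_Suc_shift del: sum.lessThan_Suc)
  also have "\<dots> = expct p (\<lambda>x. expct (replicate_pmf n p) (\<lambda>xs. (g x)\<^sup>2 + 2 * g x * ?S xs + (?S xs)\<^sup>2))"
    by (simp add: power2_sum algebra_simps)
  also have "\<dots> = expct p (\<lambda>x. (g x)\<^sup>2 + real n * expct p (\<lambda>x. (g x)\<^sup>2))"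
    by (simp add: expct_add S Suc.IH)
  also have "\<dots> = real (Suc n) * expct p (\<lambda>x. (g x)\<^sup>2)"
    by (simp add: expct_add algebra_simps)
  finally show ?case .
qed simp

text \<open>Chebyshev's inequality for the lower tail, the one on which acceptance of the true pair
  depends.\<close>

lemma chebyshev_replicate_pmf:
  fixes p :: "'a::finite pmf"
  assumes "\<delta> > 0" "n > 0"
  shows "measure_pmf.prob (replicate_pmf n p) {xs. (\<Sum>i<n. f (xs ! i)) \<le> real n * (expct p f - \<delta>)}
     \<le> expct p (\<lambda>x. (f x - expct p f)\<^sup>2) / (\<delta>\<^sup>2 * real n)"
proof -
  define g where "g = (\<lambda>x. f x - expct p f)"
  have g0: "expct p g = 0" by (simp add: g_def expct_diff)
  have "{xs. (\<Sum>i<n. f (xs ! i)) \<le> real n * (expct p f - \<delta>)}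
      \<subseteq> {xs. (\<Sum>i<n. g (xs ! i))\<^sup>2 \<ge> (real n * \<delta>)\<^sup>2}"
  proof safe
    fix xs assume "(\<Sum>i<n. f (xs ! i)) \<le> real n * (expct p f - \<delta>)"
    then have "(\<Sum>i<n. g (xs ! i)) \<le> - (real n * \<delta>)"
      by (simp add: g_def sum_subtractf algebra_simps)
    then have "real n * \<delta> \<le> - (\<Sum>i<n. g (xs ! i))" by simp
    then have "(real n * \<delta>)\<^sup>2 \<le> (- (\<Sum>i<n. g (xs ! i)))\<^sup>2"
      using assms by (intro power_mono) auto
    then show "(real n * \<delta>)\<^sup>2 \<le> (\<Sum>i<n. g (xs ! i))\<^sup>2" by simp
  qed
  then have "measure_pmf.prob (replicate_pmf n p) {xs. (\<Sum>i<n. f (xs ! i)) \<le> real n * (expct p f - \<delta>)}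
     \<le> measure_pmf.prob (replicate_pmf n p) {xs. (\<Sum>i<n. g (xs ! i))\<^sup>2 \<ge> (real n * \<delta>)\<^sup>2}"
    by (intro measure_pmf.finite_measure_mono) auto
  also have "\<dots> \<le> expct (replicate_pmf n p) (\<lambda>xs. (\<Sum>i<n. g (xs ! i))\<^sup>2) / (real n * \<delta>)\<^sup>2"
    using assms by (intro markov_prob) auto
  also have "\<dots> = expct p (\<lambda>x. (g x)\<^sup>2) / (\<delta>\<^sup>2 * real n)"
    using assms unfolding expct_square_sum[OF g0] by (simp add: power2_eq_square field_simps)
  finally show ?thesis by (simp add: g_def)
qed

text \<open>Source and channel blocks grow along \<open>m0 * L\<close> and \<open>n0 * L\<close>
  with fixed \<open>m0\<close> and \<open>n0\<close>, so the law is needed along multiples of a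
  constant.\<close>

lemma weak_law:
  fixes p :: "'a::finite pmf"
  assumes "\<delta> > 0" "k > 0" "\<eta> > 0"
  shows "\<forall>\<^sub>F L in sequentially. measure_pmf.prob (replicate_pmf (k * L) p)
     {xs. (\<Sum>i<k * L. f (xs ! i)) \<le> real (k * L) * (expct p f - \<delta>)} \<le> \<eta>"
proof -
  define V where "V = expct p (\<lambda>x. (f x - expct p f)\<^sup>2)"
  have "(\<lambda>L. V / (\<delta>\<^sup>2 * (real k * real L))) \<longlonglongrightarrow> 0"
    using assms by real_asymp
  then have "\<forall>\<^sub>F L in sequentially. V / (\<delta>\<^sup>2 * (real k * real L)) < \<eta>"
    using assms by (intro order_tendstoD)
  then show ?thesis
    using eventually_gt_at_top[of "0::nat"]
  proof eventually_elim
    case (elim L)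
    then show ?case
      using chebyshev_replicate_pmf[of \<delta> "k * L" p f] assms by (simp add: V_def)
  qed
qed

section \<open>Random coding\<close>

text \<open>Random coding uses pairwise independence of the codewords, because a union bound
  compares the true block with one wrong block at a time.\<close>

lemma Pi_pmf_two_components:
  assumes "finite A" "s \<in> A" "s' \<in> A" "s \<noteq> s'"
  shows "map_pmf (\<lambda>f. (f s, f s')) (Pi_pmf A d (\<lambda>_. Q)) = pair_pmf Q Q"
proof -
  define A' where "A' = A - {s}"
  have A: "A = insert s A'" "finite A'" "s \<notin> A'" "s' \<in> A'" using assms by (auto simp: A'_def)
  have "map_pmf (\<lambda>f. (f s, f s')) (Pi_pmf A d (\<lambda>_. Q))
      = map_pmf (\<lambda>(y, f). (y, f s')) (pair_pmf Q (Pi_pmf A' d (\<lambda>_. Q)))"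
    using assms(4) A unfolding A(1) by (simp add: Pi_pmf_insert map_pmf_comp case_prod_unfold)
  also have "\<dots> = pair_pmf (map_pmf id Q) (map_pmf (\<lambda>f. f s') (Pi_pmf A' d (\<lambda>_. Q)))"
    unfolding map_pair[symmetric] by simp
  also have "\<dots> = pair_pmf Q Q" using A by (simp add: Pi_pmf_component)
  finally show ?thesis .
qed

text \<open>\<open>Pi_pmf\<close> pins the codebooks to \<open>undefined\<close> outside the finite
  index sets, so there are finitely many of them when the codeword laws have finite support.\<close>

definition random_code_pmf where
  "random_code_pmf A1 A2 Q1 Q2 C s t =
     bind_pmf (Pi_pmf A1 undefined (\<lambda>_. Q1)) (\<lambda>F1. bind_pmf (Pi_pmf A2 undefined (\<lambda>_. Q2))
       (\<lambda>F2. map_pmf (\<lambda>y. (F1, F2, y)) (C (F1 s) (F2 t))))"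

abbreviation rand_out where
  "rand_out Q1 Q2 C \<equiv> bind_pmf Q1 (\<lambda>x1. bind_pmf Q2 (C x1))"

text \<open>The output is generated from \<open>F1 s\<close> and \<open>F2 t\<close>; for
  \<open>s' \<noteq> s\<close> the codeword \<open>F1 s'\<close> is a fresh draw, independent of it.
  The test for a wrong first component reads no codeword of the second sender, so
  \<open>F2 t\<close> can be averaged into the output law.\<close>

lemma random_code_left:
  assumes "finite A1" "s \<in> A1" "s' \<in> A1" "s \<noteq> s'" and "finite A2" "t \<in> A2"
  shows "map_pmf (\<lambda>(F1, F2, y). (F1 s', y)) (random_code_pmf A1 A2 Q1 Q2 C s t)
       = pair_pmf Q1 (rand_out Q1 Q2 C)"
proof -
  have "map_pmf (\<lambda>(F1, F2, y). (F1 s', y)) (random_code_pmf A1 A2 Q1 Q2 C s t)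
     = bind_pmf (map_pmf (\<lambda>F. (F s, F s')) (Pi_pmf A1 undefined (\<lambda>_. Q1))) (\<lambda>(x, x').
         bind_pmf (map_pmf (\<lambda>F. F t) (Pi_pmf A2 undefined (\<lambda>_. Q2))) (\<lambda>x2. map_pmf (Pair x') (C x x2)))"
    by (simp add: random_code_pmf_def map_bind_pmf bind_map_pmf map_pmf_comp)
  also have "\<dots> = bind_pmf Q1 (\<lambda>x. bind_pmf Q1 (\<lambda>x'. bind_pmf Q2 (\<lambda>x2. map_pmf (Pair x') (C x x2))))"
    using assms by (simp add: Pi_pmf_two_components Pi_pmf_component pair_pmf_def bind_assoc_pmf bind_return_pmf)
  also have "\<dots> = bind_pmf Q1 (\<lambda>x'. bind_pmf Q1 (\<lambda>x. bind_pmf Q2 (\<lambda>x2. map_pmf (Pair x') (C x x2))))"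
    by (rule bind_commute_pmf)
  also have "\<dots> = pair_pmf Q1 (rand_out Q1 Q2 C)"
    by (simp add: pair_pmf_def map_pmf_def bind_assoc_pmf bind_return_pmf)
  finally show ?thesis .
qed

lemma random_code_right:
  assumes "finite A1" "s \<in> A1" and "finite A2" "t \<in> A2" "t' \<in> A2" "t \<noteq> t'"
  shows "map_pmf (\<lambda>(F1, F2, y). (F2 t', y)) (random_code_pmf A1 A2 Q1 Q2 C s t)
       = pair_pmf Q2 (rand_out Q1 Q2 C)"
proof -
  have "map_pmf (\<lambda>(F1, F2, y). (F2 t', y)) (random_code_pmf A1 A2 Q1 Q2 C s t)
     = bind_pmf (map_pmf (\<lambda>F. F s) (Pi_pmf A1 undefined (\<lambda>_. Q1))) (\<lambda>x.
         bind_pmf (map_pmf (\<lambda>F. (F t, F t')) (Pi_pmf A2 undefined (\<lambda>_. Q2))) (\<lambda>(x2, x2'). map_pmf (Pair x2') (C x x2)))"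
    by (simp add: random_code_pmf_def map_bind_pmf bind_map_pmf map_pmf_comp)
  also have "\<dots> = bind_pmf Q1 (\<lambda>x. bind_pmf Q2 (\<lambda>x2. bind_pmf Q2 (\<lambda>x2'. map_pmf (Pair x2') (C x x2))))"
    using assms by (simp add: Pi_pmf_two_components Pi_pmf_component pair_pmf_def bind_assoc_pmf bind_return_pmf)
  also have "\<dots> = bind_pmf Q1 (\<lambda>x. bind_pmf Q2 (\<lambda>x2'. bind_pmf Q2 (\<lambda>x2. map_pmf (Pair x2') (C x x2))))"
    by (intro bind_pmf_cong refl bind_commute_pmf)
  also have "\<dots> = bind_pmf Q2 (\<lambda>x2'. bind_pmf Q1 (\<lambda>x. bind_pmf Q2 (\<lambda>x2. map_pmf (Pair x2') (C x x2))))"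
    by (rule bind_commute_pmf)
  also have "\<dots> = pair_pmf Q2 (rand_out Q1 Q2 C)"
    by (simp add: pair_pmf_def map_pmf_def bind_assoc_pmf bind_return_pmf)
  finally show ?thesis .
qed

lemma random_code_both:
  assumes "finite A1" "s \<in> A1" "s' \<in> A1" "s \<noteq> s'" and "finite A2" "t \<in> A2" "t' \<in> A2" "t \<noteq> t'"
  shows "map_pmf (\<lambda>(F1, F2, y). ((F1 s', F2 t'), y)) (random_code_pmf A1 A2 Q1 Q2 C s t)
       = pair_pmf (pair_pmf Q1 Q2) (rand_out Q1 Q2 C)"
proof -
  have "map_pmf (\<lambda>(F1, F2, y). ((F1 s', F2 t'), y)) (random_code_pmf A1 A2 Q1 Q2 C s t)
     = bind_pmf (map_pmf (\<lambda>F. (F s, F s')) (Pi_pmf A1 undefined (\<lambda>_. Q1))) (\<lambda>(x, x').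
         bind_pmf (map_pmf (\<lambda>F. (F t, F t')) (Pi_pmf A2 undefined (\<lambda>_. Q2)))
           (\<lambda>(x2, x2'). map_pmf (Pair (x', x2')) (C x x2)))"
    by (simp add: random_code_pmf_def map_bind_pmf bind_map_pmf map_pmf_comp)
  also have "\<dots> = bind_pmf Q1 (\<lambda>x. bind_pmf Q1 (\<lambda>x'. bind_pmf Q2 (\<lambda>x2. bind_pmf Q2 (\<lambda>x2'.
      map_pmf (Pair (x', x2')) (C x x2)))))"
    using assms by (simp add: Pi_pmf_two_components pair_pmf_def bind_assoc_pmf bind_return_pmf)
  also have "\<dots> = bind_pmf Q1 (\<lambda>x. bind_pmf Q1 (\<lambda>x'. bind_pmf Q2 (\<lambda>x2'. bind_pmf Q2 (\<lambda>x2.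
      map_pmf (Pair (x', x2')) (C x x2)))))"
    by (intro bind_pmf_cong refl bind_commute_pmf)
  also have "\<dots> = bind_pmf Q1 (\<lambda>x'. bind_pmf Q1 (\<lambda>x. bind_pmf Q2 (\<lambda>x2'. bind_pmf Q2 (\<lambda>x2.
      map_pmf (Pair (x', x2')) (C x x2)))))"
    by (rule bind_commute_pmf)
  also have "\<dots> = bind_pmf Q1 (\<lambda>x'. bind_pmf Q2 (\<lambda>x2'. bind_pmf Q1 (\<lambda>x. bind_pmf Q2 (\<lambda>x2.
      map_pmf (Pair (x', x2')) (C x x2)))))"
    by (intro bind_pmf_cong refl bind_commute_pmf)
  also have "\<dots> = pair_pmf (pair_pmf Q1 Q2) (rand_out Q1 Q2 C)"
    by (simp add: pair_pmf_def map_pmf_def bind_assoc_pmf bind_return_pmf)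
  finally show ?thesis .
qed

text \<open>Markov's inequality is applied for each fixed \<open>y\<close>, which is why the mean of
  \<open>d\<close> is bounded for every \<open>y\<close>; the result is uniform in the output law
  \<open>Y\<close>.\<close>

lemma markov_pair_pmf:
  assumes "finite (set_pmf Q)" "\<And>x y. d x y \<ge> 0" "\<And>y. expct Q (\<lambda>x. d x y) \<le> 1" "v \<ge> 0" "\<gamma> > 0"
  shows "measure_pmf.prob (pair_pmf Q Y) {(x, y). v * d x y > \<gamma>} \<le> v / \<gamma>"
proof -
  have "pair_pmf Q Y = bind_pmf Y (\<lambda>y. map_pmf (\<lambda>x. (x, y)) Q)"
    unfolding pair_pmf_def map_pmf_def by (rule bind_commute_pmf)
  moreover have "measure_pmf.prob (map_pmf (\<lambda>x. (x, y)) Q) {(x, y). v * d x y > \<gamma>} \<le> v / \<gamma>" for y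
  proof -
    have "measure_pmf.prob (map_pmf (\<lambda>x. (x, y)) Q) {(x, y). v * d x y > \<gamma>}
        \<le> measure_pmf.prob Q {x. v * d x y \<ge> \<gamma>}"
      unfolding measure_map_pmf by (intro measure_pmf.finite_measure_mono) auto
    also have "\<dots> \<le> expct Q (\<lambda>x. v * d x y) / \<gamma>"
      using assms by (intro markov_prob) auto
    also have "\<dots> \<le> v / \<gamma>"
      using assms(3)[of y] assms(4,5) by (simp add: divide_right_mono mult_left_le)
    finally show ?thesis .
  qed
  ultimately show ?thesis by (simp only: prob_bind_le)
qed

text \<open>The weights \<open>v1\<close>, \<open>v2\<close>, \<open>v3\<close> sum to at most 1, so
  the union bound over all candidates costs nothing; the 3 counts the kinds of wrong pair. In
  \<open>acc1\<close> the second component is the true \<open>t\<close>, so \<open>v1\<close> may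
  depend on it, and likewise \<open>v2\<close> on \<open>s\<close>.\<close>

lemma false_acceptance:
  assumes fin: "finite A1" "finite A2" "finite (set_pmf Q1)" "finite (set_pmf Q2)"
    and st: "s \<in> A1" "t \<in> A2" and \<gamma>: "\<gamma> > 0"
    and d1: "\<And>x y. d1 x y \<ge> 0" "\<And>y. expct Q1 (\<lambda>x. d1 x y) \<le> 1"
    and d2: "\<And>x y. d2 x y \<ge> 0" "\<And>y. expct Q2 (\<lambda>x. d2 x y) \<le> 1"
    and v1: "\<And>s. v1 s \<ge> 0" "(\<Sum>s\<in>A1. v1 s) \<le> 1"
    and v2: "\<And>t. v2 t \<ge> 0" "(\<Sum>t\<in>A2. v2 t) \<le> 1"
    and v3: "\<And>s t. v3 s t \<ge> 0" "(\<Sum>s\<in>A1. \<Sum>t\<in>A2. v3 s t) \<le> 1"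
    and acc1: "\<And>s' x1 x2 y. acc s' t x1 x2 y \<Longrightarrow> v1 s' * d1 x1 y > \<gamma>"
    and acc2: "\<And>t' x1 x2 y. acc s t' x1 x2 y \<Longrightarrow> v2 t' * d2 x2 y > \<gamma>"
    and acc3: "\<And>s' t' x1 x2 y. acc s' t' x1 x2 y \<Longrightarrow> v3 s' t' * (d1 x1 y * d2 x2 y) > \<gamma>"
  shows "measure_pmf.prob (random_code_pmf A1 A2 Q1 Q2 C s t)
    {(F1, F2, y). \<exists>s'\<in>A1. \<exists>t'\<in>A2. (s', t') \<noteq> (s, t) \<and> acc s' t' (F1 s') (F2 t') y} \<le> 3 / \<gamma>"
proof -
  let ?R = "random_code_pmf A1 A2 Q1 Q2 C s t"
  define E1 where "E1 = (\<lambda>s'. {(F1 :: 'a \<Rightarrow> 'c, F2 :: 'b \<Rightarrow> 'd, y). v1 s' * d1 (F1 s') y > \<gamma>})"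
  define E2 where "E2 = (\<lambda>t'. {(F1 :: 'a \<Rightarrow> 'c, F2 :: 'b \<Rightarrow> 'd, y). v2 t' * d2 (F2 t') y > \<gamma>})"
  define E3 where "E3 = (\<lambda>(s', t'). {(F1 :: 'a \<Rightarrow> 'c, F2 :: 'b \<Rightarrow> 'd, y).
      v3 s' t' * (d1 (F1 s') y * d2 (F2 t') y) > \<gamma>})"
  let ?U1 = "\<Union>s'\<in>A1 - {s}. E1 s'" and ?U2 = "\<Union>t'\<in>A2 - {t}. E2 t'"
    and ?U3 = "\<Union>z\<in>(A1 - {s}) \<times> (A2 - {t}). E3 z"
  have e1: "measure_pmf.prob ?R (E1 s') \<le> v1 s' / \<gamma>" if "s' \<in> A1 - {s}" for s'
  proof -
    have "measure_pmf.prob ?R (E1 s') = measure_pmf.prob (map_pmf (\<lambda>(F1, F2, y). (F1 s', y)) ?R)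
        {(x, y). v1 s' * d1 x y > \<gamma>}"
      unfolding measure_map_pmf by (intro arg_cong[where f="measure_pmf.prob _"]) (auto simp: E1_def)
    also have "\<dots> \<le> v1 s' / \<gamma>"
      using that fin st d1 v1 \<gamma> by (subst random_code_left) (auto intro!: markov_pair_pmf)
    finally show ?thesis .
  qed
  have e2: "measure_pmf.prob ?R (E2 t') \<le> v2 t' / \<gamma>" if "t' \<in> A2 - {t}" for t'
  proof -
    have "measure_pmf.prob ?R (E2 t') = measure_pmf.prob (map_pmf (\<lambda>(F1, F2, y). (F2 t', y)) ?R)
        {(x, y). v2 t' * d2 x y > \<gamma>}"
      unfolding measure_map_pmf by (intro arg_cong[where f="measure_pmf.prob _"]) (auto simp: E2_def)
    also have "\<dots> \<le> v2 t' / \<gamma>"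
      using that fin st d2 v2 \<gamma> by (subst random_code_right) (auto intro!: markov_pair_pmf)
    finally show ?thesis .
  qed
  \<comment> \<open>Two wrong codewords are independent of each other as well, so the mean of the
    product of their ratios is the product of the means.\<close>
  have d12: "expct (pair_pmf Q1 Q2) (\<lambda>x. d1 (fst x) y * d2 (snd x) y) \<le> 1" for y
  proof -
    have "expct (pair_pmf Q1 Q2) (\<lambda>x. d1 (fst x) y * d2 (snd x) y)
        = expct Q1 (\<lambda>x. d1 x y) * expct Q2 (\<lambda>x. d2 x y)"
      using fin unfolding pair_pmf_def by (simp add: expct_bind)
    also have "\<dots> \<le> 1"
      using d1 d2 by (intro mult_le_one) (auto intro: integral_nonneg_AE)
    finally show ?thesis .
  qed
  have e3: "measure_pmf.prob ?R (E3 z) \<le> (case z of (s', t') \<Rightarrow> v3 s' t') / \<gamma>"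
    if "z \<in> (A1 - {s}) \<times> (A2 - {t})" for z
  proof -
    obtain s' t' where z: "z = (s', t')" by (cases z)
    have "measure_pmf.prob ?R (E3 z) = measure_pmf.prob (map_pmf (\<lambda>(F1, F2, y). ((F1 s', F2 t'), y)) ?R)
        {(x, y). v3 s' t' * (d1 (fst x) y * d2 (snd x) y) > \<gamma>}"
      unfolding measure_map_pmf by (intro arg_cong[where f="measure_pmf.prob _"]) (auto simp: E3_def z)
    also have "\<dots> \<le> v3 s' t' / \<gamma>"
      using that fin st d1(1) d2(1) d12 v3 \<gamma>
      by (subst random_code_both) (auto simp: z intro!: markov_pair_pmf)
    finally show ?thesis by (simp add: z)
  qed
  have u1: "measure_pmf.prob ?R ?U1 \<le> 1 / \<gamma>"
  proof -
    have "measure_pmf.prob ?R ?U1 \<le> (\<Sum>s'\<in>A1 - {s}. measure_pmf.prob ?R (E1 s'))"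
      using fin by (intro measure_pmf.finite_measure_subadditive_finite) auto
    also have "\<dots> \<le> (\<Sum>s'\<in>A1 - {s}. v1 s' / \<gamma>)" by (intro sum_mono e1)
    also have "\<dots> \<le> (\<Sum>s'\<in>A1. v1 s' / \<gamma>)" using fin v1 \<gamma> by (intro sum_mono2) auto
    also have "\<dots> \<le> 1 / \<gamma>" using v1 \<gamma> by (simp add: divide_right_mono flip: sum_divide_distrib)
    finally show ?thesis .
  qed
  have u2: "measure_pmf.prob ?R ?U2 \<le> 1 / \<gamma>"
  proof -
    have "measure_pmf.prob ?R ?U2 \<le> (\<Sum>t'\<in>A2 - {t}. measure_pmf.prob ?R (E2 t'))"
      using fin by (intro measure_pmf.finite_measure_subadditive_finite) auto
    also have "\<dots> \<le> (\<Sum>t'\<in>A2 - {t}. v2 t' / \<gamma>)" by (intro sum_mono e2)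
    also have "\<dots> \<le> (\<Sum>t'\<in>A2. v2 t' / \<gamma>)" using fin v2 \<gamma> by (intro sum_mono2) auto
    also have "\<dots> \<le> 1 / \<gamma>" using v2 \<gamma> by (simp add: divide_right_mono flip: sum_divide_distrib)
    finally show ?thesis .
  qed
  have u3: "measure_pmf.prob ?R ?U3 \<le> 1 / \<gamma>"
  proof -
    have "measure_pmf.prob ?R ?U3 \<le> (\<Sum>z\<in>(A1 - {s}) \<times> (A2 - {t}). measure_pmf.prob ?R (E3 z))"
      using fin by (intro measure_pmf.finite_measure_subadditive_finite) auto
    also have "\<dots> \<le> (\<Sum>z\<in>(A1 - {s}) \<times> (A2 - {t}). (case z of (s', t') \<Rightarrow> v3 s' t') / \<gamma>)"
      by (intro sum_mono e3)
    also have "\<dots> \<le> (\<Sum>z\<in>A1 \<times> A2. (case z of (s', t') \<Rightarrow> v3 s' t') / \<gamma>)"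
      using fin v3 \<gamma> by (intro sum_mono2) auto
    also have "\<dots> = (\<Sum>s\<in>A1. \<Sum>t\<in>A2. v3 s t) / \<gamma>"
      by (simp add: sum.cartesian_product flip: sum_divide_distrib)
    also have "\<dots> \<le> 1 / \<gamma>" using v3 \<gamma> by (simp add: divide_right_mono)
    finally show ?thesis .
  qed
  have "measure_pmf.prob ?R {(F1, F2, y). \<exists>s'\<in>A1. \<exists>t'\<in>A2. (s', t') \<noteq> (s, t) \<and> acc s' t' (F1 s') (F2 t') y}
      \<le> measure_pmf.prob ?R (?U1 \<union> ?U2 \<union> ?U3)"
  proof (intro measure_pmf.finite_measure_mono)
    show "{(F1, F2, y). \<exists>s'\<in>A1. \<exists>t'\<in>A2. (s', t') \<noteq> (s, t) \<and> acc s' t' (F1 s') (F2 t') y} \<subseteq> ?U1 \<union> ?U2 \<union> ?U3"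
    proof
      fix z assume "z \<in> {(F1, F2, y). \<exists>s'\<in>A1. \<exists>t'\<in>A2. (s', t') \<noteq> (s, t) \<and> acc s' t' (F1 s') (F2 t') y}"
      then obtain F1 F2 y s' t' where z: "z = (F1, F2, y)"
        and *: "s' \<in> A1" "t' \<in> A2" "acc s' t' (F1 s') (F2 t') y" "(s', t') \<noteq> (s, t)" by auto
      consider "t' = t" "s' \<noteq> s" | "s' = s" "t' \<noteq> t" | "s' \<noteq> s" "t' \<noteq> t" using * by auto
      then show "z \<in> ?U1 \<union> ?U2 \<union> ?U3"
      proof cases
        case 1
        then have "\<gamma> < v1 s' * d1 (F1 s') y" using * by (intro acc1) auto
        then have "(F1, F2, y) \<in> E1 s'" by (simp add: E1_def)
        then show ?thesis using *(1) 1(2) unfolding z by blast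
      next
        case 2
        then have "\<gamma> < v2 t' * d2 (F2 t') y" using * by (intro acc2) auto
        then have "(F1, F2, y) \<in> E2 t'" by (simp add: E2_def)
        then show ?thesis using *(2) 2(2) unfolding z by blast
      next
        case 3
        have "\<gamma> < v3 s' t' * (d1 (F1 s') y * d2 (F2 t') y)" using * by (intro acc3)
        then have "(F1, F2, y) \<in> E3 (s', t')" by (simp add: E3_def)
        then show ?thesis using *(1,2) 3 unfolding z by blast
      qed
    qed
  qed auto
  also have "\<dots> \<le> measure_pmf.prob ?R (?U1 \<union> ?U2) + measure_pmf.prob ?R ?U3"
    by (intro measure_Un_le) auto
  also have "\<dots> \<le> measure_pmf.prob ?R ?U1 + measure_pmf.prob ?R ?U2 + measure_pmf.prob ?R ?U3"
    by (intro add_right_mono measure_Un_le) auto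
  also have "\<dots> \<le> 3 / \<gamma>" using u1 u2 u3 by simp
  finally show ?thesis .
qed

section \<open>Existence of one pair of codebooks for both receivers\<close>

lemma prob_bind_exists:
  assumes "finite (set_pmf p)" "measure_pmf.prob (bind_pmf p f) X \<le> c"
  shows "\<exists>x\<in>set_pmf p. measure_pmf.prob (f x) X \<le> c"
proof (rule ccontr)
  assume "\<not> ?thesis"
  then have gt: "\<And>x. x \<in> set_pmf p \<Longrightarrow> c < measure_pmf.prob (f x) X" by auto
  \<comment> \<open>All values exceed \<open>c\<close>; by finiteness of the support so does their
    minimum, which keeps the comparison with the mean strict.\<close>
  define \<mu> where "\<mu> = Min ((\<lambda>x. measure_pmf.prob (f x) X) ` set_pmf p)"
  have "\<mu> \<in> (\<lambda>x. measure_pmf.prob (f x) X) ` set_pmf p"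
    unfolding \<mu>_def using assms(1) set_pmf_not_empty[of p] by (intro Min_in) auto
  then have "c < \<mu>" using gt by auto
  moreover have "\<mu> \<le> expct p (\<lambda>x. measure_pmf.prob (f x) X)"
    using expct_mono[OF assms(1), of "\<lambda>_. \<mu>" "\<lambda>x. measure_pmf.prob (f x) X"] assms(1)
    by (auto simp: \<mu>_def)
  ultimately show False using assms(2) by (simp add: prob_bind)
qed

text \<open>For fixed source blocks the codewords are drawn independently, so their joint law with
  the output is the same for all blocks. Correlation of the sources does not reach the channel, and
  source and channel ratios can be treated by separate laws of large numbers.\<close>

lemma random_code_true_words:
  assumes "finite A1" "s \<in> A1" "finite A2" "t \<in> A2"
  shows "map_pmf (\<lambda>(F1, F2, y). (F1 s, F2 t, y)) (random_code_pmf A1 A2 Q1 Q2 C s t) = in_joint Q1 Q2 C"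
proof -
  have "map_pmf (\<lambda>(F1, F2, y). (F1 s, F2 t, y)) (random_code_pmf A1 A2 Q1 Q2 C s t)
     = bind_pmf (map_pmf (\<lambda>F. F s) (Pi_pmf A1 undefined (\<lambda>_. Q1))) (\<lambda>x.
         bind_pmf (map_pmf (\<lambda>F. F t) (Pi_pmf A2 undefined (\<lambda>_. Q2))) (\<lambda>x2. map_pmf (\<lambda>y. (x, x2, y)) (C x x2)))"
    by (simp add: random_code_pmf_def map_bind_pmf bind_map_pmf map_pmf_comp)
  then show ?thesis using assms by (simp add: Pi_pmf_component in_joint_def)
qed

text \<open>\<open>\<alpha>\<close> bounds rejection of the true pair and \<open>\<beta>\<close>
  acceptance of a wrong one; the factor 2 counts the receivers. Side information enters through
  \<open>u\<close> in the observations \<open>ob1\<close> and \<open>ob2\<close>.\<close>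

lemma random_coding_exists:
  fixes \<sigma>1 :: "'u \<Rightarrow> 'a" and \<sigma>2 :: "'u \<Rightarrow> 'b" and C :: "'x1 \<Rightarrow> 'x2 \<Rightarrow> 'y pmf"
    and ob1 :: "'u \<Rightarrow> 'y \<Rightarrow> 'o1" and ob2 :: "'u \<Rightarrow> 'y \<Rightarrow> 'o2"
  assumes fin: "finite A1" "finite A2" "finite (set_pmf Q1)" "finite (set_pmf Q2)"
    and \<sigma>: "\<And>u. u \<in> set_pmf U \<Longrightarrow> \<sigma>1 u \<in> A1" "\<And>u. u \<in> set_pmf U \<Longrightarrow> \<sigma>2 u \<in> A2"
    and false1: "\<And>u. u \<in> set_pmf U \<Longrightarrow>
      measure_pmf.prob (random_code_pmf A1 A2 Q1 Q2 C (\<sigma>1 u) (\<sigma>2 u))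
       {(F1, F2, y). \<exists>s\<in>A1. \<exists>t\<in>A2. (s, t) \<noteq> (\<sigma>1 u, \<sigma>2 u) \<and> acc1 s t (F1 s) (F2 t) (ob1 u y)} \<le> \<beta>"
    and false2: "\<And>u. u \<in> set_pmf U \<Longrightarrow>
      measure_pmf.prob (random_code_pmf A1 A2 Q1 Q2 C (\<sigma>1 u) (\<sigma>2 u))
       {(F1, F2, y). \<exists>s\<in>A1. \<exists>t\<in>A2. (s, t) \<noteq> (\<sigma>1 u, \<sigma>2 u) \<and> acc2 s t (F1 s) (F2 t) (ob2 u y)} \<le> \<beta>"
    and true1: "measure_pmf.prob (pair_pmf U (in_joint Q1 Q2 C))
       {(u, x1, x2, y). \<not> acc1 (\<sigma>1 u) (\<sigma>2 u) x1 x2 (ob1 u y)} \<le> \<alpha>"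
    and true2: "measure_pmf.prob (pair_pmf U (in_joint Q1 Q2 C))
       {(u, x1, x2, y). \<not> acc2 (\<sigma>1 u) (\<sigma>2 u) x1 x2 (ob2 u y)} \<le> \<alpha>"
  shows "\<exists>F1 F2 g1 g2. (\<forall>s\<in>A1. F1 s \<in> set_pmf Q1) \<and> (\<forall>t\<in>A2. F2 t \<in> set_pmf Q2) \<and>
     measure_pmf.prob (bind_pmf U (\<lambda>u. map_pmf (Pair u) (C (F1 (\<sigma>1 u)) (F2 (\<sigma>2 u)))))
       {(u, y). \<not> (g1 (ob1 u y) = (\<sigma>1 u, \<sigma>2 u) \<and> g2 (ob2 u y) = (\<sigma>1 u, \<sigma>2 u))} \<le> 2 * (\<alpha> + \<beta>)"
proof -
  let ?R = "\<lambda>u. random_code_pmf A1 A2 Q1 Q2 C (\<sigma>1 u) (\<sigma>2 u)"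
  define \<Pi>1 where "\<Pi>1 = Pi_pmf A1 undefined (\<lambda>_. Q1)"
  define \<Pi>2 where "\<Pi>2 = Pi_pmf A2 undefined (\<lambda>_. Q2)"
  define B where "B = bind_pmf U (\<lambda>u. map_pmf (\<lambda>(F1, F2, y). (F1, F2, u, y)) (?R u))"
  define N1 where "N1 = {(F1, F2, u, y). \<not> acc1 (\<sigma>1 u) (\<sigma>2 u) (F1 (\<sigma>1 u)) (F2 (\<sigma>2 u)) (ob1 u y)}"
  define N2 where "N2 = {(F1, F2, u, y). \<not> acc2 (\<sigma>1 u) (\<sigma>2 u) (F1 (\<sigma>1 u)) (F2 (\<sigma>2 u)) (ob2 u y)}"
  define M1 where "M1 = {(F1, F2, u, y). \<exists>s\<in>A1. \<exists>t\<in>A2. (s, t) \<noteq> (\<sigma>1 u, \<sigma>2 u) \<and> acc1 s t (F1 s) (F2 t) (ob1 u y)}"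
  define M2 where "M2 = {(F1, F2, u, y). \<exists>s\<in>A1. \<exists>t\<in>A2. (s, t) \<noteq> (\<sigma>1 u, \<sigma>2 u) \<and> acc2 s t (F1 s) (F2 t) (ob2 u y)}"
  have words: "map_pmf (\<lambda>(F1, F2, u, y). (u, F1 (\<sigma>1 u), F2 (\<sigma>2 u), y)) B = pair_pmf U (in_joint Q1 Q2 C)"
  proof -
    have "map_pmf (\<lambda>(F1, F2, u, y). (u, F1 (\<sigma>1 u), F2 (\<sigma>2 u), y)) B
       = bind_pmf U (\<lambda>u. map_pmf (Pair u) (map_pmf (\<lambda>(F1, F2, y). (F1 (\<sigma>1 u), F2 (\<sigma>2 u), y)) (?R u)))"
      by (simp add: B_def map_bind_pmf map_pmf_comp case_prod_unfold)
    also have "\<dots> = bind_pmf U (\<lambda>u. map_pmf (Pair u) (in_joint Q1 Q2 C))"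
      using fin \<sigma> by (intro bind_pmf_cong refl) (simp add: random_code_true_words)
    finally show ?thesis by (simp add: pair_pmf_def map_pmf_def)
  qed
  have n1: "measure_pmf.prob B N1 \<le> \<alpha>"
    using true1 unfolding words[symmetric] measure_map_pmf
    by (simp add: N1_def case_prod_unfold vimage_def)
  have n2: "measure_pmf.prob B N2 \<le> \<alpha>"
    using true2 unfolding words[symmetric] measure_map_pmf
    by (simp add: N2_def case_prod_unfold vimage_def)
  have m1: "measure_pmf.prob B M1 \<le> \<beta>"
    unfolding B_def using false1
    by (intro prob_bind_le) (simp add: M1_def case_prod_unfold vimage_def)
  have m2: "measure_pmf.prob B M2 \<le> \<beta>"
    unfolding B_def using false2
    by (intro prob_bind_le) (simp add: M2_def case_prod_unfold vimage_def)
  \<comment> \<open>Any accepted pair may be chosen: if the true pair is accepted and no other is,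
    the choice is forced, and otherwise an error is already counted.\<close>
  define g1 where "g1 = (\<lambda>F1 F2 ob. SOME st. st \<in> A1 \<times> A2 \<and> acc1 (fst st) (snd st) (F1 (fst st)) (F2 (snd st)) ob)"
  define g2 where "g2 = (\<lambda>F1 F2 ob. SOME st. st \<in> A1 \<times> A2 \<and> acc2 (fst st) (snd st) (F1 (fst st)) (F2 (snd st)) ob)"
  \<comment> \<open>\<open>\<sigma>1 u\<close> and \<open>\<sigma>2 u\<close> are known to lie in
    the index sets only for \<open>u\<close> in the support of \<open>U\<close>, so the error event
    is cut down to it; under a code this does not change its probability.\<close>
  define E where "E = {(F1, F2, u, y). u \<in> set_pmf U \<and> \<not> (g1 F1 F2 (ob1 u y) = (\<sigma>1 u, \<sigma>2 u) \<and> g2 F1 F2 (ob2 u y) = (\<sigma>1 u, \<sigma>2 u))}"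
  have g1_ok: "g1 F1 F2 (ob1 u y) = (\<sigma>1 u, \<sigma>2 u)"
    if "u \<in> set_pmf U" "(F1, F2, u, y) \<notin> N1" "(F1, F2, u, y) \<notin> M1" for F1 F2 u y
    unfolding g1_def
  proof (rule some_equality)
    show "(\<sigma>1 u, \<sigma>2 u) \<in> A1 \<times> A2 \<and> acc1 (fst (\<sigma>1 u, \<sigma>2 u)) (snd (\<sigma>1 u, \<sigma>2 u))
        (F1 (fst (\<sigma>1 u, \<sigma>2 u))) (F2 (snd (\<sigma>1 u, \<sigma>2 u))) (ob1 u y)"
      using that(2) \<sigma>[OF that(1)] by (simp add: N1_def)
    fix st
    assume "st \<in> A1 \<times> A2 \<and> acc1 (fst st) (snd st) (F1 (fst st)) (F2 (snd st)) (ob1 u y)"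
    then show "st = (\<sigma>1 u, \<sigma>2 u)"
      using that(3) by (cases st) (simp add: M1_def, blast)
  qed
  have g2_ok: "g2 F1 F2 (ob2 u y) = (\<sigma>1 u, \<sigma>2 u)"
    if "u \<in> set_pmf U" "(F1, F2, u, y) \<notin> N2" "(F1, F2, u, y) \<notin> M2" for F1 F2 u y
    unfolding g2_def
  proof (rule some_equality)
    show "(\<sigma>1 u, \<sigma>2 u) \<in> A1 \<times> A2 \<and> acc2 (fst (\<sigma>1 u, \<sigma>2 u)) (snd (\<sigma>1 u, \<sigma>2 u))
        (F1 (fst (\<sigma>1 u, \<sigma>2 u))) (F2 (snd (\<sigma>1 u, \<sigma>2 u))) (ob2 u y)"
      using that(2) \<sigma>[OF that(1)] by (simp add: N2_def)
    fix st
    assume "st \<in> A1 \<times> A2 \<and> acc2 (fst st) (snd st) (F1 (fst st)) (F2 (snd st)) (ob2 u y)"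
    then show "st = (\<sigma>1 u, \<sigma>2 u)"
      using that(3) by (cases st) (simp add: M2_def, blast)
  qed
  have "E \<subseteq> (N1 \<union> M1) \<union> (N2 \<union> M2)"
  proof
    fix z assume "z \<in> E"
    moreover obtain F1 F2 u y where "z = (F1, F2, u, y)" by (metis surj_pair)
    ultimately show "z \<in> (N1 \<union> M1) \<union> (N2 \<union> M2)"
      using g1_ok[of u F1 F2 y] g2_ok[of u F1 F2 y] by (auto simp: E_def)
  qed
  then have "measure_pmf.prob B E \<le> measure_pmf.prob B ((N1 \<union> M1) \<union> (N2 \<union> M2))"
    by (intro measure_pmf.finite_measure_mono) auto
  also have "\<dots> \<le> (measure_pmf.prob B N1 + measure_pmf.prob B M1) + (measure_pmf.prob B N2 + measure_pmf.prob B M2)"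
    by (intro order.trans[OF measure_Un_le] add_mono measure_Un_le) auto
  also have "\<dots> \<le> 2 * (\<alpha> + \<beta>)" using n1 n2 m1 m2 by simp
  finally have BE: "measure_pmf.prob B E \<le> 2 * (\<alpha> + \<beta>)" .
  define code where "code = (\<lambda>F1 F2. bind_pmf U (\<lambda>u. map_pmf (Pair u) (C (F1 (\<sigma>1 u)) (F2 (\<sigma>2 u)))))"
  \<comment> \<open>In \<open>B\<close> the source is drawn first, as the bounds for fixed source
    blocks require. Moving the codebooks to the front exhibits the error as an average over
    \<open>F1\<close> and \<open>F2\<close>, which are then fixed one after the other.\<close>
  have "B = bind_pmf U (\<lambda>u. bind_pmf \<Pi>1 (\<lambda>F1. bind_pmf \<Pi>2 (\<lambda>F2.
      map_pmf (\<lambda>y. (F1, F2, u, y)) (C (F1 (\<sigma>1 u)) (F2 (\<sigma>2 u))))))"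
    by (simp add: B_def random_code_pmf_def map_bind_pmf map_pmf_comp \<Pi>1_def \<Pi>2_def)
  also have "\<dots> = bind_pmf \<Pi>1 (\<lambda>F1. bind_pmf U (\<lambda>u. bind_pmf \<Pi>2 (\<lambda>F2.
      map_pmf (\<lambda>y. (F1, F2, u, y)) (C (F1 (\<sigma>1 u)) (F2 (\<sigma>2 u))))))"
    by (rule bind_commute_pmf)
  also have "\<dots> = bind_pmf \<Pi>1 (\<lambda>F1. bind_pmf \<Pi>2 (\<lambda>F2. bind_pmf U (\<lambda>u.
      map_pmf (\<lambda>y. (F1, F2, u, y)) (C (F1 (\<sigma>1 u)) (F2 (\<sigma>2 u))))))"
    by (intro bind_pmf_cong refl bind_commute_pmf)
  also have "\<dots> = bind_pmf \<Pi>1 (\<lambda>F1. bind_pmf \<Pi>2 (\<lambda>F2. map_pmf (\<lambda>z. (F1, F2, z)) (code F1 F2)))"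
    by (simp add: code_def map_bind_pmf map_pmf_comp)
  finally have B: "B = bind_pmf \<Pi>1 (\<lambda>F1. bind_pmf \<Pi>2 (\<lambda>F2. map_pmf (\<lambda>z. (F1, F2, z)) (code F1 F2)))" .
  have fin\<Pi>: "finite (set_pmf \<Pi>1)" "finite (set_pmf \<Pi>2)"
    using fin by (auto simp: \<Pi>1_def \<Pi>2_def set_Pi_pmf)
  obtain F1 where F1: "F1 \<in> set_pmf \<Pi>1"
    and "measure_pmf.prob (bind_pmf \<Pi>2 (\<lambda>F2. map_pmf (\<lambda>z. (F1, F2, z)) (code F1 F2))) E \<le> 2 * (\<alpha> + \<beta>)"
    using prob_bind_exists[OF fin\<Pi>(1) BE[unfolded B]] by auto
  then obtain F2 where F2: "F2 \<in> set_pmf \<Pi>2"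
    and err: "measure_pmf.prob (map_pmf (\<lambda>z. (F1, F2, z)) (code F1 F2)) E \<le> 2 * (\<alpha> + \<beta>)"
    using prob_bind_exists[OF fin\<Pi>(2)] by blast
  have "measure_pmf.prob (code F1 F2)
       {(u, y). \<not> (g1 F1 F2 (ob1 u y) = (\<sigma>1 u, \<sigma>2 u) \<and> g2 F1 F2 (ob2 u y) = (\<sigma>1 u, \<sigma>2 u))}
     \<le> measure_pmf.prob (map_pmf (\<lambda>z. (F1, F2, z)) (code F1 F2)) E"
    unfolding measure_map_pmf
    by (intro measure_pmf.finite_measure_mono_AE)
       (auto simp: AE_measure_pmf_iff E_def code_def)
  also note err
  finally have "measure_pmf.prob (code F1 F2)
       {(u, y). \<not> (g1 F1 F2 (ob1 u y) = (\<sigma>1 u, \<sigma>2 u) \<and> g2 F1 F2 (ob2 u y) = (\<sigma>1 u, \<sigma>2 u))} \<le> 2 * (\<alpha> + \<beta>)" .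
  moreover have "\<forall>s\<in>A1. F1 s \<in> set_pmf Q1" "\<forall>t\<in>A2. F2 t \<in> set_pmf Q2"
    using F1 F2 fin by (auto simp: \<Pi>1_def \<Pi>2_def set_Pi_pmf PiE_dflt_def)
  ultimately show ?thesis unfolding code_def by blast
qed

section \<open>Threshold decoding\<close>

definition cond_ratio :: "('s \<times> 't) pmf \<Rightarrow> 's \<times> 't \<Rightarrow> real" where
  "cond_ratio q st = pmf q st / pmf (map_pmf snd q) (snd st)"

text \<open>Outputs of probability 0 give \<open>x / 0 = 0\<close>, so the mean over an independent input is only
  at most 1.\<close>

definition chan_ratio :: "'x pmf \<Rightarrow> ('x \<Rightarrow> 'y pmf) \<Rightarrow> 'x \<times> 'y \<Rightarrow> real" where
  "chan_ratio Q a xy = pmf (a (fst xy)) (snd xy) / pmf (bind_pmf Q a) (snd xy)"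

lemma cond_ratio_nonneg [simp]: "cond_ratio q st \<ge> 0"
  by (simp add: cond_ratio_def)

lemma chan_ratio_nonneg [simp]: "chan_ratio Q a xy \<ge> 0"
  by (simp add: chan_ratio_def)

lemma cond_ratio_pos: "st \<in> set_pmf q \<Longrightarrow> cond_ratio q st > 0"
  unfolding cond_ratio_def by (intro divide_pos_pos pmf_positive) auto

lemma chan_ratio_pos: "xy \<in> set_pmf (chan_joint Q a) \<Longrightarrow> chan_ratio Q a xy > 0"
  unfolding chan_ratio_def by (intro divide_pos_pos pmf_positive) auto

lemma pmf_map_snd_UNIV:
  fixes q :: "('s::finite \<times> 't) pmf"
  shows "pmf (map_pmf snd q) t = (\<Sum>s\<in>UNIV. pmf q (s, t))"
proof -
  have "snd -` {t} = (\<lambda>s::'s. (s, t)) ` UNIV" by auto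
  then have "pmf (map_pmf snd q) t = (\<Sum>z\<in>(\<lambda>s::'s. (s, t)) ` UNIV. pmf q z)"
    by (simp add: pmf_map measure_measure_pmf_finite)
  then show ?thesis by (simp add: sum.reindex inj_on_def)
qed

text \<open>Equality holds unless \<open>t\<close> has probability 0, where division by 0 makes
  every term 0; the union bound asks for no more.\<close>

lemma sum_cond_ratio_le_1:
  fixes q :: "('s::finite \<times> 't) pmf"
  shows "(\<Sum>s\<in>UNIV. cond_ratio q (s, t)) \<le> 1"
  by (simp add: cond_ratio_def pmf_map_snd_UNIV flip: sum_divide_distrib)

lemma expct_chan_ratio_le_1:
  fixes Q :: "'x::finite pmf"
  shows "expct Q (\<lambda>x. chan_ratio Q a (x, y)) \<le> 1"
  by (simp add: chan_ratio_def expct_UNIV pmf_bind_UNIV flip: sum_divide_distrib)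

lemma expct_log_cond_ratio: "expct q (\<lambda>st. log 2 (cond_ratio q st)) = - cond_ent q"
  by (simp add: cond_ent_expct cond_ratio_def)

lemma expct_log_chan_ratio:
  fixes Q :: "'x::finite pmf" and a :: "'x \<Rightarrow> 'y::finite pmf"
  shows "expct (chan_joint Q a) (\<lambda>xy. log 2 (chan_ratio Q a xy)) = mut_inf (chan_joint Q a)"
  by (simp add: mut_inf_chan_joint expct_bind chan_ratio_def)

abbreviation src1 :: "('s1 \<times> 's2 \<times> 'w) pmf \<Rightarrow> ('s1 \<times> 's2 \<times> 'w) pmf" where
  "src1 p \<equiv> map_pmf (\<lambda>(s1, s2, w). (s1, (s2, w))) p"

abbreviation src2 :: "('s1 \<times> 's2 \<times> 'w) pmf \<Rightarrow> ('s2 \<times> 's1 \<times> 'w) pmf" where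
  "src2 p \<equiv> map_pmf (\<lambda>(s1, s2, w). (s2, (s1, w))) p"

abbreviation src12 :: "('s1 \<times> 's2 \<times> 'w) pmf \<Rightarrow> (('s1 \<times> 's2) \<times> 'w) pmf" where
  "src12 p \<equiv> map_pmf (\<lambda>(s1, s2, w). ((s1, s2), w)) p"

text \<open>Each test contains the channel ratios of exactly those components that are wrong in its
  error case, and the probability of the wrong blocks given the correct ones and the side
  information.\<close>

definition accepts ::
  "real \<Rightarrow> nat \<Rightarrow> nat \<Rightarrow> ('s1 \<times> 's2 \<times> 'w) pmf \<Rightarrow> ('x1 \<Rightarrow> 'y1 pmf) \<Rightarrow> ('x2 \<Rightarrow> 'y2 pmf) \<Rightarrow> 'x1 pmf \<Rightarrow> 'x2 pmf \<Rightarrow>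
   's1 list \<Rightarrow> 's2 list \<Rightarrow> 'x1 list \<Rightarrow> 'x2 list \<Rightarrow> ('y1 \<times> 'y2) list \<times> 'w list \<Rightarrow> bool" where
  "accepts \<gamma> m n p a c P1 P2 s t x1 x2 = (\<lambda>(y, w).
     (\<Prod>i<m. cond_ratio (src1 p) (s ! i, (t ! i, w ! i))) * (\<Prod>j<n. chan_ratio P1 a (x1 ! j, fst (y ! j))) > \<gamma> \<and>
     (\<Prod>i<m. cond_ratio (src2 p) (t ! i, (s ! i, w ! i))) * (\<Prod>j<n. chan_ratio P2 c (x2 ! j, snd (y ! j))) > \<gamma> \<and>
     (\<Prod>i<m. cond_ratio (src12 p) ((s ! i, t ! i), w ! i)) *
       ((\<Prod>j<n. chan_ratio P1 a (x1 ! j, fst (y ! j))) * (\<Prod>j<n. chan_ratio P2 c (x2 ! j, snd (y ! j)))) > \<gamma>)"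

text \<open>The bound is uniform in the side information and the outputs: conditional source ratios
  sum to at most 1 for every value conditioned on, channel ratios have mean at most 1 for every
  output letter, and both facts pass to blocks by factorization over positions.\<close>

lemma false_accepts:
  fixes p :: "('s1::finite \<times> 's2::finite \<times> 'w) pmf"
    and P1 :: "'x1::finite pmf" and P2 :: "'x2::finite pmf"
  assumes "\<gamma> > 0" "length s = m" "length t = m"
  shows "measure_pmf.prob (random_code_pmf {s. length s = m} {t. length t = m}
        (replicate_pmf n P1) (replicate_pmf n P2) C s t)
    {(F1, F2, y). \<exists>s'\<in>{s. length s = m}. \<exists>t'\<in>{t. length t = m}. (s', t') \<noteq> (s, t) \<and>
        accepts \<gamma> m n p a c P1 P2 s' t' (F1 s') (F2 t') (yo y, w)} \<le> 3 / \<gamma>"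
proof -
  have ex: "expct (replicate_pmf n Q) (\<lambda>x. \<Prod>j<n. chan_ratio Q b (x ! j, h j)) \<le> 1"
    for Q :: "'z::finite pmf" and b :: "'z \<Rightarrow> 'v pmf" and h
  proof -
    have "expct (replicate_pmf n Q) (\<lambda>x. \<Prod>j<n. chan_ratio Q b (x ! j, h j))
        = (\<Prod>j<n. expct Q (\<lambda>x. chan_ratio Q b (x, h j)))"
      unfolding replicate_pmf_eq_seq_pmf
      by (subst expct_prod_seq_pmf[where h="\<lambda>j x. chan_ratio Q b (x, h j)"]) auto
    also have "\<dots> \<le> 1"
      by (intro prod_le_1) (auto simp: expct_chan_ratio_le_1 intro: integral_nonneg_AE)
    finally show ?thesis .
  qed
  have s1: "(\<Sum>s\<in>{s. length s = m}. \<Prod>i<m. cond_ratio q (s ! i, h i)) \<le> 1"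
    for q :: "('k::finite \<times> 'l) pmf" and h
    by (subst sum_lists_prod[where h="\<lambda>i s. cond_ratio q (s, h i)"])
       (intro prod_le_1 conjI sum_nonneg sum_cond_ratio_le_1; simp)
  have s12: "(\<Sum>s\<in>{s. length s = m}. \<Sum>t\<in>{t. length t = m}.
      \<Prod>i<m. cond_ratio (src12 p) ((s ! i, t ! i), w ! i)) \<le> 1"
  proof -
    have "(\<Sum>s\<in>{s. length s = m}. \<Sum>t\<in>{t. length t = m}.
        \<Prod>i<m. cond_ratio (src12 p) ((s ! i, t ! i), w ! i))
      = (\<Prod>i<m. \<Sum>s\<in>UNIV. \<Sum>t\<in>UNIV. cond_ratio (src12 p) ((s, t), w ! i))"
      by (subst sum_lists_prod[symmetric])
         (intro sum.cong refl sum_lists_prod[where h="\<lambda>i t. cond_ratio (src12 p) ((s ! i, t), w ! i)" for s])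
    also have "\<dots> = (\<Prod>i<m. \<Sum>z\<in>UNIV. cond_ratio (src12 p) (z, w ! i))"
      by (simp add: sum.cartesian_product)
    also have "\<dots> \<le> 1"
      by (intro prod_le_1 conjI sum_nonneg sum_cond_ratio_le_1; simp)
    finally show ?thesis .
  qed
  show ?thesis
    using assms
    by (intro false_acceptance[where
          ?d1.0="\<lambda>x y. \<Prod>j<n. chan_ratio P1 a (x ! j, fst (yo y ! j))"
          and ?d2.0="\<lambda>x y. \<Prod>j<n. chan_ratio P2 c (x ! j, snd (yo y ! j))"
          and ?v1.0="\<lambda>s'. \<Prod>i<m. cond_ratio (src1 p) (s' ! i, (t ! i, w ! i))"
          and ?v2.0="\<lambda>t'. \<Prod>i<m. cond_ratio (src2 p) (t' ! i, (s ! i, w ! i))"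
          and ?v3.0="\<lambda>s' t'. \<Prod>i<m. cond_ratio (src12 p) ((s' ! i, t' ! i), w ! i)"
          and acc="\<lambda>s' t' x1 x2 y. accepts \<gamma> m n p a c P1 P2 s' t' x1 x2 (yo y, w)"]
        ex s1 s12 prod_nonneg finite_length_eq)
       (auto simp: accepts_def)
qed

section \<open>Acceptance of the true pair\<close>

text \<open>Commuting the current output with the later inputs shows that the input-output pairs are
  independent, which puts the channel ratios within reach of the weak law.\<close>

lemma zip_channel_iid:
  "bind_pmf (replicate_pmf n Q) (\<lambda>x. map_pmf (zip x) (seq_pmf (map a x)))
     = replicate_pmf n (chan_joint Q a)"
proof (induction n)
  case (Suc n)
  have "bind_pmf (replicate_pmf (Suc n) Q) (\<lambda>x. map_pmf (zip x) (seq_pmf (map a x)))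
      = bind_pmf Q (\<lambda>x. bind_pmf (replicate_pmf n Q) (\<lambda>xs. bind_pmf (a x) (\<lambda>y.
          map_pmf (\<lambda>ys. (x, y) # zip xs ys) (seq_pmf (map a xs)))))"
    by (simp add: bind_assoc_pmf bind_return_pmf map_bind_pmf map_pmf_comp)
  also have "\<dots> = bind_pmf Q (\<lambda>x. bind_pmf (a x) (\<lambda>y. bind_pmf (replicate_pmf n Q) (\<lambda>xs.
          map_pmf (\<lambda>ys. (x, y) # zip xs ys) (seq_pmf (map a xs)))))"
    by (intro bind_pmf_cong refl bind_commute_pmf)
  also have "\<dots> = bind_pmf Q (\<lambda>x. bind_pmf (a x) (\<lambda>y.
          map_pmf ((#) (x, y)) (bind_pmf (replicate_pmf n Q) (\<lambda>xs. map_pmf (zip xs) (seq_pmf (map a xs))))))"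
    by (simp add: map_bind_pmf map_pmf_comp)
  also have "\<dots> = replicate_pmf (Suc n) (chan_joint Q a)"
    unfolding Suc.IH by (simp add: bind_assoc_pmf bind_map_pmf map_pmf_def bind_return_pmf)
  finally show ?case .
qed (simp add: bind_return_pmf)

lemma in_joint_zip_left:
  fixes a :: "'x1 \<Rightarrow> 'y1 pmf" and c :: "'x2 \<Rightarrow> 'y2 pmf"
  assumes \<pi>: "\<And>x1 x2. map_pmf \<pi> (W x1 x2) = pair_pmf (a x1) (c x2)"
  shows "map_pmf (\<lambda>(x1, x2, y). zip x1 (map fst (map \<pi> y)))
      (in_joint (replicate_pmf n P1) (replicate_pmf n P2) (\<lambda>x1 x2. seq_pmf (map2 W x1 x2)))
    = replicate_pmf n (chan_joint P1 a)"
proof -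
  have "map_pmf (\<lambda>y. zip x1 (map fst (map \<pi> y))) (seq_pmf (map2 W x1 x2)) = map_pmf (zip x1) (seq_pmf (map a x1))"
    if "length x1 = n" "length x2 = n" for x1 x2
  proof -
    have "map_pmf (\<lambda>y. zip x1 (map fst (map \<pi> y))) (seq_pmf (map2 W x1 x2))
        = map_pmf (\<lambda>z. zip x1 (fst z)) (map_pmf (\<lambda>y. unzip (map \<pi> y)) (seq_pmf (map2 W x1 x2)))"
      by (simp add: map_pmf_comp unzip_def)
    also have "\<dots> = map_pmf (zip x1) (map_pmf fst (pair_pmf (seq_pmf (map a x1)) (seq_pmf (map c x2))))"
      using that by (subst receiver_channel_block[where \<pi>=\<pi> and W=W, OF \<pi>]) (simp_all add: map_pmf_comp)
    finally show ?thesis by (simp add: map_fst_pair_pmf)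
  qed
  then have "map_pmf (\<lambda>(x1, x2, y). zip x1 (map fst (map \<pi> y)))
      (in_joint (replicate_pmf n P1) (replicate_pmf n P2) (\<lambda>x1 x2. seq_pmf (map2 W x1 x2)))
    = bind_pmf (replicate_pmf n P1) (\<lambda>x1. bind_pmf (replicate_pmf n P2) (\<lambda>x2. map_pmf (zip x1) (seq_pmf (map a x1))))"
    unfolding in_joint_def map_bind_pmf map_pmf_comp case_prod_conv
    by (intro bind_pmf_cong refl) (simp add: length_replicate_pmf)
  then show ?thesis by (simp add: zip_channel_iid)
qed

lemma in_joint_zip_right:
  fixes a :: "'x1 \<Rightarrow> 'y1 pmf" and c :: "'x2 \<Rightarrow> 'y2 pmf"
  assumes \<pi>: "\<And>x1 x2. map_pmf \<pi> (W x1 x2) = pair_pmf (a x1) (c x2)"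
  shows "map_pmf (\<lambda>(x1, x2, y). zip x2 (map snd (map \<pi> y)))
      (in_joint (replicate_pmf n P1) (replicate_pmf n P2) (\<lambda>x1 x2. seq_pmf (map2 W x1 x2)))
    = replicate_pmf n (chan_joint P2 c)"
proof -
  have "map_pmf (\<lambda>y. zip x2 (map snd (map \<pi> y))) (seq_pmf (map2 W x1 x2)) = map_pmf (zip x2) (seq_pmf (map c x2))"
    if "length x1 = n" "length x2 = n" for x1 x2
  proof -
    have "map_pmf (\<lambda>y. zip x2 (map snd (map \<pi> y))) (seq_pmf (map2 W x1 x2))
        = map_pmf (\<lambda>z. zip x2 (snd z)) (map_pmf (\<lambda>y. unzip (map \<pi> y)) (seq_pmf (map2 W x1 x2)))"
      by (simp add: map_pmf_comp unzip_def)
    also have "\<dots> = map_pmf (zip x2) (map_pmf snd (pair_pmf (seq_pmf (map a x1)) (seq_pmf (map c x2))))"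
      using that by (subst receiver_channel_block[where \<pi>=\<pi> and W=W, OF \<pi>]) (simp_all add: map_pmf_comp)
    finally show ?thesis by (simp add: map_snd_pair_pmf)
  qed
  then have "map_pmf (\<lambda>(x1, x2, y). zip x2 (map snd (map \<pi> y)))
      (in_joint (replicate_pmf n P1) (replicate_pmf n P2) (\<lambda>x1 x2. seq_pmf (map2 W x1 x2)))
    = bind_pmf (replicate_pmf n P1) (\<lambda>x1. bind_pmf (replicate_pmf n P2) (\<lambda>x2. map_pmf (zip x2) (seq_pmf (map c x2))))"
    unfolding in_joint_def map_bind_pmf map_pmf_comp case_prod_conv
    by (intro bind_pmf_cong refl) (simp add: length_replicate_pmf)
  then show ?thesis by (simp add: zip_channel_iid)
qed

lemma prod_gt_powr_if_log_sum:
  fixes f g :: "nat \<Rightarrow> real"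
  assumes "\<And>i. i < m \<Longrightarrow> f i > 0" "\<And>j. j < n \<Longrightarrow> g j > 0"
    and "r < (\<Sum>i<m. log 2 (f i)) + (\<Sum>j<n. log 2 (g j))"
  shows "2 powr r < (\<Prod>i<m. f i) * (\<Prod>j<n. g j)"
proof -
  have pos: "(\<Prod>i<m. f i) > 0" "(\<Prod>j<n. g j) > 0" using assms by (auto intro!: prod_pos)
  have "log 2 ((\<Prod>i<m. f i) * (\<Prod>j<n. g j)) = (\<Sum>i<m. log 2 (f i)) + (\<Sum>j<n. log 2 (g j))"
    unfolding log_mult_pos[OF pos]
    using assms(1,2) by (intro arg_cong2[where f="(+)"] log_prod_sum) auto
  then show ?thesis using assms(3) pos by (simp add: less_log_iff[symmetric])
qed

lemma true_accepts:
  fixes P :: "('s1::finite \<times> 's2::finite \<times> 'w1::finite \<times> 'w2::finite) pmf"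
    and W :: "'x1::finite \<Rightarrow> 'x2::finite \<Rightarrow> ('y::finite \<times> 'y'::finite) pmf"
    and wk :: "'s1 \<times> 's2 \<times> 'w1 \<times> 'w2 \<Rightarrow> 'w::finite"
    and a :: "'x1 \<Rightarrow> 'z1::finite pmf" and c :: "'x2 \<Rightarrow> 'z2::finite pmf"
  assumes \<pi>: "\<And>x1 x2. map_pmf \<pi> (W x1 x2) = pair_pmf (a x1) (c x2)"
    and mn0: "m0 > 0" "n0 > 0" and b: "b = real n0 / real m0"
  defines "p \<equiv> map_pmf (\<lambda>u. (s1_of u, s2_of u, wk u)) P"
  assumes conds: "recv_conds (<) b p a c P1 P2"
  shows "\<exists>\<tau>>0. \<forall>\<eta>>0. \<forall>\<^sub>F L in sequentially.
    measure_pmf.prob (pair_pmf (replicate_pmf (m0 * L) P)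
        (in_joint (replicate_pmf (n0 * L) P1) (replicate_pmf (n0 * L) P2) (\<lambda>x1 x2. seq_pmf (map2 W x1 x2))))
     {(u, x1, x2, y). \<not> accepts (2 powr (real (m0 * L) * \<tau>)) (m0 * L) (n0 * L) p a c P1 P2
        (map s1_of u) (map s2_of u) x1 x2 (map \<pi> y, map wk u)} \<le> \<eta>"
proof -
  define \<phi> where "\<phi> = (\<lambda>u. (s1_of u, s2_of u, wk u))"
  define H1 where "H1 = cond_ent (src1 p)"
  define H2 where "H2 = cond_ent (src2 p)"
  define H12 where "H12 = cond_ent (src12 p)"
  define I1 where "I1 = mut_inf (chan_joint P1 a)"
  define I2 where "I2 = mut_inf (chan_joint P2 c)"
  have lt: "H1 < b * I1" "H2 < b * I2" "H12 < b * (I1 + I2)"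
    using conds unfolding recv_conds_def H1_def H2_def H12_def I1_def I2_def by auto
  have b0: "b > 0" using mn0 b by simp
  \<comment> \<open>\<open>g\<close> is the smallest slack per source letter. A test sums one source
    average and at most two channel averages, each allowed to fall short by \<open>\<delta>\<close>,
    at a cost of at most \<open>\<delta> * (1 + 2 * b)\<close>; this is set to half of
    \<open>g\<close>, and the other half is the exponent \<open>\<tau>\<close>.\<close>
  define g where "g = min (b * I1 - H1) (min (b * I2 - H2) (b * (I1 + I2) - H12))"
  define \<delta> where "\<delta> = g / (2 * (1 + 2 * b))"
  define \<tau> where "\<tau> = g / 2"
  have g: "g > 0" "g \<le> b * I1 - H1" "g \<le> b * I2 - H2" "g \<le> b * (I1 + I2) - H12"
    using lt by (auto simp: g_def)
  have \<delta>0: "\<delta> > 0" using g b0 by (simp add: \<delta>_def)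
  have \<tau>0: "\<tau> > 0" using g by (simp add: \<tau>_def)
  have \<delta>g: "\<delta> * (1 + 2 * b) = g / 2"
    using b0 unfolding \<delta>_def by (simp add: field_simps add_pos_pos)
  have b\<delta>: "b * \<delta> > 0" using b0 \<delta>0 by simp
  have gaps: "\<tau> \<le> (- H1 - \<delta>) + b * (I1 - \<delta>)" "\<tau> \<le> (- H2 - \<delta>) + b * (I2 - \<delta>)"
    "\<tau> \<le> (- H12 - \<delta>) + (b * (I1 - \<delta>) + b * (I2 - \<delta>))"
    using g \<delta>g b\<delta> unfolding \<tau>_def by (auto simp: algebra_simps)
  define l1 where "l1 = (\<lambda>u. log 2 (cond_ratio (src1 p) (s1_of u, (s2_of u, wk u))))"
  define l2 where "l2 = (\<lambda>u. log 2 (cond_ratio (src2 p) (s2_of u, (s1_of u, wk u))))"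
  define l12 where "l12 = (\<lambda>u. log 2 (cond_ratio (src12 p) ((s1_of u, s2_of u), wk u)))"
  define d1 where "d1 = (\<lambda>z. log 2 (chan_ratio P1 a z))"
  define d2 where "d2 = (\<lambda>z. log 2 (chan_ratio P2 c z))"
  have src: "src1 p = map_pmf (\<lambda>u. (s1_of u, (s2_of u, wk u))) P"
    "src2 p = map_pmf (\<lambda>u. (s2_of u, (s1_of u, wk u))) P"
    "src12 p = map_pmf (\<lambda>u. ((s1_of u, s2_of u), wk u)) P"
    by (simp_all add: p_def map_pmf_comp)
  have el: "expct P l1 = - H1" "expct P l2 = - H2" "expct P l12 = - H12"
    using expct_log_cond_ratio[of "src1 p"] expct_log_cond_ratio[of "src2 p"] expct_log_cond_ratio[of "src12 p"]
    unfolding H1_def H2_def H12_def l1_def l2_def l12_def src by simp_all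
  have ed: "expct (chan_joint P1 a) d1 = I1" "expct (chan_joint P2 c) d2 = I2"
    unfolding d1_def d2_def I1_def I2_def by (rule expct_log_chan_ratio)+
  show ?thesis
  proof (intro exI[of _ \<tau>] conjI \<tau>0 allI impI)
    fix \<eta> :: real assume "\<eta> > 0"
    \<comment> \<open>Three source averages and two channel averages may deviate.\<close>
    then have \<eta>: "\<eta> / 5 > 0" by simp
    show "\<forall>\<^sub>F L in sequentially.
    measure_pmf.prob (pair_pmf (replicate_pmf (m0 * L) P)
        (in_joint (replicate_pmf (n0 * L) P1) (replicate_pmf (n0 * L) P2) (\<lambda>x1 x2. seq_pmf (map2 W x1 x2))))
     {(u, x1, x2, y). \<not> accepts (2 powr (real (m0 * L) * \<tau>)) (m0 * L) (n0 * L) p a c P1 P2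
        (map s1_of u) (map s2_of u) x1 x2 (map \<pi> y, map wk u)} \<le> \<eta>"
      using weak_law[OF \<delta>0 mn0(1) \<eta>, of P l1] weak_law[OF \<delta>0 mn0(1) \<eta>, of P l2]
        weak_law[OF \<delta>0 mn0(1) \<eta>, of P l12] weak_law[OF \<delta>0 mn0(2) \<eta>, of "chan_joint P1 a" d1]
        weak_law[OF \<delta>0 mn0(2) \<eta>, of "chan_joint P2 c" d2]
      unfolding el ed
    proof eventually_elim
      case (elim L)
      define m where "m = m0 * L"
      define n where "n = n0 * L"
      have nm: "real n = real m * b" using mn0 by (simp add: m_def n_def b)
      define V where "V = in_joint (replicate_pmf n P1) (replicate_pmf n P2) (\<lambda>x1 x2. seq_pmf (map2 W x1 x2))"
      define T where "T = pair_pmf (replicate_pmf m P) V"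
      define z1 where "z1 = (\<lambda>(u::('s1 \<times> 's2 \<times> 'w1 \<times> 'w2) list, x1::'x1 list, x2::'x2 list, y). zip x1 (map fst (map \<pi> y)))"
      define z2 where "z2 = (\<lambda>(u::('s1 \<times> 's2 \<times> 'w1 \<times> 'w2) list, x1::'x1 list, x2::'x2 list, y). zip x2 (map snd (map \<pi> y)))"
      have mu: "map_pmf fst T = replicate_pmf m P" by (simp add: T_def map_fst_pair_pmf)
      have mV: "map_pmf snd T = V" by (simp add: T_def map_snd_pair_pmf)
      have mz1: "map_pmf z1 T = replicate_pmf n (chan_joint P1 a)"
      proof -
        have "map_pmf z1 T = map_pmf (\<lambda>(x1, x2, y). zip x1 (map fst (map \<pi> y))) (map_pmf snd T)"
          by (simp add: map_pmf_comp z1_def case_prod_unfold)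
        also have "\<dots> = replicate_pmf n (chan_joint P1 a)"
          unfolding mV V_def using \<pi> by (rule in_joint_zip_left)
        finally show ?thesis .
      qed
      have mz2: "map_pmf z2 T = replicate_pmf n (chan_joint P2 c)"
      proof -
        have "map_pmf z2 T = map_pmf (\<lambda>(x1, x2, y). zip x2 (map snd (map \<pi> y))) (map_pmf snd T)"
          by (simp add: map_pmf_comp z2_def case_prod_unfold)
        also have "\<dots> = replicate_pmf n (chan_joint P2 c)"
          unfolding mV V_def using \<pi> by (rule in_joint_zip_right)
        finally show ?thesis .
      qed
      define B1 where "B1 = {z::('s1 \<times> 's2 \<times> 'w1 \<times> 'w2) list \<times> 'x1 list \<times> 'x2 list \<times> ('y \<times> 'y') list. (\<Sum>i<m. l1 (fst z ! i)) \<le> real m * (- H1 - \<delta>)}"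
      define B2 where "B2 = {z::('s1 \<times> 's2 \<times> 'w1 \<times> 'w2) list \<times> 'x1 list \<times> 'x2 list \<times> ('y \<times> 'y') list. (\<Sum>i<m. l2 (fst z ! i)) \<le> real m * (- H2 - \<delta>)}"
      define B3 where "B3 = {z::('s1 \<times> 's2 \<times> 'w1 \<times> 'w2) list \<times> 'x1 list \<times> 'x2 list \<times> ('y \<times> 'y') list. (\<Sum>i<m. l12 (fst z ! i)) \<le> real m * (- H12 - \<delta>)}"
      define B4 where "B4 = {z. (\<Sum>j<n. d1 (z1 z ! j)) \<le> real n * (I1 - \<delta>)}"
      define B5 where "B5 = {z. (\<Sum>j<n. d2 (z2 z ! j)) \<le> real n * (I2 - \<delta>)}"
      have bad: "measure_pmf.prob T B1 \<le> \<eta> / 5" "measure_pmf.prob T B2 \<le> \<eta> / 5" "measure_pmf.prob T B3 \<le> \<eta> / 5"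
        "measure_pmf.prob T B4 \<le> \<eta> / 5" "measure_pmf.prob T B5 \<le> \<eta> / 5"
        using elim unfolding m_def[symmetric] n_def[symmetric] mu[symmetric] mz1[symmetric] mz2[symmetric]
          measure_map_pmf vimage_def B1_def B2_def B3_def B4_def B5_def by simp_all
      have good: "accepts (2 powr (real m * \<tau>)) m n p a c P1 P2 (map s1_of u) (map s2_of u) x1 x2 (map \<pi> y, map wk u)"
        if z: "(u, x1, x2, y) \<in> set_pmf T" and notbad: "(u, x1, x2, y) \<notin> B1 \<union> B2 \<union> B3 \<union> B4 \<union> B5" for u x1 x2 y
      proof -
        have u: "u \<in> set_pmf (replicate_pmf m P)" using z by (auto simp: T_def)
        have len: "length u = m" using u by (rule length_replicate_pmf)
        have V: "(x1, x2, y) \<in> set_pmf V" using z by (auto simp: T_def)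
        have lens: "length x1 = n" "length x2 = n" "length y = n"
          using V by (auto simp: V_def in_joint_def dest!: length_replicate_pmf length_seq_pmf)
        have ui: "u ! i \<in> set_pmf P" if "i < m" for i
          using u that len by (auto simp: set_replicate_pmf)
        \<comment> \<open>Positivity of the ratios on the support of \<open>T\<close> is what
          permits passing from sums of logarithms back to products.\<close>
        have c1: "cond_ratio (src1 p) (s1_of (u ! i), s2_of (u ! i), wk (u ! i)) > 0"
          "cond_ratio (src2 p) (s2_of (u ! i), s1_of (u ! i), wk (u ! i)) > 0"
          "cond_ratio (src12 p) ((s1_of (u ! i), s2_of (u ! i)), wk (u ! i)) > 0" if "i < m" for i
          using ui[OF that] unfolding src by (auto intro!: cond_ratio_pos)
        have nth1: "z1 (u, x1, x2, y) ! j = (x1 ! j, fst (map \<pi> y ! j))" if "j < n" for j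
          using that lens by (simp add: z1_def)
        have nth2: "z2 (u, x1, x2, y) ! j = (x2 ! j, snd (map \<pi> y ! j))" if "j < n" for j
          using that lens by (simp add: z2_def)
        have "z1 (u, x1, x2, y) \<in> set_pmf (map_pmf z1 T)" "z2 (u, x1, x2, y) \<in> set_pmf (map_pmf z2 T)"
          using z by auto
        then have zs: "z1 (u, x1, x2, y) \<in> set_pmf (replicate_pmf n (chan_joint P1 a))"
            "z2 (u, x1, x2, y) \<in> set_pmf (replicate_pmf n (chan_joint P2 c))"
          unfolding mz1 mz2 .
        have ch1: "chan_ratio P1 a (x1 ! j, fst (map \<pi> y ! j)) > 0" if "j < n" for j
          using nth_seq_pmf[OF zs(1)[unfolded replicate_pmf_eq_seq_pmf], of j] that
          unfolding nth1[OF that] by (intro chan_ratio_pos) simp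
        have ch2: "chan_ratio P2 c (x2 ! j, snd (map \<pi> y ! j)) > 0" if "j < n" for j
          using nth_seq_pmf[OF zs(2)[unfolded replicate_pmf_eq_seq_pmf], of j] that
          unfolding nth2[OF that] by (intro chan_ratio_pos) simp
        have s4: "real n * (I1 - \<delta>) < (\<Sum>j<n. log 2 (chan_ratio P1 a (x1 ! j, fst (map \<pi> y ! j))))"
        proof -
          have "(\<Sum>j<n. d1 (z1 (u, x1, x2, y) ! j)) = (\<Sum>j<n. log 2 (chan_ratio P1 a (x1 ! j, fst (map \<pi> y ! j))))"
            by (intro sum.cong refl) (simp only: nth1 d1_def lessThan_iff)
          then show ?thesis using notbad by (simp add: B4_def)
        qed
        have s5: "real n * (I2 - \<delta>) < (\<Sum>j<n. log 2 (chan_ratio P2 c (x2 ! j, snd (map \<pi> y ! j))))"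
        proof -
          have "(\<Sum>j<n. d2 (z2 (u, x1, x2, y) ! j)) = (\<Sum>j<n. log 2 (chan_ratio P2 c (x2 ! j, snd (map \<pi> y ! j))))"
            by (intro sum.cong refl) (simp only: nth2 d2_def lessThan_iff)
          then show ?thesis using notbad by (simp add: B5_def)
        qed
        have s: "real m * (- H1 - \<delta>) < (\<Sum>i<m. l1 (u ! i))" "real m * (- H2 - \<delta>) < (\<Sum>i<m. l2 (u ! i))"
          "real m * (- H12 - \<delta>) < (\<Sum>i<m. l12 (u ! i))"
          using notbad by (auto simp: B1_def B2_def B3_def)
        have scaled: "real m * \<tau> \<le> real m * (- H1 - \<delta>) + real n * (I1 - \<delta>)"
          "real m * \<tau> \<le> real m * (- H2 - \<delta>) + real n * (I2 - \<delta>)"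
          "real m * \<tau> \<le> real m * (- H12 - \<delta>) + (real n * (I1 - \<delta>) + real n * (I2 - \<delta>))"
          using gaps[THEN mult_left_mono, of "real m"] unfolding nm by (simp_all add: algebra_simps)
        have "2 powr (real m * \<tau>) < (\<Prod>i<m. cond_ratio (src1 p) (s1_of (u ! i), s2_of (u ! i), wk (u ! i)))
            * (\<Prod>j<n. chan_ratio P1 a (x1 ! j, fst (map \<pi> y ! j)))"
          using s(1) s4 scaled(1) unfolding l1_def
          by (intro prod_gt_powr_if_log_sum c1 ch1) auto
        moreover have "2 powr (real m * \<tau>) < (\<Prod>i<m. cond_ratio (src2 p) (s2_of (u ! i), s1_of (u ! i), wk (u ! i)))
            * (\<Prod>j<n. chan_ratio P2 c (x2 ! j, snd (map \<pi> y ! j)))"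
          using s(2) s5 scaled(2) unfolding l2_def
          by (intro prod_gt_powr_if_log_sum c1 ch2) auto
        \<comment> \<open>The two channel ratios are merged letter by letter, so that the joint test
          also has one source product and one channel product.\<close>
        moreover have "2 powr (real m * \<tau>) < (\<Prod>i<m. cond_ratio (src12 p) ((s1_of (u ! i), s2_of (u ! i)), wk (u ! i)))
            * (\<Prod>j<n. chan_ratio P1 a (x1 ! j, fst (map \<pi> y ! j)) * chan_ratio P2 c (x2 ! j, snd (map \<pi> y ! j)))"
        proof (intro prod_gt_powr_if_log_sum c1 mult_pos_pos ch1 ch2)
          have "(\<Sum>j<n. log 2 (chan_ratio P1 a (x1 ! j, fst (map \<pi> y ! j)) * chan_ratio P2 c (x2 ! j, snd (map \<pi> y ! j))))
              = (\<Sum>j<n. log 2 (chan_ratio P1 a (x1 ! j, fst (map \<pi> y ! j)))) + (\<Sum>j<n. log 2 (chan_ratio P2 c (x2 ! j, snd (map \<pi> y ! j))))"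
            unfolding sum.distrib[symmetric] by (intro sum.cong refl log_mult_pos ch1 ch2) auto
          then show "real m * \<tau> < (\<Sum>i<m. log 2 (cond_ratio (src12 p) ((s1_of (u ! i), s2_of (u ! i)), wk (u ! i))))
              + (\<Sum>j<n. log 2 (chan_ratio P1 a (x1 ! j, fst (map \<pi> y ! j)) * chan_ratio P2 c (x2 ! j, snd (map \<pi> y ! j))))"
            using s(3) s4 s5 scaled(3) unfolding l12_def by linarith
        qed auto
        ultimately show ?thesis
          using len by (simp add: accepts_def prod.distrib)
      qed
      \<comment> \<open>The inclusion is available on the support of \<open>T\<close> only, where
        lengths and positivity are guaranteed.\<close>
      have "measure_pmf.prob T {(u, x1, x2, y). \<not> accepts (2 powr (real m * \<tau>)) m n p a c P1 P2
            (map s1_of u) (map s2_of u) x1 x2 (map \<pi> y, map wk u)}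
          \<le> measure_pmf.prob T (B1 \<union> B2 \<union> B3 \<union> B4 \<union> B5)"
      proof (intro measure_pmf.finite_measure_mono_AE)
        show "AE z in measure_pmf T. z \<in> {(u, x1, x2, y). \<not> accepts (2 powr (real m * \<tau>)) m n p a c P1 P2
            (map s1_of u) (map s2_of u) x1 x2 (map \<pi> y, map wk u)} \<longrightarrow> z \<in> B1 \<union> B2 \<union> B3 \<union> B4 \<union> B5"
          unfolding AE_measure_pmf_iff using good by blast
      qed auto
      also have "\<dots> \<le> measure_pmf.prob T B1 + measure_pmf.prob T B2 + measure_pmf.prob T B3
          + measure_pmf.prob T B4 + measure_pmf.prob T B5"
        by (intro order.trans[OF measure_Un_le] add_right_mono) auto
      also have "\<dots> \<le> \<eta>" using bad by linarith
      finally show ?case unfolding T_def V_def m_def n_def .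
    qed
  qed
qed

section \<open>Signs of entropy and information, and the direct part\<close>

lemma cond_ent_nonneg: "cond_ent q \<ge> 0"
proof -
  have "pmf q st * log 2 (pmf q st / pmf (map_pmf snd q) (snd st)) \<le> 0" for st
  proof (cases "st \<in> set_pmf q")
    case True
    have "pmf q st \<le> pmf (map_pmf snd q) (snd st)"
      unfolding pmf_map by (subst measure_pmf_single[symmetric])
        (intro measure_pmf.finite_measure_mono, auto)
    moreover have "pmf q st > 0" using True by (rule pmf_positive)
    ultimately show ?thesis by (intro mult_nonneg_nonpos) (auto simp: divide_le_eq_1)
  qed (simp add: set_pmf_iff)
  then show ?thesis unfolding cond_ent_def by (simp add: sum_nonpos)
qed

text \<open>Gibbs' inequality for the reciprocal channel ratio. Its mean can be below 1, because
  pairs with \<open>pmf (a x) y = 0\<close> drop out of the sum.\<close>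

lemma mut_inf_chan_joint_nonneg:
  fixes a :: "'x::finite \<Rightarrow> 'y::finite pmf"
  shows "mut_inf (chan_joint Q a) \<ge> 0"
proof -
  have "expct (chan_joint Q a) (\<lambda>xy. log 2 (1 / chan_ratio Q a xy)) \<le> 0"
  proof (rule expct_log_nonpos)
    have "expct (chan_joint Q a) (\<lambda>xy. 1 / chan_ratio Q a xy)
        = expct Q (\<lambda>x. expct (a x) (\<lambda>y. 1 / chan_ratio Q a (x, y)))"
      by (simp add: expct_bind)
    also have "\<dots> = (\<Sum>x\<in>UNIV. \<Sum>y\<in>UNIV. pmf Q x * (pmf (a x) y * (pmf (bind_pmf Q a) y / pmf (a x) y)))"
      by (simp add: expct_UNIV chan_ratio_def sum_distrib_left)
    also have "\<dots> \<le> (\<Sum>x\<in>UNIV. \<Sum>y\<in>UNIV. pmf Q x * pmf (bind_pmf Q a) y)"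
      by (intro sum_mono mult_left_mono) auto
    also have "\<dots> = 1"
      by (simp add: sum_pmf_eq_1 flip: sum_distrib_left)
    finally show "expct (chan_joint Q a) (\<lambda>xy. 1 / chan_ratio Q a xy) \<le> 1" .
  qed (use chan_ratio_pos[of _ Q a] in \<open>auto simp del: set_bind_pmf\<close>)
  moreover have "expct (chan_joint Q a) (\<lambda>xy. log 2 (1 / chan_ratio Q a xy))
      = expct (chan_joint Q a) (\<lambda>xy. 0 - log 2 (chan_ratio Q a xy))"
  proof (intro expct_cong)
    fix xy assume "xy \<in> set_pmf (chan_joint Q a)"
    from chan_ratio_pos[OF this] show "log 2 (1 / chan_ratio Q a xy) = 0 - log 2 (chan_ratio Q a xy)"
      by (simp add: log_divide)
  qed
  ultimately show ?thesis
    by (subst (asm) expct_diff) (auto simp: expct_log_chan_ratio)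
qed

lemma direct_part:
  fixes P :: "('s1::finite \<times> 's2::finite \<times> 'w1::finite \<times> 'w2::finite) pmf"
    and W :: "'x1::finite \<Rightarrow> 'x2::finite \<Rightarrow>
              (('y11::finite \<times> 'y21::finite) \<times> ('y12::finite \<times> 'y22::finite)) pmf"
  assumes no_int: "\<And>x1 x2 y11 y21 y12 y22.
       pmf (W x1 x2) ((y11, y21), (y12, y22)) = pmf (q1 x1) (y11, y12) * pmf (q2 x2) (y21, y22)"
    and rat: "b \<in> \<rat>" and conds: "rate_conds (<) b P W P1 P2"
  shows "achievable P W b"
proof -
  define pA where "pA = map_pmf (\<lambda>u. (s1_of u, s2_of u, w1_of u)) P"
  define pB where "pB = map_pmf (\<lambda>u. (s1_of u, s2_of u, w2_of u)) P"
  define aA where "aA = (\<lambda>x. map_pmf fst (q1 x))"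
  define cA where "cA = (\<lambda>x. map_pmf fst (q2 x))"
  define aB where "aB = (\<lambda>x. map_pmf snd (q1 x))"
  define cB where "cB = (\<lambda>x. map_pmf snd (q2 x))"
  have rc: "map_pmf fst (W x1 x2) = pair_pmf (aA x1) (cA x2)"
    "map_pmf snd (W x1 x2) = pair_pmf (aB x1) (cB x2)" for x1 x2
    using receiver_channels[where W=W and ?q1.0=q1 and ?q2.0=q2, OF no_int]
    unfolding aA_def cA_def aB_def cB_def by auto
  have conds': "recv_conds (<) b pA aA cA P1 P2" "recv_conds (<) b pB aB cB P1 P2"
    using conds unfolding rate_conds_iff_recv_conds[where W=W and ?q1.0=q1 and ?q2.0=q2, OF no_int]
      pA_def aA_def cA_def pB_def aB_def cB_def by auto
  \<comment> \<open>A strict rate condition puts a nonnegative entropy below \<open>b\<close> times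
    a nonnegative information, which forces \<open>b > 0\<close>, as positive block lengths
    require.\<close>
  have "0 < b * mut_inf (chan_joint P1 aA)"
    using conds'(1) cond_ent_nonneg[of "src1 pA"] by (auto simp: recv_conds_def intro: order.strict_trans1)
  then have "b > 0" using mut_inf_chan_joint_nonneg[of P1 aA] by (simp add: zero_less_mult_iff)
  with rat obtain n0 m0 :: nat where b: "b = real n0 / real m0" and m0: "m0 > 0"
    by (elim Rats_abs_nat_div_natE) auto
  have n0: "n0 > 0" using b \<open>b > 0\<close> by (cases n0) auto
  \<comment> \<open>Each receiver has its own exponent, since the slack in its conditions
    differs.\<close>
  obtain \<tau>A where \<tau>A: "\<tau>A > 0" and evA: "\<And>\<eta>. \<eta> > 0 \<Longrightarrow> \<forall>\<^sub>F L in sequentially.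
    measure_pmf.prob (pair_pmf (replicate_pmf (m0 * L) P)
        (in_joint (replicate_pmf (n0 * L) P1) (replicate_pmf (n0 * L) P2) (\<lambda>x1 x2. seq_pmf (map2 W x1 x2))))
     {(u, x1, x2, y). \<not> accepts (2 powr (real (m0 * L) * \<tau>A)) (m0 * L) (n0 * L) pA aA cA P1 P2
        (map s1_of u) (map s2_of u) x1 x2 (map fst y, map w1_of u)} \<le> \<eta>"
    using true_accepts[where \<pi>=fst and W=W and wk=w1_of and P=P, OF rc(1) m0 n0 b conds'(1)[unfolded pA_def]]
    unfolding pA_def by blast
  obtain \<tau>B where \<tau>B: "\<tau>B > 0" and evB: "\<And>\<eta>. \<eta> > 0 \<Longrightarrow> \<forall>\<^sub>F L in sequentially.
    measure_pmf.prob (pair_pmf (replicate_pmf (m0 * L) P)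
        (in_joint (replicate_pmf (n0 * L) P1) (replicate_pmf (n0 * L) P2) (\<lambda>x1 x2. seq_pmf (map2 W x1 x2))))
     {(u, x1, x2, y). \<not> accepts (2 powr (real (m0 * L) * \<tau>B)) (m0 * L) (n0 * L) pB aB cB P1 P2
        (map s1_of u) (map s2_of u) x1 x2 (map snd y, map w2_of u)} \<le> \<eta>"
    using true_accepts[where \<pi>=snd and W=W and wk=w2_of and P=P, OF rc(2) m0 n0 b conds'(2)[unfolded pB_def]]
    unfolding pB_def by blast
  have evG: "\<forall>\<^sub>F L in sequentially. 3 / 2 powr (real (m0 * L) * \<tau>) \<le> \<eta>" if "\<tau> > 0" "\<eta> > 0" for \<tau> \<eta>
  proof -
    have "(\<lambda>L. 3 / 2 powr (real m0 * real L * \<tau>)) \<longlonglongrightarrow> 0" using that(1) m0 by real_asymp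
    then have "\<forall>\<^sub>F L in sequentially. 3 / 2 powr (real m0 * real L * \<tau>) < \<eta>"
      using that(2) by (intro order_tendstoD)
    then show ?thesis by eventually_elim simp
  qed
  show ?thesis
    unfolding achievable_def
  proof (intro allI impI)
    fix \<epsilon> :: real assume "\<epsilon> > 0"
    \<comment> \<open>Two receivers, each with a rejected true pair or an accepted wrong one, give
      at most \<open>4 * \<epsilon> / 5\<close>, strictly below \<open>\<epsilon>\<close>.\<close>
    then have \<eta>: "\<epsilon> / 5 > 0" by simp
    have "\<forall>\<^sub>F L in sequentially. L > (0::nat) \<and>
      measure_pmf.prob (pair_pmf (replicate_pmf (m0 * L) P)
        (in_joint (replicate_pmf (n0 * L) P1) (replicate_pmf (n0 * L) P2) (\<lambda>x1 x2. seq_pmf (map2 W x1 x2))))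
       {(u, x1, x2, y). \<not> accepts (2 powr (real (m0 * L) * \<tau>A)) (m0 * L) (n0 * L) pA aA cA P1 P2
        (map s1_of u) (map s2_of u) x1 x2 (map fst y, map w1_of u)} \<le> \<epsilon> / 5 \<and>
      measure_pmf.prob (pair_pmf (replicate_pmf (m0 * L) P)
        (in_joint (replicate_pmf (n0 * L) P1) (replicate_pmf (n0 * L) P2) (\<lambda>x1 x2. seq_pmf (map2 W x1 x2))))
       {(u, x1, x2, y). \<not> accepts (2 powr (real (m0 * L) * \<tau>B)) (m0 * L) (n0 * L) pB aB cB P1 P2
        (map s1_of u) (map s2_of u) x1 x2 (map snd y, map w2_of u)} \<le> \<epsilon> / 5 \<and>
      3 / 2 powr (real (m0 * L) * \<tau>A) \<le> \<epsilon> / 5 \<and> 3 / 2 powr (real (m0 * L) * \<tau>B) \<le> \<epsilon> / 5"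
      by (intro eventually_conj eventually_gt_at_top evA evB evG \<tau>A \<tau>B \<eta>)
    then obtain L where L: "L > 0"
      and tA: "measure_pmf.prob (pair_pmf (replicate_pmf (m0 * L) P)
        (in_joint (replicate_pmf (n0 * L) P1) (replicate_pmf (n0 * L) P2) (\<lambda>x1 x2. seq_pmf (map2 W x1 x2))))
       {(u, x1, x2, y). \<not> accepts (2 powr (real (m0 * L) * \<tau>A)) (m0 * L) (n0 * L) pA aA cA P1 P2
        (map s1_of u) (map s2_of u) x1 x2 (map fst y, map w1_of u)} \<le> \<epsilon> / 5"
      and tB: "measure_pmf.prob (pair_pmf (replicate_pmf (m0 * L) P)
        (in_joint (replicate_pmf (n0 * L) P1) (replicate_pmf (n0 * L) P2) (\<lambda>x1 x2. seq_pmf (map2 W x1 x2))))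
       {(u, x1, x2, y). \<not> accepts (2 powr (real (m0 * L) * \<tau>B)) (m0 * L) (n0 * L) pB aB cB P1 P2
        (map s1_of u) (map s2_of u) x1 x2 (map snd y, map w2_of u)} \<le> \<epsilon> / 5"
      and gA: "3 / 2 powr (real (m0 * L) * \<tau>A) \<le> \<epsilon> / 5" and gB: "3 / 2 powr (real (m0 * L) * \<tau>B) \<le> \<epsilon> / 5"
      using eventually_happens'[OF sequentially_bot] by blast
    define m where "m = m0 * L"
    define n where "n = n0 * L"
    have mn: "m > 0" "n > 0" "real n / real m = b" using L m0 n0 b by (auto simp: m_def n_def)
    let ?Q1 = "replicate_pmf n P1" and ?Q2 = "replicate_pmf n P2"
    let ?C = "\<lambda>x1 x2. seq_pmf (map2 W x1 x2)"
    let ?A1 = "{s::'s1 list. length s = m}" and ?A2 = "{s::'s2 list. length s = m}"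
    have "\<exists>F1 F2 g1 g2. (\<forall>s\<in>?A1. F1 s \<in> set_pmf ?Q1) \<and> (\<forall>t\<in>?A2. F2 t \<in> set_pmf ?Q2) \<and>
      measure_pmf.prob (bind_pmf (replicate_pmf m P) (\<lambda>u. map_pmf (Pair u) (?C (F1 (map s1_of u)) (F2 (map s2_of u)))))
       {(u, y). \<not> (g1 (map fst y, map w1_of u) = (map s1_of u, map s2_of u)
          \<and> g2 (map snd y, map w2_of u) = (map s1_of u, map s2_of u))} \<le> 2 * (\<epsilon> / 5 + \<epsilon> / 5)"
    proof (rule random_coding_exists[where
          ?acc1.0="accepts (2 powr (real m * \<tau>A)) m n pA aA cA P1 P2"
          and ?acc2.0="accepts (2 powr (real m * \<tau>B)) m n pB aB cB P1 P2"])
      fix u assume "u \<in> set_pmf (replicate_pmf m P)"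
      then have len: "length u = m" by (rule length_replicate_pmf)
      show "map s1_of u \<in> ?A1" "map s2_of u \<in> ?A2" using len by auto
      show "measure_pmf.prob (random_code_pmf ?A1 ?A2 ?Q1 ?Q2 ?C (map s1_of u) (map s2_of u))
         {(F1, F2, y). \<exists>s\<in>?A1. \<exists>t\<in>?A2. (s, t) \<noteq> (map s1_of u, map s2_of u) \<and>
           accepts (2 powr (real m * \<tau>A)) m n pA aA cA P1 P2 s t (F1 s) (F2 t) (map fst y, map w1_of u)} \<le> \<epsilon> / 5"
        using gA len unfolding m_def[symmetric]
        by (intro order.trans[OF false_accepts]) auto
      show "measure_pmf.prob (random_code_pmf ?A1 ?A2 ?Q1 ?Q2 ?C (map s1_of u) (map s2_of u))
         {(F1, F2, y). \<exists>s\<in>?A1. \<exists>t\<in>?A2. (s, t) \<noteq> (map s1_of u, map s2_of u) \<and>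
           accepts (2 powr (real m * \<tau>B)) m n pB aB cB P1 P2 s t (F1 s) (F2 t) (map snd y, map w2_of u)} \<le> \<epsilon> / 5"
        using gB len unfolding m_def[symmetric]
        by (intro order.trans[OF false_accepts]) auto
    qed (use tA tB in \<open>simp_all add: finite_length_eq m_def n_def\<close>)
    then obtain F1 F2 g1 g2 where F: "\<forall>s\<in>?A1. F1 s \<in> set_pmf ?Q1" "\<forall>t\<in>?A2. F2 t \<in> set_pmf ?Q2"
      and err: "measure_pmf.prob (bind_pmf (replicate_pmf m P) (\<lambda>u. map_pmf (Pair u) (?C (F1 (map s1_of u)) (F2 (map s2_of u)))))
       {(u, y). \<not> (g1 (map fst y, map w1_of u) = (map s1_of u, map s2_of u)
          \<and> g2 (map snd y, map w2_of u) = (map s1_of u, map s2_of u))} \<le> 2 * (\<epsilon> / 5 + \<epsilon> / 5)"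
      by blast
    have len: "\<And>s. length s = m \<Longrightarrow> length (F1 s) = n" "\<And>t. length t = m \<Longrightarrow> length (F2 t) = n"
      using F by (auto intro: length_replicate_pmf)
    have "err_prob P W m n F1 F2 (\<lambda>y w. g1 (y, w)) (\<lambda>y w. g2 (y, w)) < \<epsilon>"
      using err \<open>\<epsilon> > 0\<close> len
      by (subst err_prob_eq_prob) (auto simp: code_pmf_def)
    then show "\<exists>m n f1 f2 g1 g2. 0 < m \<and> 0 < n \<and> real n / real m = b \<and>
       (\<forall>s. length s = m \<longrightarrow> length (f1 s) = n) \<and> (\<forall>s. length s = m \<longrightarrow> length (f2 s) = n) \<and>
       err_prob P W m n f1 f2 g1 g2 < \<epsilon>"
      using mn len by (intro exI[of _ m] exI[of _ n] exI[of _ F1] exI[of _ F2]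
        exI[of _ "\<lambda>y w. g1 (y, w)"] exI[of _ "\<lambda>y w. g2 (y, w)"] conjI) auto
  qed
qed

theorem theorem7:
  fixes P :: "('s1::finite \<times> 's2::finite \<times> 'w1::finite \<times> 'w2::finite) pmf"
    and W :: "'x1::finite \<Rightarrow> 'x2::finite \<Rightarrow>
              (('y11::finite \<times> 'y21::finite) \<times> ('y12::finite \<times> 'y22::finite)) pmf"
    and q1 :: "'x1 \<Rightarrow> ('y11 \<times> 'y12) pmf"
    and q2 :: "'x2 \<Rightarrow> ('y21 \<times> 'y22) pmf"
    and b :: real
  assumes no_interference:
    "\<And>x1 x2 y11 y21 y12 y22.
       pmf (W x1 x2) ((y11, y21), (y12, y22)) = pmf (q1 x1) (y11, y12) * pmf (q2 x2) (y21, y22)"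
  shows "((b \<in> \<rat> \<and> (\<exists>P1 P2. rate_conds (<) b P W P1 P2)) \<longrightarrow> achievable P W b)
         \<and> (achievable P W b \<longrightarrow> (\<exists>P1 P2. rate_conds (\<le>) b P W P1 P2))"
  using direct_part[where W=W and ?q1.0=q1 and ?q2.0=q2, OF no_interference]
    converse_part[where W=W and ?q1.0=q1 and ?q2.0=q2, OF no_interference] by blast

end
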